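(* Let $d\ge 1$, $T>0$, $\eta_0>0$, and $0<\varepsilon\le T$. Let $a,b,\chi\in C^\infty(\mathbb R^d)$ be real-valued with all derivatives bounded, such that $\underline a\le a(x)\le \bar a$, $\underline b\le b(x)\le \bar b$ for positive constants $\underline a,\bar a,\underline b,\bar b$, and $\chi\ge 0$. Define $$\eta_\varepsilon(t)=\begin{cases}\eta_0\varepsilon^{-1}, & |t-T|<\varepsilon/2,\\ 0,&\text{otherwise}.\end{cases}$$ Let $u_0\in H^3(\mathbb R^d)$ and $u_1\in H^2(\mathbb R^d)$ be real-valued, and let $u_\varepsilon$ be the unique solution, with $u_\varepsilon\in L^\infty_{\rm loc}(\mathbb R_+,H^3(\mathbb R^d))$ and $\partial_t^2u_\varepsilon\in L^\infty_{\rm loc}(\mathbb R_+,H^1(\mathbb R^d))$, of $$\partial_t^2u_\varepsilon=a(x)\nabla\cdot\Big(b(x)\big(1+\chi(x)\eta_\varepsilon(t)\big)\nabla u_\varepsilon\Big)\quad\text{on }\mathbb R_+\times\mathbb R^d,\qquad u_\varepsilon(0)=u_0,\ \partial_tu_\varepsilon(0)=u_1.$$ Then: (i) for every $\tau>0$ there is $C=C(a,b,\chi,\eta_0,\tau)$, independent of $\varepsilon$, such that $$\|u_\varepsilon\|_{L^\infty(0,\tau;H^2(\mathbb R^d))}+\|\partial_tu_\varepsilon\|_{L^\infty(0,\tau;H^1(\mathbb R^d))}\le C\|u_0\|_{H^3}+C\|u_1\|_{H^2}.$$ (ii) Let $U$ be the unperturbed solution, i.e. the solution of $\partial_t^2U=a\nabla\cdot(b\nabla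 U)$ with $U(0)=u_0$, $\partial_tU(0)=u_1$. Let $(\mathbf W_\varepsilon,w_\varepsilon)$, with $\mathbf W_\varepsilon$ taking values in $\mathbb R^d$ and $w_\varepsilon$ scalar, be the solution of $$b^{-1}\partial_t\mathbf W_\varepsilon+\nabla w_\varepsilon=-\chi\,\eta_\varepsilon(t)\,\nabla(u_\varepsilon-U),\qquad a^{-1}\partial_tw_\varepsilon+\nabla\cdot\mathbf W_\varepsilon=0,\qquad \mathbf W_\varepsilon(0)=0,\ w_\varepsilon(0)=0.$$ Then for every $\tau>0$ there is $C=C(a,b,\chi,\eta_0,\tau,u_0,u_1)$, independent of $\varepsilon$, such that $$\|\mathbf W_\varepsilon\|_{L^\infty(0,\tau;H^{-1}(\mathbb R^d))}+\|w_\varepsilon\|_{L^\infty(0,\tau;L^2(\mathbb R^d))}\le C\varepsilon.$$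
   Context: The equation models a wave field perturbed by an "instantaneous time mirror" acting at time $T$: $\eta_\varepsilon$ approximates $\eta_0\delta(t-T)$. The pair $(\mathbf W_\varepsilon,w_\varepsilon)$ is the correction term $\mathbf R_\varepsilon$ in the decomposition of the first-order formulation $\mathbf u_\varepsilon=(\mathbf v_\varepsilon,u_\varepsilon)$ (with $[b(1+\chi\eta_\varepsilon)]^{-1}\partial_t\mathbf v_\varepsilon+\nabla u_\varepsilon=0$, $a^{-1}\partial_tu_\varepsilon+\nabla\cdot\mathbf v_\varepsilon=0$) as unperturbed wave + time-reversed wave + forward wave + $\mathbf R_\varepsilon$; equivalently $\mathbf R_\varepsilon$ is obtained by propagating, with the unperturbed first-order system, the source $-\chi\eta_\varepsilon(\nabla(u_\varepsilon-U),0)$ from zero initial data. $H^s$ denotes the Sobolev space on $\mathbb R^d$. *)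

theory Defs
  imports "HOL-Analysis.Analysis"
begin

definition pdx :: "'n::finite \<Rightarrow> (real^'n \<Rightarrow> real) \<Rightarrow> real^'n \<Rightarrow> real" where
  "pdx i f x = deriv (\<lambda>h. f (x + h *\<^sub>R axis i 1)) 0"

fun pds :: "'n::finite list \<Rightarrow> (real^'n \<Rightarrow> real) \<Rightarrow> real^'n \<Rightarrow> real" where
  "pds [] f = f"
| "pds (i # is) f = pdx i (pds is f)"

definition smooth :: "(real^'n::finite \<Rightarrow> real) \<Rightarrow> bool" where
  "smooth f \<longleftrightarrow> (\<forall>is. \<forall>x. pds is f differentiable (at x))"

definition smooth_bdd :: "(real^'n::finite \<Rightarrow> real) \<Rightarrow> bool" where
  "smooth_bdd f \<longleftrightarrow> smooth f \<and> (\<forall>is. bounded (range (pds is f)))"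

definition test_fun :: "(real^'n::finite \<Rightarrow> real) \<Rightarrow> bool" where
  "test_fun \<phi> \<longleftrightarrow> smooth \<phi> \<and> compact (closure {x. \<phi> x \<noteq> 0})"

definition L2 :: "(real^'n::finite \<Rightarrow> real) \<Rightarrow> bool" where
  "L2 f \<longleftrightarrow> f \<in> borel_measurable lborel \<and> integrable lborel (\<lambda>x. (f x)\<^sup>2)"

definition L2norm :: "(real^'n::finite \<Rightarrow> real) \<Rightarrow> real" where
  "L2norm f = sqrt (LINT x|lborel. (f x)\<^sup>2)"

definition weak_deriv :: "'n::finite list \<Rightarrow> (real^'n \<Rightarrow> real) \<Rightarrow> (real^'n \<Rightarrow> real) \<Rightarrow> bool" where
  "weak_deriv is f g \<longleftrightarrow> (\<forall>\<phi>. test_fun \<phi> \<longrightarrow>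
      (LINT x|lborel. f x * pds is \<phi> x) = (-1) ^ length is * (LINT x|lborel. g x * \<phi> x))"

definition sobolev :: "nat \<Rightarrow> (real^'n::finite \<Rightarrow> real) \<Rightarrow> bool" where
  "sobolev k f \<longleftrightarrow> L2 f \<and> (\<forall>is::'n list. length is \<le> k \<longrightarrow> (\<exists>g. L2 g \<and> weak_deriv is f g))"

definition wd :: "'n::finite list \<Rightarrow> (real^'n \<Rightarrow> real) \<Rightarrow> real^'n \<Rightarrow> real" where
  "wd is f = (SOME g. L2 g \<and> weak_deriv is f g)"

text \<open>H^k norm (sum over ordered lists of directions of length \<le> k; equivalent to the usual norm).\<close>
definition Hnorm :: "nat \<Rightarrow> (real^'n::finite \<Rightarrow> real) \<Rightarrow> real" where
  "Hnorm k f = sqrt (\<Sum>is\<in>{is::'n list. length is \<le> k}. (L2norm (wd is f))\<^sup>2)"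

text \<open>H^{-1} norm (dual norm against H^1, via density of test functions).\<close>
definition Hm1norm :: "(real^'n::finite \<Rightarrow> real) \<Rightarrow> real" where
  "Hm1norm f = Sup {\<bar>LINT x|lborel. f x * \<phi> x\<bar> | \<phi>. test_fun \<phi> \<and> Hnorm 1 \<phi> \<le> 1}"

definition vcomp :: "(real^'n::finite \<Rightarrow> real^'n) \<Rightarrow> 'n \<Rightarrow> real^'n \<Rightarrow> real" where
  "vcomp W i = (\<lambda>x. W x $ i)"

definition Hm1norm_vec :: "(real^'n::finite \<Rightarrow> real^'n) \<Rightarrow> real" where
  "Hm1norm_vec W = (\<Sum>i\<in>UNIV. Hm1norm (vcomp W i))"

definition wgrad :: "(real^'n::finite \<Rightarrow> real) \<Rightarrow> real^'n \<Rightarrow> real^'n" where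
  "wgrad f = (\<lambda>x. \<chi> i. wd [i] f x)"

definition wdiv :: "(real^'n::finite \<Rightarrow> real^'n) \<Rightarrow> real^'n \<Rightarrow> real" where
  "wdiv W = (\<lambda>x. \<Sum>i\<in>UNIV. wd [i] (vcomp W i) x)"

definition H_deriv :: "nat \<Rightarrow> (real \<Rightarrow> real^'n::finite \<Rightarrow> real) \<Rightarrow> (real \<Rightarrow> real^'n \<Rightarrow> real) \<Rightarrow> real \<Rightarrow> bool" where
  "H_deriv k u v t \<longleftrightarrow>
     ((\<lambda>s. Hnorm k (\<lambda>x. (u s x - u t x) / (s - t) - v t x)) \<longlongrightarrow> 0) (at t within {0..})"

definition eta :: "real \<Rightarrow> real \<Rightarrow> real \<Rightarrow> real \<Rightarrow> real" where
  "eta eta0 T \<epsilon> t = (if \<bar>t - T\<bar> < \<epsilon> / 2 then eta0 / \<epsilon> else 0)"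

text \<open>Solution (in the class u \<in> L^\<infinity>_loc(R_+,H^3), \<partial>_t^2 u \<in> L^\<infinity>_loc(R_+,H^1)) of
  \<partial>_t^2 u = a div(b c(t) grad u), u(0) = u0, \<partial>_t u(0) = u1, with time derivative v = \<partial>_t u.
  Concretely: u(t) \<in> H^3 locally uniformly, u is C^1 into H^1 with derivative v,
  v is locally Lipschitz into H^1 and for a.e. t its H^1-derivative z(t) satisfies the equation.\<close>
definition wave_sol ::
  "(real^'n::finite \<Rightarrow> real) \<Rightarrow> (real^'n \<Rightarrow> real) \<Rightarrow> (real \<Rightarrow> real^'n \<Rightarrow> real)
   \<Rightarrow> (real^'n \<Rightarrow> real) \<Rightarrow> (real^'n \<Rightarrow> real)
   \<Rightarrow> (real \<Rightarrow> real^'n \<Rightarrow> real) \<Rightarrow> (real \<Rightarrow> real^'n \<Rightarrow> real) \<Rightarrow> bool" where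
  "wave_sol a b c u0 u1 u v \<longleftrightarrow>
     (\<forall>t\<ge>0. sobolev 3 (u t) \<and> sobolev 1 (v t)) \<and>
     (\<forall>\<tau>. \<exists>M. \<forall>t\<in>{0..\<tau>}. Hnorm 3 (u t) \<le> M) \<and>
     (\<forall>t\<ge>0. H_deriv 1 u v t) \<and>
     (\<forall>\<tau>. \<exists>L. \<forall>s\<in>{0..\<tau>}. \<forall>t\<in>{0..\<tau>}. Hnorm 1 (\<lambda>x. v s x - v t x) \<le> L * \<bar>s - t\<bar>) \<and>
     (\<exists>z. AE t in lborel. t > 0 \<longrightarrow>
          sobolev 1 (z t) \<and> H_deriv 1 v z t \<and>
          (AE x in lborel. z t x =
              a x * (\<Sum>i\<in>UNIV. wd [i] (\<lambda>y. b y * c t y * wd [i] (u t) y) x))) \<and>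
     (AE x in lborel. u 0 x = u0 x) \<and> (AE x in lborel. v 0 x = u1 x)"

definition fo_sol ::
  "(real^'n::finite \<Rightarrow> real) \<Rightarrow> (real^'n \<Rightarrow> real) \<Rightarrow> (real \<Rightarrow> real^'n \<Rightarrow> real^'n)
   \<Rightarrow> (real \<Rightarrow> real^'n \<Rightarrow> real^'n) \<Rightarrow> (real \<Rightarrow> real^'n \<Rightarrow> real) \<Rightarrow> bool" where
  "fo_sol a b F W w \<longleftrightarrow>
     (\<forall>t\<ge>0. sobolev 1 (w t) \<and> (\<forall>i. sobolev 1 (vcomp (W t) i))) \<and>
     (\<forall>\<tau>. \<exists>M. \<forall>t\<in>{0..\<tau>}. Hnorm 1 (w t) \<le> M \<and> (\<forall>i. Hnorm 1 (vcomp (W t) i) \<le> M)) \<and>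
     (\<forall>\<tau>. \<exists>L. \<forall>s\<in>{0..\<tau>}. \<forall>t\<in>{0..\<tau>}.
          L2norm (\<lambda>x. w s x - w t x) \<le> L * \<bar>s - t\<bar> \<and>
          (\<forall>i. L2norm (\<lambda>x. W s x $ i - W t x $ i) \<le> L * \<bar>s - t\<bar>)) \<and>
     (\<exists>Wt wt. AE t in lborel. t > 0 \<longrightarrow>
          L2 (wt t) \<and> (\<forall>i. L2 (vcomp (Wt t) i)) \<and>
          H_deriv 0 w wt t \<and> (\<forall>i. H_deriv 0 (\<lambda>s. vcomp (W s) i) (\<lambda>s. vcomp (Wt s) i) t) \<and>
          (AE x in lborel. Wt t x /\<^sub>R b x + wgrad (w t) x = F t x) \<and>
          (AE x in lborel. wt t x / a x + wdiv (W t) x = 0)) \<and>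
     (AE x in lborel. W 0 x = 0) \<and> (AE x in lborel. w 0 x = 0)"

end

theory Submission
  imports Defs
begin

text \<open>
  Everything is an energy estimate in \<open>L\<^sup>2\<close>, regarded as an inner product space of classes of functions,
  where the weak derivative is the generator of the translation group.

  Before the mirror acts, the energies of \<open>D \<partial>\<^sub>k u\<close> with difference quotients \<open>D\<close> bound \<open>u\<close> in \<open>H\<^sup>3\<close>; difference
  quotients are needed because second derivatives of \<open>\<partial>\<^sub>t u\<close> are not known to exist.
  While it acts, on an interval of length \<open>\<epsilon>\<close> starting at \<open>s\<close>, the coefficient is \<open>b (1 + \<kappa> \<chi>)\<close> with \<open>\<kappa> = \<eta>\<^sub>0 / \<epsilon>\<close>,
  and the potential energy of \<open>u\<close> has size \<open>1 / \<epsilon>\<close>. The energy of \<open>u - u(s)\<close> starts without a potential part and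
  grows at rate \<open>1 + \<kappa>\<close>, hence only by a bounded factor; the price is the source \<open>u(s)\<close>, which must
  lie in \<open>H\<^sup>3\<close>. This is the loss of one derivative. Afterwards the unperturbed estimate applies again.

  For the corrector, \<open>u = U\<close> up to time \<open>s\<close> and \<open>\<partial>\<^sub>t(u - U)\<close> is bounded in \<open>H\<^sup>1\<close>, so that \<open>\<nabla>(u - U) = O(\<epsilon>)\<close> while
  the mirror acts. The source is then \<open>O(1)\<close> for a time \<open>\<epsilon>\<close>, and already the \<open>L\<^sup>2\<close> norm of \<open>W\<close> is \<open>O(\<epsilon>)\<close>.
\<close>

section \<open>The space of square integrable functions\<close>

text \<open>Two features of the solution class shape the argument. The second time derivative exists
  only for almost every \<open>t\<close>, so each energy inequality is an a.e. differential
  inequality for a Lipschitz function. This is why a Lipschitz property accompanies every energy,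
  while its constant may be arbitrarily bad. Moreover \<open>v\<close> has just one space
  derivative, so for a first derivative of \<open>u\<close> the velocity is merely in L^2 and the
  Dirichlet form cannot be differentiated under the gradient. Instead the difference of two values
  of the form is integrated by parts onto \<open>Qop\<close>, which stays bounded and is weakly
  continuous in time.

  The H^3 bound before the pulse does not close by Gronwall alone: the error for a single difference
  quotient contains all third derivatives of \<open>u\<close>. It closes by absorption. The supremum
  of the squared H^3 norm, weighted by a decaying exponential of rate \<open>lam\<close>, is finite
  because the solution class is locally bounded in H^3, and it returns on the right with a factor
  that is small for large \<open>lam\<close>.\<close>

lemma L2_integrable_mult:
  assumes "L2 f" "L2 g"
  shows "integrable lborel (\<lambda>x. f x * g x)"
proof (rule Bochner_Integration.integrable_bound)
  show "integrable lborel (\<lambda>x. (f x)\<^sup>2 + (g x)\<^sup>2)"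
    using assms by (auto simp: L2_def)
  show "(\<lambda>x. f x * g x) \<in> borel_measurable lborel"
    using assms by (auto simp: L2_def)
  have "\<bar>f x * g x\<bar> \<le> (f x)\<^sup>2 + (g x)\<^sup>2" for x
    using sum_squares_bound[of "\<bar>f x\<bar>" "\<bar>g x\<bar>"] mult_nonneg_nonneg[of "\<bar>f x\<bar>" "\<bar>g x\<bar>"]
    unfolding abs_mult power2_abs by linarith
  then show "AE x in lborel. norm (f x * g x) \<le> norm ((f x)\<^sup>2 + (g x)\<^sup>2)"
    by simp
qed

lemma L2_add: assumes "L2 f" "L2 g" shows "L2 (\<lambda>x. f x + g x)"
proof -
  have "integrable lborel (\<lambda>x. (f x)\<^sup>2 + (g x)\<^sup>2 + 2 * (f x * g x))"
    using assms L2_integrable_mult[OF assms] by (auto simp: L2_def)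
  then show ?thesis
    using assms by (auto simp: L2_def power2_sum mult.assoc)
qed

lemma L2_scale: assumes "L2 f" shows "L2 (\<lambda>x. c * f x)"
  using assms by (auto simp: L2_def power_mult_distrib)

lemma L2_minus: assumes "L2 f" shows "L2 (\<lambda>x. - f x)"
  using L2_scale[OF assms, of "-1"] by simp

lemma L2_diff: assumes "L2 f" "L2 g" shows "L2 (\<lambda>x. f x - g x)"
  using L2_add[OF assms(1) L2_minus[OF assms(2)]] by simp

lemma L2_zero [simp]: "L2 (\<lambda>x. 0)"
  by (simp add: L2_def)

lemma L2_dominated:
  assumes "L2 g" "f \<in> borel_measurable lborel" "\<And>x. \<bar>f x\<bar> \<le> \<bar>g x\<bar>"
  shows "L2 f"
  unfolding L2_def
proof
  show "integrable lborel (\<lambda>x. (f x)\<^sup>2)"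
    by (rule Bochner_Integration.integrable_bound[of _ "\<lambda>x. (g x)\<^sup>2"])
      (use assms in \<open>auto simp: L2_def abs_le_square_iff\<close>)
qed fact

text \<open>Square integrability is part of the relation, which is therefore only a partial
  equivalence. The class of any other function is unspecified, and so the computation rules for
  \<open>cls\<close> carry \<open>L2\<close> hypotheses.\<close>

definition l2rel :: "(real^'n::finite \<Rightarrow> real) \<Rightarrow> (real^'n \<Rightarrow> real) \<Rightarrow> bool" where
  "l2rel f g \<longleftrightarrow> L2 f \<and> L2 g \<and> (AE x in lborel. f x = g x)"

lemma part_equivp_l2rel: "part_equivp l2rel"
proof (rule part_equivpI)
  show "\<exists>x. l2rel x x" by (rule exI[of _ "\<lambda>x. 0"]) (simp add: l2rel_def)
  show "symp l2rel" by (rule sympI) (simp add: l2rel_def eq_commute)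
  show "transp l2rel"
  proof (rule transpI)
    fix f g h assume a: "l2rel f g" "l2rel g h"
    then have "AE x in lborel. f x = g x" "AE x in lborel. g x = h x"
      by (auto simp: l2rel_def)
    then have "AE x in lborel. f x = h x" by eventually_elim simp
    then show "l2rel f h" using a by (simp add: l2rel_def)
  qed
qed

quotient_type (overloaded) 'n l2 = "real^'n::finite \<Rightarrow> real" / partial: l2rel
  morphisms rep_l2 cls
  by (rule part_equivp_l2rel)

lemma l2rel_refl: "l2rel f f \<longleftrightarrow> L2 f"
  by (simp add: l2rel_def)

lemma L2_rep [simp]: "L2 (rep_l2 f)"
  using Quotient3_rep_reflp[OF Quotient3_l2] by (simp add: l2rel_refl)

lemma cls_rep [simp]: "cls (rep_l2 f) = f"
  by (rule Quotient3_abs_rep[OF Quotient3_l2])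

lemma cls_eq_iff: "L2 f \<Longrightarrow> L2 g \<Longrightarrow> cls f = cls g \<longleftrightarrow> (AE x in lborel. f x = g x)"
  using Quotient3_rel[OF Quotient3_l2, of f g] by (auto simp: l2rel_def)

lemma rep_cls_AE: "L2 f \<Longrightarrow> AE x in lborel. rep_l2 (cls f) x = f x"
  using cls_eq_iff[of "rep_l2 (cls f)" f] by simp

lemma l2_cases: obtains g where "L2 g" "f = cls g"
  by (metis L2_rep cls_rep)

instantiation l2 :: (finite) real_vector
begin
lift_definition zero_l2 :: "'a l2" is "\<lambda>x. 0" by (simp add: l2rel_def)
lift_definition plus_l2 :: "'a l2 \<Rightarrow> 'a l2 \<Rightarrow> 'a l2" is "\<lambda>f g x. f x + g x"
  by (auto simp: l2rel_def L2_add elim: eventually_elim2)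
lift_definition minus_l2 :: "'a l2 \<Rightarrow> 'a l2 \<Rightarrow> 'a l2" is "\<lambda>f g x. f x - g x"
  by (auto simp: l2rel_def L2_diff elim: eventually_elim2)
lift_definition uminus_l2 :: "'a l2 \<Rightarrow> 'a l2" is "\<lambda>f x. - f x"
  by (auto simp: l2rel_def L2_minus elim: eventually_mono)
lift_definition scaleR_l2 :: "real \<Rightarrow> 'a l2 \<Rightarrow> 'a l2" is "\<lambda>c f x. c * f x"
  by (auto simp: l2rel_def L2_scale elim: eventually_mono)
instance
  by standard
    (transfer; auto simp: l2rel_def L2_add L2_minus L2_diff L2_scale algebra_simps)+
end

instantiation l2 :: (finite) real_inner
begin
lift_definition inner_l2 :: "'a l2 \<Rightarrow> 'a l2 \<Rightarrow> real" is "\<lambda>f g. LINT x|lborel. f x * g x"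
proof (rule integral_cong_AE)
  fix f f' g g' :: "real^'a \<Rightarrow> real"
  assume a: "l2rel f f'" "l2rel g g'"
  then show "(\<lambda>x. f x * g x) \<in> borel_measurable lborel" "(\<lambda>x. f' x * g' x) \<in> borel_measurable lborel"
    by (auto simp: l2rel_def L2_def)
  from a have "AE x in lborel. f x = f' x" "AE x in lborel. g x = g' x"
    by (auto simp: l2rel_def)
  then show "AE x in lborel. f x * g x = f' x * g' x" by eventually_elim simp
qed
definition norm_l2 :: "'a l2 \<Rightarrow> real" where "norm_l2 f = sqrt (inner f f)"
definition dist_l2 :: "'a l2 \<Rightarrow> 'a l2 \<Rightarrow> real" where "dist_l2 f g = norm (f - g)"
definition sgn_l2 :: "'a l2 \<Rightarrow> 'a l2" where "sgn_l2 f = f /\<^sub>R norm f"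
definition uniformity_l2 :: "('a l2 \<times> 'a l2) filter" where
  "uniformity_l2 = (INF e\<in>{0<..}. principal {(x, y). dist x y < e})"
definition open_l2 :: "'a l2 set \<Rightarrow> bool" where
  "open_l2 U \<longleftrightarrow> (\<forall>x\<in>U. eventually (\<lambda>(x', y). x' = x \<longrightarrow> y \<in> U) uniformity)"
instance
proof
  fix f g h :: "'a l2" and r :: real
  show "dist f g = norm (f - g)" by (rule dist_l2_def)
  show "sgn f = f /\<^sub>R norm f" by (rule sgn_l2_def)
  show "uniformity = (INF e\<in>{0<..}. principal {(x::'a l2, y). dist x y < e})"
    by (rule uniformity_l2_def)
  show "open U \<longleftrightarrow> (\<forall>x\<in>U. eventually (\<lambda>(x', y). x' = x \<longrightarrow> y \<in> U) uniformity)" for U :: "'a l2 set"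
    by (rule open_l2_def)
  show "inner f g = inner g f" by transfer (simp add: mult.commute)
  show "inner (f + g) h = inner f h + inner g h"
    by transfer (simp add: l2rel_refl L2_integrable_mult algebra_simps)
  show "inner (r *\<^sub>R f) g = r * inner f g"
    by transfer (simp add: mult.assoc)
  show "0 \<le> inner f f" by transfer simp
  show "inner f f = 0 \<longleftrightarrow> f = 0"
    apply transfer
    subgoal for f
      using integral_nonneg_eq_0_iff_AE[of lborel "\<lambda>x. f x * f x"]
      by (auto simp: l2rel_def L2_integrable_mult)
    done
  show "norm f = sqrt (inner f f)" by (rule norm_l2_def)
qed
end

lemma inner_cls: "L2 f \<Longrightarrow> L2 g \<Longrightarrow> inner (cls f) (cls g) = (LINT x|lborel. f x * g x)"
  by (simp add: inner_l2.abs_eq l2rel_refl)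

lemma norm_cls: "L2 f \<Longrightarrow> norm (cls f) = L2norm f"
  by (simp add: norm_eq_sqrt_inner inner_cls L2norm_def power2_eq_square)

lemma cls_add: "L2 f \<Longrightarrow> L2 g \<Longrightarrow> cls (\<lambda>x. f x + g x) = cls f + cls g"
  by (simp add: plus_l2.abs_eq l2rel_refl)

lemma cls_diff: "L2 f \<Longrightarrow> L2 g \<Longrightarrow> cls (\<lambda>x. f x - g x) = cls f - cls g"
  by (simp add: minus_l2.abs_eq l2rel_refl)

lemma cls_scale: "L2 f \<Longrightarrow> cls (\<lambda>x. c * f x) = c *\<^sub>R cls f"
  by (simp add: scaleR_l2.abs_eq l2rel_refl)

lemma cls_zero: "cls (\<lambda>x. 0) = 0"
  by (simp add: zero_l2.abs_eq)

lemma L2_sum: "finite A \<Longrightarrow> (\<And>i. i \<in> A \<Longrightarrow> L2 (f i)) \<Longrightarrow> L2 (\<lambda>x. \<Sum>i\<in>A. f i x)"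
  by (induction A rule: finite_induct) (auto intro: L2_add)

lemma cls_sum: "finite A \<Longrightarrow> (\<And>i. i \<in> A \<Longrightarrow> L2 (f i)) \<Longrightarrow> cls (\<lambda>x. \<Sum>i\<in>A. f i x) = (\<Sum>i\<in>A. cls (f i))"
  by (induction A rule: finite_induct) (auto simp: cls_add L2_sum cls_zero)

section \<open>Translations\<close>

text \<open>Formed from an arbitrary representative. The choice is immaterial because translates of
  null sets are null, which is the content of \<open>tau_cls\<close>.\<close>

definition tau :: "real^'n::finite \<Rightarrow> 'n l2 \<Rightarrow> 'n l2" where
  "tau h f = cls (\<lambda>x. rep_l2 f (x + h))"

lemma integral_shift:
  fixes f :: "real^'n::finite \<Rightarrow> real"
  assumes "f \<in> borel_measurable lborel"
  shows "integrable lborel (\<lambda>x. f (x + h)) \<longleftrightarrow> integrable lborel f"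
    and "(LINT x|lborel. f (x + h)) = (LINT x|lborel. f x)"
proof -
  have "integrable lborel f \<longleftrightarrow> integrable (distr lborel borel ((+) h)) f"
    by (simp add: lborel_distr_plus)
  also have "\<dots> \<longleftrightarrow> integrable lborel (\<lambda>x. f (h + x))"
    using assms by (subst integrable_distr_eq) auto
  finally show "integrable lborel (\<lambda>x. f (x + h)) \<longleftrightarrow> integrable lborel f"
    by (simp add: add.commute)
  have "(LINT x|lborel. f x) = (LINT x|distr lborel borel ((+) h). f x)"
    by (simp add: lborel_distr_plus)
  also have "\<dots> = (LINT x|lborel. f (h + x))"
    using assms by (subst integral_distr) auto
  finally show "(LINT x|lborel. f (x + h)) = (LINT x|lborel. f x)"
    by (simp add: add.commute)
qed

lemma AE_shift:
  fixes P :: "real^'n::finite \<Rightarrow> bool"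
  assumes "AE x in lborel. P x"
  shows "AE x in lborel. P (x + h)"
proof -
  have "AE x in distr lborel borel ((+) h). P x"
    using assms by (simp only: lborel_distr_plus)
  then have "AE x in lborel. P (h + x)"
    by (rule AE_distrD[rotated]) auto
  then show ?thesis by (simp add: add.commute)
qed

lemma L2_shift: "L2 f \<Longrightarrow> L2 (\<lambda>x. f (x + h))"
  using integral_shift(1)[of "\<lambda>x. (f x)\<^sup>2" h] by (auto simp: L2_def)

lemma tau_cls: "L2 f \<Longrightarrow> tau h (cls f) = cls (\<lambda>x. f (x + h))"
  unfolding tau_def
  by (subst cls_eq_iff) (auto intro: L2_shift AE_shift rep_cls_AE)

lemma inner_tau: "inner (tau h f) (tau h g) = inner f g"
proof (cases f rule: l2_cases; cases g rule: l2_cases)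
  fix f' g' assume *: "L2 f'" "f = cls f'" "L2 g'" "g = cls g'"
  then have "(\<lambda>x. f' x * g' x) \<in> borel_measurable lborel" by (auto simp: L2_def)
  from integral_shift(2)[OF this, of h] show ?thesis
    using * by (simp add: tau_cls inner_cls L2_shift)
qed

lemma linear_tau: fixes h :: "real^'n::finite" shows "linear (tau h)"
proof
  fix f g :: "'n l2" and c :: real
  obtain f' where f: "L2 f'" "f = cls f'" by (rule l2_cases)
  obtain g' where g: "L2 g'" "g = cls g'" by (rule l2_cases)
  show "tau h (f + g) = tau h f + tau h g"
    using f g by (simp add: tau_cls L2_add L2_shift flip: cls_add)
  show "tau h (c *\<^sub>R f) = c *\<^sub>R tau h f"
    using f by (simp add: tau_cls L2_scale L2_shift flip: cls_scale)
qed

lemma norm_tau [simp]: "norm (tau h f) = norm f"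
  by (simp add: norm_eq_sqrt_inner inner_tau)

lemma bounded_linear_tau: "bounded_linear (tau h)"
  using linear_tau by (rule bounded_linear.intro[OF _ bounded_linear_axioms.intro])
    (auto simp: linear_def intro!: exI[of _ 1])

lemma tau_tau: "tau h (tau k f) = tau (h + k) f"
proof (cases f rule: l2_cases)
  fix g assume "L2 g" "f = cls g"
  then show ?thesis by (simp add: tau_cls L2_shift add_ac)
qed

lemma tau_0 [simp]: "tau 0 f = f"
  by (cases f rule: l2_cases) (simp add: tau_cls)

section \<open>Bounded multipliers\<close>

text \<open>Deliberately weaker than \<open>smooth_bdd\<close>: the weight \<open>1 / a\<close> and
  the difference quotients of coefficients act only as bounded multipliers. The explicit
  \<open>K\<close> bounds the operator norm, see \<open>norm_mul_le\<close>.\<close>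

definition mbdd :: "(real^'n::finite \<Rightarrow> real) \<Rightarrow> real \<Rightarrow> bool" where
  "mbdd m K \<longleftrightarrow> m \<in> borel_measurable lborel \<and> (\<forall>x. \<bar>m x\<bar> \<le> K)"

definition mul :: "(real^'n::finite \<Rightarrow> real) \<Rightarrow> 'n l2 \<Rightarrow> 'n l2" where
  "mul m f = cls (\<lambda>x. m x * rep_l2 f x)"

lemma mbdd_nonneg: "mbdd m K \<Longrightarrow> 0 \<le> K"
  unfolding mbdd_def by (meson abs_ge_zero order_trans)

lemma L2_mul: assumes "mbdd m K" "L2 f" shows "L2 (\<lambda>x. m x * f x)"
  by (rule L2_dominated[OF L2_scale[OF assms(2), of K]])
    (use assms mbdd_nonneg[OF assms(1)] in \<open>auto simp: mbdd_def L2_def abs_mult intro: mult_right_mono\<close>)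

lemma mul_cls: assumes "mbdd m K" "L2 f" shows "mul m (cls f) = cls (\<lambda>x. m x * f x)"
  unfolding mul_def
proof (subst cls_eq_iff)
  show "AE x in lborel. m x * rep_l2 (cls f) x = m x * f x"
    using rep_cls_AE[OF assms(2)] by eventually_elim simp
qed (use L2_mul[OF assms(1)] assms in auto)

lemma linear_mul: fixes m :: "real^'n::finite \<Rightarrow> real" assumes "mbdd m K" shows "linear (mul m)"
proof
  fix f g :: "'n l2" and c :: real
  obtain f' where f: "L2 f'" "f = cls f'" by (rule l2_cases)
  obtain g' where g: "L2 g'" "g = cls g'" by (rule l2_cases)
  show "mul m (f + g) = mul m f + mul m g"
    using f g by (simp add: mul_cls[OF assms] L2_add L2_mul[OF assms] distrib_left flip: cls_add)
  show "mul m (c *\<^sub>R f) = c *\<^sub>R mul m f"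
    using f by (simp add: mul_cls[OF assms] L2_scale L2_mul[OF assms] mult.left_commute flip: cls_scale)
qed

lemma norm_mul_le: assumes "mbdd m K" shows "norm (mul m f) \<le> K * norm f"
proof (cases f rule: l2_cases)
  fix g assume g: "L2 g" "f = cls g"
  have "inner (mul m f) (mul m f) \<le> (LINT x|lborel. (K * g x) * (K * g x))"
    unfolding g(2) mul_cls[OF assms g(1)] inner_cls[OF L2_mul[OF assms g(1)] L2_mul[OF assms g(1)]]
  proof (rule integral_mono)
    show "integrable lborel (\<lambda>x. m x * g x * (m x * g x))"
      by (intro L2_integrable_mult L2_mul[OF assms] g)
    show "integrable lborel (\<lambda>x. (K * g x) * (K * g x))"
      by (intro L2_integrable_mult L2_scale g)
    fix x show "m x * g x * (m x * g x) \<le> (K * g x) * (K * g x)"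
      using assms mbdd_nonneg[OF assms]
      by (auto simp: mbdd_def abs_mult power2_eq_square[symmetric] abs_le_square_iff[symmetric] intro: mult_right_mono)
  qed
  also have "\<dots> = inner (K *\<^sub>R f) (K *\<^sub>R f)"
    using g by (simp add: inner_cls L2_scale flip: cls_scale)
  finally have "(norm (mul m f))\<^sup>2 \<le> (K * norm f)\<^sup>2"
    by (simp add: power_mult_distrib power2_norm_eq_inner) (simp add: power2_eq_square)
  then show ?thesis
    by (rule power2_le_imp_le) (simp add: mbdd_nonneg[OF assms])
qed

lemma bounded_linear_mul: assumes "mbdd m K" shows "bounded_linear (mul m)"
  using linear_mul[OF assms] norm_mul_le[OF assms]
  by (intro bounded_linear.intro bounded_linear_axioms.intro)
    (auto simp: linear_def intro!: exI[of _ K] simp: mult.commute)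

lemma inner_mul: assumes "mbdd m K" shows "inner (mul m f) g = inner f (mul m g)"
proof -
  obtain f' where f: "L2 f'" "f = cls f'" by (rule l2_cases)
  obtain g' where g: "L2 g'" "g = cls g'" by (rule l2_cases)
  show ?thesis using f g by (simp add: mul_cls[OF assms] inner_cls L2_mul[OF assms] mult.left_commute mult.assoc)
qed

lemma mbdd_mult: "mbdd m K \<Longrightarrow> mbdd m' K' \<Longrightarrow> mbdd (\<lambda>x. m x * m' x) (K * K')"
  unfolding mbdd_def by (auto simp: abs_mult intro!: mult_mono)

lemma mbdd_add: "mbdd m K \<Longrightarrow> mbdd m' K' \<Longrightarrow> mbdd (\<lambda>x. m x + m' x) (K + K')"
  unfolding mbdd_def by (auto intro!: order_trans[OF abs_triangle_ineq] add_mono)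

lemma mbdd_scale: "mbdd m K \<Longrightarrow> mbdd (\<lambda>x. c * m x) (\<bar>c\<bar> * K)"
  unfolding mbdd_def by (auto simp: abs_mult intro!: mult_left_mono)

lemma mul_mul: assumes "mbdd m K" "mbdd m' K'"
  shows "mul m (mul m' f) = mul (\<lambda>x. m x * m' x) f"
  by (cases f rule: l2_cases)
    (simp add: mul_cls[OF assms(1)] mul_cls[OF assms(2)] mul_cls[OF mbdd_mult[OF assms]] L2_mul[OF assms(2)] mult.assoc)

lemma mul_add_left: assumes "mbdd m K" "mbdd m' K'"
  shows "mul (\<lambda>x. m x + m' x) f = mul m f + mul m' f"
  by (cases f rule: l2_cases)
    (simp add: mul_cls[OF assms(1)] mul_cls[OF assms(2)] mul_cls[OF mbdd_add[OF assms]] L2_mul[OF assms(2)]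
      L2_mul[OF assms(1)] distrib_right flip: cls_add)

lemma mul_scale_left: assumes "mbdd m K"
  shows "mul (\<lambda>x. c * m x) f = c *\<^sub>R mul m f"
  by (cases f rule: l2_cases)
    (simp add: mul_cls[OF assms(1)] mul_cls[OF mbdd_scale[OF assms]] L2_mul[OF assms] mult.assoc flip: cls_scale)

lemma mul_one: "mul (\<lambda>x. 1) f = f"
  using mul_cls[of "\<lambda>x. 1" 1] by (cases f rule: l2_cases) (auto simp: mbdd_def)

text \<open>Turns the positive lower bounds of the coefficients into coercivity of the
  energies.\<close>

lemma inner_mul_ge:
  assumes "mbdd m K" "\<And>x. c \<le> m x"
  shows "c * (norm f)\<^sup>2 \<le> inner (mul m f) f"
proof (cases f rule: l2_cases)
  fix g assume g: "L2 g" "f = cls g"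
  have "c * (norm f)\<^sup>2 = (LINT x|lborel. c * (g x * g x))"
    using g by (simp add: power2_norm_eq_inner inner_cls)
  also have "\<dots> \<le> (LINT x|lborel. m x * g x * g x)"
  proof (rule integral_mono)
    show "integrable lborel (\<lambda>x. c * (g x * g x))"
      by (intro integrable_mult_right L2_integrable_mult g)
    show "integrable lborel (\<lambda>x. m x * g x * g x)"
      by (intro L2_integrable_mult L2_mul[OF assms(1)] g)
    fix x show "c * (g x * g x) \<le> m x * g x * g x"
      using assms(2)[of x] by (simp add: mult.assoc mult_right_mono)
  qed
  also have "\<dots> = inner (mul m f) f"
    using g by (simp add: mul_cls[OF assms(1)] inner_cls L2_mul[OF assms(1)])
  finally show ?thesis .
qed

lemma tau_mul: assumes "mbdd m K"
  shows "tau h (mul m f) = mul (\<lambda>x. m (x + h)) (tau h f)"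
proof (cases f rule: l2_cases)
  fix g assume g: "L2 g" "f = cls g"
  have "mbdd (\<lambda>x. m (x + h)) K" using assms by (auto simp: mbdd_def)
  then show ?thesis using g
    by (simp add: mul_cls[OF assms] tau_cls L2_mul[OF assms] mul_cls L2_shift)
qed

section \<open>Test functions are dense\<close>

lemma pdx_has_deriv:
  assumes "f differentiable (at x)"
  shows "((\<lambda>h. f (x + h *\<^sub>R axis i 1)) has_field_derivative pdx i f x) (at 0)"
proof -
  have "f differentiable (at (x + 0 *\<^sub>R axis i 1))" using assms by simp
  then have "(f \<circ> (\<lambda>h::real. x + h *\<^sub>R axis i 1)) differentiable (at 0)"
    by (intro differentiable_chain_at) auto
  then show ?thesis
    unfolding pdx_def by (simp add: DERIV_deriv_iff_real_differentiable o_def)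
qed

lemma pdx_eqI:
  "((\<lambda>h. f (x + h *\<^sub>R axis i 1)) has_field_derivative D) (at 0) \<Longrightarrow> pdx i f x = D"
  unfolding pdx_def by (rule DERIV_imp_deriv)

lemma pdx_line:
  assumes "\<And>x. f differentiable (at x)"
  shows "((\<lambda>h. f (x + h *\<^sub>R axis i 1)) has_field_derivative pdx i f (x + h *\<^sub>R axis i 1)) (at h)"
proof -
  have "((\<lambda>k. f (x + (k + h) *\<^sub>R axis i 1)) has_field_derivative pdx i f (x + h *\<^sub>R axis i 1)) (at 0)"
    using pdx_has_deriv[OF assms, of "x + h *\<^sub>R axis i 1" i]
    by (simp add: algebra_simps)
  then show ?thesis
    using DERIV_shift[of "\<lambda>h. f (x + h *\<^sub>R axis i 1)" _ 0 h] by simp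
qed

lemma pds_append: "pds (is @ js) f = pds is (pds js f)"
  by (induction "is") auto

lemma smooth_pds: "smooth f \<Longrightarrow> smooth (pds is f)"
  unfolding smooth_def by (metis pds_append)

lemma smooth_pdx: "smooth f \<Longrightarrow> smooth (pdx i f)"
  using smooth_pds[of f "[i]"] by simp

lemma smooth_differentiable: "smooth f \<Longrightarrow> f differentiable (at x)"
  unfolding smooth_def by (metis pds.simps(1))

lemma smooth_continuous: "smooth f \<Longrightarrow> continuous_on S f"
  by (meson continuous_at_imp_continuous_on differentiable_imp_continuous_within smooth_differentiable)

lemma smooth_borel [measurable_dest]: "smooth f \<Longrightarrow> f \<in> borel_measurable lborel"
  using smooth_continuous borel_measurable_continuous_onI by auto

lemma pds_add:
  assumes "smooth f" "smooth g"
  shows "pds is (\<lambda>x. f x + g x) = (\<lambda>x. pds is f x + pds is g x)"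
proof (induction "is")
  case (Cons i "is")
  have "pdx i (\<lambda>x. pds is f x + pds is g x) x = pdx i (pds is f) x + pdx i (pds is g) x" for x
    using assms by (intro pdx_eqI DERIV_add pdx_has_deriv) (auto simp: smooth_def)
  then show ?case by (auto simp: Cons)
qed simp

lemma pds_scale:
  assumes "smooth f"
  shows "pds is (\<lambda>x. c * f x) = (\<lambda>x. c * pds is f x)"
proof (induction "is")
  case (Cons i "is")
  have "pdx i (\<lambda>x. c * pds is f x) x = c * pdx i (pds is f) x" for x
    using assms by (intro pdx_eqI DERIV_cmult pdx_has_deriv) (auto simp: smooth_def)
  then show ?case by (auto simp: Cons)
qed simp

lemma smooth_add: "smooth f \<Longrightarrow> smooth g \<Longrightarrow> smooth (\<lambda>x. f x + g x)"
  by (simp add: smooth_def[of "\<lambda>x. f x + g x"] pds_add) (auto simp: smooth_def)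

lemma smooth_scale: "smooth f \<Longrightarrow> smooth (\<lambda>x. c * f x)"
  by (simp add: smooth_def[of "\<lambda>x. c * f x"] pds_scale) (auto simp: smooth_def)

lemma test_fun_add: "test_fun f \<Longrightarrow> test_fun g \<Longrightarrow> test_fun (\<lambda>x. f x + g x)"
  unfolding test_fun_def
  by (auto simp: smooth_add intro: bounded_subset[of "{x. f x \<noteq> 0} \<union> {x. g x \<noteq> 0}"])

lemma test_fun_scale: "test_fun f \<Longrightarrow> test_fun (\<lambda>x. c * f x)"
  unfolding test_fun_def
  by (auto simp: smooth_scale intro: bounded_subset[of "{x. f x \<noteq> 0}"])

lemma pdx_support: "{x. pdx i f x \<noteq> 0} \<subseteq> closure {x. f x \<noteq> 0}"
proof -
  have "pdx i f x = 0" if x: "x \<notin> closure {x. f x \<noteq> 0}" for x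
  proof -
    have "open (- closure {x. f x \<noteq> 0})" by auto
    with x obtain e where e: "e > 0" "ball x e \<subseteq> - closure {x. f x \<noteq> 0}"
      by (meson ComplI open_contains_ball)
    have "f (x + h *\<^sub>R axis i 1) = 0" if "h \<in> ball 0 e" for h
    proof -
      have "x + h *\<^sub>R axis i 1 \<in> ball x e"
        using that by (simp add: dist_norm)
      then have "x + h *\<^sub>R axis i 1 \<notin> closure {x. f x \<noteq> 0}" using e by blast
      then show ?thesis using closure_subset[of "{x. f x \<noteq> 0}"] by auto
    qed
    moreover have "((\<lambda>h. 0::real) has_field_derivative 0) (at 0)" by simp
    ultimately have "((\<lambda>h. f (x + h *\<^sub>R axis i 1)) has_field_derivative 0) (at 0)"
      using e(1) by (subst DERIV_cong_ev[OF refl _ refl, where g = "\<lambda>h. 0"])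
        (auto simp: eventually_nhds_metric dist_norm)
    then show ?thesis by (rule pdx_eqI)
  qed
  then show ?thesis by blast
qed

lemma test_fun_pdx: "test_fun f \<Longrightarrow> test_fun (pdx i f)"
  unfolding test_fun_def
  by (auto simp: smooth_pdx intro: bounded_subset[OF bounded_closure pdx_support])

lemma test_fun_pds: "test_fun f \<Longrightarrow> test_fun (pds is f)"
  by (induction "is") (auto intro: test_fun_pdx)

lemma test_fun_bounded:
  assumes "test_fun f"
  obtains B where "B \<ge> 0" "\<And>x. \<bar>f x\<bar> \<le> B"
proof -
  let ?K = "closure {x. f x \<noteq> 0}"
  have "compact (f ` ?K)"
    using assms by (auto simp: test_fun_def intro: compact_continuous_image smooth_continuous)
  then obtain B where B: "\<And>x. x \<in> ?K \<Longrightarrow> \<bar>f x\<bar> \<le> B"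
    by (force dest: compact_imp_bounded simp: bounded_iff)
  have "\<bar>f x\<bar> \<le> max B 0" for x
    using B[of x] closure_subset[of "{x. f x \<noteq> 0}"] by (cases "f x = 0") auto
  then show ?thesis by (rule that[rotated]) auto
qed

lemma L2_indicator_compact: "compact K \<Longrightarrow> L2 (indicator K)"
proof -
  assume K: "compact K"
  have "(\<lambda>x. (indicator K x :: real)\<^sup>2) = indicator K" by (auto simp: indicator_def)
  then show ?thesis
    using K emeasure_bounded_finite[of K] by (auto simp: L2_def compact_imp_bounded integrable_indicator_iff borel_compact intro!: borel_measurable_indicator)
qed

lemma L2_test: "test_fun f \<Longrightarrow> L2 f"
proof -
  assume f: "test_fun f"
  obtain B where B: "B \<ge> 0" "\<And>x. \<bar>f x\<bar> \<le> B" using test_fun_bounded[OF f] by blast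
  show ?thesis
  proof (rule L2_dominated)
    show "L2 (\<lambda>x. B * indicator (closure {x. f x \<noteq> 0}) x)"
      using f by (intro L2_scale L2_indicator_compact) (auto simp: test_fun_def)
    show "\<bar>f x\<bar> \<le> \<bar>B * indicator (closure {x. f x \<noteq> 0}) x\<bar>" for x
      using B closure_subset[of "{x. f x \<noteq> 0}"] by (auto simp: indicator_def)
    show "f \<in> borel_measurable lborel" using f unfolding test_fun_def by (intro smooth_borel) simp
  qed
qed

lemma L2norm_mono:
  assumes "L2 f" "L2 g" "\<And>x. \<bar>f x\<bar> \<le> \<bar>g x\<bar>"
  shows "L2norm f \<le> L2norm g"
  unfolding L2norm_def
  using assms by (intro real_sqrt_le_mono integral_mono) (auto simp: L2_def abs_le_square_iff)

text \<open>The generator of translations in direction \<open>i\<close>: \<open>f\<close> lies in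
  its domain and \<open>g\<close> is its value. By \<open>isd_weakD\<close> and
  \<open>isd_weakI\<close> this is the weak derivative. In the strong form the product rule,
  integration by parts and commutation become limits of identities for translations.\<close>

definition isd :: "'n::finite \<Rightarrow> 'n l2 \<Rightarrow> 'n l2 \<Rightarrow> bool" where
  "isd i f g \<longleftrightarrow> ((\<lambda>h. (tau (h *\<^sub>R axis i 1) f - f) /\<^sub>R h) \<longlongrightarrow> g) (at 0)"

text \<open>Taylor's formula by two applications of the mean value inequality, up to a factor 1/2 in
  the constant.\<close>

lemma second_order_bound:
  fixes g g' g'' :: "real \<Rightarrow> real"
  assumes g: "\<And>t. (g has_field_derivative g' t) (at t)"
    and g': "\<And>t. (g' has_field_derivative g'' t) (at t)"
    and B: "\<And>t. \<bar>g'' t\<bar> \<le> B"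
  shows "\<bar>g h - g 0 - h * g' 0\<bar> \<le> B * h\<^sup>2"
proof -
  have 1: "\<bar>g' t - g' 0\<bar> \<le> B * \<bar>t\<bar>" for t
    using field_differentiable_bound[of UNIV g' g'' B t 0] g' B by simp
  have B0: "B \<ge> 0" using B[of 0] by linarith
  have "norm ((g h - h * g' 0) - (g 0 - 0 * g' 0)) \<le> (B * \<bar>h\<bar>) * norm (h - 0)"
  proof (rule field_differentiable_bound[of "closed_segment 0 h" _ "\<lambda>t. g' t - g' 0"])
    fix z assume "z \<in> closed_segment 0 h"
    then have "\<bar>z\<bar> \<le> \<bar>h\<bar>" by (auto simp: closed_segment_eq_real_ivl split: if_splits)
    then show "norm (g' z - g' 0) \<le> B * \<bar>h\<bar>"
      using 1[of z] mult_left_mono[OF _ B0, of "\<bar>z\<bar>" "\<bar>h\<bar>"] by simp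
    show "((\<lambda>h. g h - h * g' 0) has_field_derivative g' z - g' 0) (at z within closed_segment 0 h)"
      by (intro DERIV_diff has_field_derivative_at_within[OF g] DERIV_cmult_right DERIV_ident[THEN DERIV_cmult_right, simplified])
  qed auto
  then show ?thesis by (simp add: power2_eq_square mult.assoc)
qed

lemma isd_test:
  fixes f :: "real^'n::finite \<Rightarrow> real"
  assumes f: "test_fun f"
  shows "isd i (cls f) (cls (pdx i f))"
proof -
  let ?e = "axis i 1 :: real^'n"
  \<comment> \<open>\<open>K\<close> contains the support of \<open>f\<close> and of all its
    translates by at most 1, so the Taylor remainder is dominated by
    \<open>B * \<bar>h\<bar>\<close> on one fixed compact set. Hence its L^2 norm is of order
    \<open>h\<close>.\<close>
  define K where "K = (\<lambda>(x, s). x + s *\<^sub>R ?e) ` (closure {x. f x \<noteq> 0} \<times> {-1..1::real})"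
  have K: "compact K"
    unfolding K_def using f
    by (intro compact_continuous_image compact_Times) (auto simp: test_fun_def case_prod_unfold intro!: continuous_intros)
  have KI: "y \<in> K" if "y + s *\<^sub>R ?e \<in> closure {x. f x \<noteq> 0}" "\<bar>s\<bar> \<le> 1" for y s
    unfolding K_def using that by (intro image_eqI[of _ _ "(y + s *\<^sub>R ?e, -s)"]) auto
  obtain B where B: "B \<ge> 0" "\<And>x. \<bar>pdx i (pdx i f) x\<bar> \<le> B"
    using test_fun_bounded[OF test_fun_pdx[OF test_fun_pdx[OF f]]] by metis
  have df: "f differentiable (at x)" "pdx i f differentiable (at x)" for x
    using f test_fun_pdx[OF f] by (auto simp: test_fun_def intro: smooth_differentiable)
  have bnd: "\<bar>f (x + h *\<^sub>R ?e) - f x - h * pdx i f x\<bar> \<le> B * h\<^sup>2" for x h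
    using second_order_bound[of "\<lambda>h. f (x + h *\<^sub>R ?e)" "\<lambda>h. pdx i f (x + h *\<^sub>R ?e)"
        "\<lambda>h. pdx i (pdx i f) (x + h *\<^sub>R ?e)" B h] pdx_line[of f x] pdx_line[of "pdx i f" x] df B by simp
  have pt: "\<bar>(f (x + h *\<^sub>R ?e) - f x) * inverse h - pdx i f x\<bar> \<le> \<bar>B * \<bar>h\<bar> * indicator K x\<bar>"
    if h: "h \<noteq> 0" "\<bar>h\<bar> \<le> 1" for x h
  proof (cases "x \<in> K")
    case True
    have "(f (x + h *\<^sub>R ?e) - f x) * inverse h - pdx i f x = (f (x + h *\<^sub>R ?e) - f x - h * pdx i f x) / h"
      using h by (simp add: field_simps)
    also have "\<bar>\<dots>\<bar> \<le> B * h\<^sup>2 / \<bar>h\<bar>"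
      using bnd h by (simp add: abs_divide divide_right_mono)
    also have "\<dots> = B * \<bar>h\<bar>" using h by (simp add: power2_eq_square field_simps)
    finally show ?thesis using True B by simp
  next
    case False
    have "f (x + h *\<^sub>R ?e) = 0" "f x = 0"
      using KI[of x h] KI[of x 0] False h closure_subset[of "{x. f x \<noteq> 0}"] by auto
    moreover have "pdx i f x = 0" using pdx_support[of i f] KI[of x 0] False by auto
    ultimately show ?thesis by simp
  qed
  have L: "L2 f" "L2 (pdx i f)" using f by (auto intro: L2_test test_fun_pdx)
  have nb: "norm ((tau (h *\<^sub>R ?e) (cls f) - cls f) /\<^sub>R h - cls (pdx i f)) \<le> \<bar>h\<bar> * (B * L2norm (indicator K))"
    if h: "h \<noteq> 0" "\<bar>h\<bar> \<le> 1" for h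
  proof -
    have "(tau (h *\<^sub>R ?e) (cls f) - cls f) /\<^sub>R h - cls (pdx i f)
      = cls (\<lambda>x. (f (x + h *\<^sub>R ?e) - f x) * inverse h - pdx i f x)"
      using L by (simp add: tau_cls L2_shift L2_diff L2_scale mult.commute[of _ "inverse h"] flip: cls_diff cls_scale)
    also have "norm \<dots> \<le> L2norm (\<lambda>x. B * \<bar>h\<bar> * indicator K x)"
      using L pt[OF h] K
      by (subst norm_cls) (auto intro!: L2norm_mono L2_diff L2_scale L2_shift L2_indicator_compact simp: mult.commute[of _ "inverse h"])
    also have "\<dots> = norm ((B * \<bar>h\<bar>) *\<^sub>R cls (indicator K))"
      using K by (simp add: norm_cls L2_scale L2_indicator_compact flip: cls_scale)
    also have "\<dots> = \<bar>h\<bar> * (B * L2norm (indicator K))"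
      using K B by (simp add: norm_cls L2_indicator_compact)
    finally show ?thesis .
  qed
  have "((\<lambda>h. (tau (h *\<^sub>R ?e) (cls f) - cls f) /\<^sub>R h - cls (pdx i f)) \<longlongrightarrow> 0) (at 0)"
  proof (rule Lim_null_comparison)
    show "((\<lambda>h. \<bar>h\<bar> * (B * L2norm (indicator K :: _ \<Rightarrow> real))) \<longlongrightarrow> 0) (at (0::real))"
      by (rule tendsto_eq_intros | simp)+
    show "\<forall>\<^sub>F h in at 0. norm ((tau (h *\<^sub>R ?e) (cls f) - cls f) /\<^sub>R h - cls (pdx i f)) \<le> \<bar>h\<bar> * (B * L2norm (indicator K))"
      unfolding eventually_at by (rule exI[of _ 1]) (auto simp: dist_norm intro!: nb)
  qed
  then show ?thesis
    unfolding isd_def by (simp add: Lim_null[symmetric])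
qed

section \<open>Smooth bump functions\<close>

text \<open>The flat function exp(-1/t), together with its quotients by powers of t. The derivative
  of \<open>rho k\<close> is a combination of \<open>rho (k + 2)\<close> and
  \<open>rho (k + 1)\<close>, so the span of the family is closed under differentiation.\<close>

definition rho :: "nat \<Rightarrow> real \<Rightarrow> real" where
  "rho k t = (if t > 0 then exp (- (1 / t)) / t ^ k else 0)"

text \<open>A single term of the exponential series at \<open>1 / t\<close> is bounded by the whole
  sum.\<close>

lemma exp_minus_inverse_le:
  fixes t :: real
  assumes "t > 0"
  shows "exp (- (1 / t)) \<le> fact n * t ^ n"
proof -
  have "(1 / t) ^ n / fact n \<le> exp (1 / t)"
  proof -
    have s: "(\<lambda>n. (1 / t) ^ n /\<^sub>R fact n) sums exp (1 / t)" by (rule exp_converges)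
    have "(\<Sum>k\<in>{n}. (1 / t) ^ k /\<^sub>R fact k) \<le> (\<Sum>k. (1 / t) ^ k /\<^sub>R fact k)"
      by (rule sum_le_suminf) (use assms s in \<open>auto intro: sums_summable\<close>)
    then show ?thesis using s by (simp add: sums_iff divide_inverse mult.commute)
  qed
  then show ?thesis
    using assms by (simp add: exp_minus field_simps power_divide)
qed

lemma rho_deriv: "(rho k has_field_derivative (rho (k + 2) t - real k * rho (k + 1) t)) (at t)"
proof -
  consider "t > 0" | "t < 0" | "t = 0" by linarith
  then show ?thesis
  proof cases
    case 1
    have "((\<lambda>t. exp (- (1 / t)) / t ^ k) has_field_derivative (rho (k + 2) t - real k * rho (k + 1) t)) (at t)"
      using 1 by (auto intro!: derivative_eq_intros simp: rho_def field_simps power2_eq_square) 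
        (cases k; simp add: field_simps)
    then show ?thesis
    proof (rule DERIV_cong_ev[OF refl _ refl, THEN iffD1, rotated])
      show "\<forall>\<^sub>F x in nhds t. exp (- (1 / x)) / x ^ k = rho k x"
        using 1 eventually_nhds_in_open[of "{0<..}" t] by (auto elim!: eventually_mono simp: rho_def)
    qed
  next
    case 2
    have "((\<lambda>t. 0) has_field_derivative (rho (k + 2) t - real k * rho (k + 1) t)) (at t)"
      using 2 by (simp add: rho_def)
    then show ?thesis
    proof (rule DERIV_cong_ev[OF refl _ refl, THEN iffD1, rotated])
      show "\<forall>\<^sub>F x in nhds t. 0 = rho k x"
        using 2 eventually_nhds_in_open[of "{..<0}" t] by (auto elim!: eventually_mono simp: rho_def)
    qed
  next
    case 3
    \<comment> \<open>At 0 the difference quotient is \<open>rho k h / h\<close>. The bound of order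
      \<open>k + 2\<close> absorbs the \<open>k + 1\<close> powers in the denominator and leaves one
      power of \<open>h\<close>.\<close>
    have "((\<lambda>h. rho k h / h) \<longlongrightarrow> 0) (at 0)"
    proof (rule Lim_null_comparison)
      show "((\<lambda>h. fact (k + 2) * \<bar>h\<bar>) \<longlongrightarrow> 0) (at (0::real))"
        by (rule tendsto_eq_intros | simp)+
      have "norm (rho k h / h) \<le> fact (k + 2) * \<bar>h\<bar>" for h
      proof (cases "h > 0")
        case True
        have "rho k h / h = exp (- (1 / h)) / (h ^ (k + 1))"
          using True by (simp add: rho_def field_simps)
        also have "\<dots> \<le> (fact (k + 2) * h ^ (k + 2)) / (h ^ (k + 1))"
          using True by (intro divide_right_mono exp_minus_inverse_le) auto
        also have "\<dots> = fact (k + 2) * h" using True by (simp add: field_simps)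
        finally show ?thesis using True by (simp add: rho_def)
      qed (simp add: rho_def mult_nonneg_nonpos)
      then show "\<forall>\<^sub>F h in at 0. norm (rho k h / h) \<le> fact (k + 2) * \<bar>h\<bar>" by simp
    qed
    then show ?thesis using 3 by (simp add: DERIV_def rho_def)
  qed
qed

text \<open>An algebra of functions that is closed under partial derivatives, so that its
  elements are smooth.\<close>
inductive bump_alg :: "(real^'n::finite \<Rightarrow> real) \<Rightarrow> bool" where
  const: "bump_alg (\<lambda>x. c)"
| rho: "bump_alg (\<lambda>x. rho k (c * x $ j + d))"
| add: "bump_alg f \<Longrightarrow> bump_alg g \<Longrightarrow> bump_alg (\<lambda>x. f x + g x)"
| mult: "bump_alg f \<Longrightarrow> bump_alg g \<Longrightarrow> bump_alg (\<lambda>x. f x * g x)"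

lemma bump_alg_pdx:
  fixes f :: "real^'n::finite \<Rightarrow> real"
  assumes "bump_alg f"
  shows "(\<forall>x. f differentiable (at x)) \<and> bump_alg (pdx i f)"
  using assms
proof induction
  case (const c)
  have "pdx i (\<lambda>x. c) = (\<lambda>x. 0)" by (rule ext, rule pdx_eqI) simp
  then show ?case by (simp add: bump_alg.const)
next
  case (rho k c j d)
  have D: "(\<lambda>x. rho k (c * x $ j + d)) differentiable (at x)" for x :: "real^'n"
  proof -
    have "rho k differentiable (at (c * x $ j + d))"
      using rho_deriv real_differentiable_def by blast
    moreover have "(\<lambda>x. c * x $ j + d) differentiable (at x)"
      by (intro differentiable_add differentiable_mult differentiable_const
          bounded_linear_imp_differentiable[OF bounded_linear_vec_nth])
    ultimately have "(rho k \<circ> (\<lambda>x. c * x $ j + d)) differentiable (at x)"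
      by (intro differentiable_chain_at)
    then show ?thesis by (simp add: o_def)
  qed
  have "pdx i (\<lambda>x. rho k (c * x $ j + d))
     = (\<lambda>x. (if i = j then c else 0) * (rho (k + 2) (c * x $ j + d) + (- real k) * rho (k + 1) (c * x $ j + d)))"
  proof (rule ext, rule pdx_eqI)
    fix x :: "real^'n"
    let ?a = "axis i 1 $ j :: real"
    have "((\<lambda>h. rho k (c * (x $ j + h * ?a) + d)) has_field_derivative
        (rho (k + 2) (c * (x $ j + 0 * ?a) + d) - real k * rho (k + 1) (c * (x $ j + 0 * ?a) + d)) * (c * ?a)) (at 0)"
      by (rule DERIV_chain2[OF rho_deriv]) (auto intro!: derivative_eq_intros)
    then show "((\<lambda>h. rho k (c * (x + h *\<^sub>R axis i 1) $ j + d)) has_field_derivative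
        (if i = j then c else 0) * (rho (k + 2) (c * x $ j + d) + (- real k) * rho (k + 1) (c * x $ j + d))) (at 0)"
      by (auto simp: axis_def algebra_simps cong: if_cong)
  qed
  moreover have "bump_alg (\<lambda>x. (if i = j then c else 0) * (rho (k + 2) (c * x $ j + d) + (- real k) * rho (k + 1) (c * x $ j + d)))"
    by (intro bump_alg.intros)
  ultimately show ?case using D by simp
next
  case (add f g)
  then have "pdx i (\<lambda>x. f x + g x) = (\<lambda>x. pdx i f x + pdx i g x)"
    by (intro ext pdx_eqI DERIV_add pdx_has_deriv) auto
  then show ?case using add by (auto intro!: bump_alg.intros)
next
  case (mult f g)
  have "pdx i (\<lambda>x. f x * g x) = (\<lambda>x. pdx i f x * g x + pdx i g x * f x)"
  proof (rule ext, rule pdx_eqI)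
    fix x
    have "((\<lambda>h. f (x + h *\<^sub>R axis i 1) * g (x + h *\<^sub>R axis i 1)) has_field_derivative
       pdx i f x * g (x + 0 *\<^sub>R axis i 1) + pdx i g x * f (x + 0 *\<^sub>R axis i 1)) (at 0)"
      using mult by (intro DERIV_mult pdx_has_deriv) auto
    then show "((\<lambda>h. f (x + h *\<^sub>R axis i 1) * g (x + h *\<^sub>R axis i 1)) has_field_derivative
       pdx i f x * g x + pdx i g x * f x) (at 0)" by simp
  qed
  then show ?case using mult by (auto intro!: bump_alg.intros)
qed

lemma bump_alg_smooth: "bump_alg f \<Longrightarrow> smooth f"
proof -
  assume f: "bump_alg f"
  have "bump_alg (pds is f)" for "is"
    by (induction "is") (auto simp: f bump_alg_pdx)
  then show ?thesis using bump_alg_pdx by (auto simp: smooth_def)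
qed

lemma bump_alg_prod: "finite A \<Longrightarrow> (\<And>j. j \<in> A \<Longrightarrow> bump_alg (f j)) \<Longrightarrow> bump_alg (\<lambda>x. \<Prod>j\<in>A. f j x)"
  by (induction A rule: finite_induct) (auto intro: bump_alg.intros)

lemma tendsto_cls_dominated:
  assumes g: "\<And>n. g n \<in> borel_measurable lborel"
    and f: "f \<in> borel_measurable lborel"
    and lim: "\<And>x. (\<lambda>n. g n x) \<longlonglongrightarrow> f x"
    and h: "L2 h" and bnd: "\<And>n x. \<bar>g n x\<bar> \<le> \<bar>h x\<bar>"
  shows "L2 (g n)" "L2 f" "(\<lambda>n. cls (g n)) \<longlonglongrightarrow> cls f"
proof -
  have Lg: "L2 (g n)" for n by (rule L2_dominated[OF h g bnd])
  then show "L2 (g n)" .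
  have bf: "\<bar>f x\<bar> \<le> \<bar>h x\<bar>" for x
    by (rule tendsto_upperbound[OF tendsto_rabs[OF lim[of x]]]) (auto simp: bnd)
  show Lf: "L2 f" by (rule L2_dominated[OF h f bf])
  have "(\<lambda>n. LINT x|lborel. (g n x - f x)\<^sup>2) \<longlonglongrightarrow> (LINT x|lborel. (f x - f x)\<^sup>2)"
  proof (rule integral_dominated_convergence[where w = "\<lambda>x. 4 * (h x)\<^sup>2"])
    show "(\<lambda>x. (g n x - f x)\<^sup>2) \<in> borel_measurable lborel" for n
      using g f by measurable
    show "integrable lborel (\<lambda>x. 4 * (h x)\<^sup>2)" using h by (auto simp: L2_def)
    show "AE x in lborel. (\<lambda>n. (g n x - f x)\<^sup>2) \<longlonglongrightarrow> (f x - f x)\<^sup>2"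
      by (intro AE_I2 tendsto_intros lim)
    have "\<bar>g n x - f x\<bar> \<le> \<bar>2 * h x\<bar>" for n x using bnd[of n x] bf[of x] by linarith
    then have "(g n x - f x)\<^sup>2 \<le> (2 * h x)\<^sup>2" for n x
      by (simp only: abs_le_square_iff)
    then show "AE x in lborel. norm ((g n x - f x)\<^sup>2) \<le> 4 * (h x)\<^sup>2" for n
      by (simp add: power_mult_distrib)
  qed (use f in measurable)
  then have "(\<lambda>n. sqrt (LINT x|lborel. (g n x - f x)\<^sup>2)) \<longlonglongrightarrow> sqrt 0"
    by (intro tendsto_real_sqrt) simp
  then have "(\<lambda>n. norm (cls (g n) - cls f)) \<longlonglongrightarrow> 0"
    using Lg Lf by (simp add: norm_cls L2_diff L2norm_def flip: cls_diff)
  then show "(\<lambda>n. cls (g n)) \<longlonglongrightarrow> cls f"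
    by (simp add: tendsto_norm_zero_iff LIM_zero_iff)
qed

text \<open>For \<open>t > 0\<close> the factor \<open>exp (- (1 / (n * t)))\<close> tends to 1 as
  \<open>n\<close> grows, and for \<open>t \<le> 0\<close> it is replaced by 0. The products of such
  factors therefore fill the open box without leaving it.\<close>

lemma exists_bump_sequence:
  fixes a b :: "real^'n::finite"
  obtains g where "\<And>n. test_fun (g n)" "\<And>n x. \<bar>g n x\<bar> \<le> \<bar>indicator (cbox a b) x\<bar>"
    "\<And>x. (\<lambda>n. g n x) \<longlonglongrightarrow> indicator (box a b) x"
proof
  define k where "k n t = rho 0 (real n * t)" for n t
  define g where "g n x = (\<Prod>j\<in>UNIV. k n (x $ j - a $ j) * k n (b $ j - x $ j))" for n and x :: "real^'n"
  have k01: "0 \<le> k n t" "k n t \<le> 1" for n t by (auto simp: k_def rho_def)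
  have k0: "k n t = 0" if "t \<le> 0" for n t
    using that by (auto simp: k_def rho_def zero_less_mult_iff)
  have klim: "(\<lambda>n. k n t) \<longlonglongrightarrow> 1" if "t > 0" for t
  proof -
    have "(\<lambda>n. exp (- (inverse (real n) * (1 / t)))) \<longlonglongrightarrow> exp (- (0 * (1 / t)))"
      by (intro tendsto_intros lim_inverse_n)
    moreover have "\<forall>\<^sub>F n in sequentially. exp (- (inverse (real n) * (1 / t))) = k n t"
      using eventually_gt_at_top[of 0]
      by eventually_elim (use that in \<open>auto simp: k_def rho_def field_simps\<close>)
    ultimately show ?thesis by (simp add: tendsto_cong)
  qed
  have g0: "g n x = 0" if "x \<notin> box a b" for n x
  proof -
    have "\<exists>j. x $ j - a $ j \<le> 0 \<or> b $ j - x $ j \<le> 0"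
      using that by (auto simp: mem_box_cart not_less)
    then obtain j where "x $ j - a $ j \<le> 0 \<or> b $ j - x $ j \<le> 0" ..
    then have "k n (x $ j - a $ j) * k n (b $ j - x $ j) = 0" using k0 by auto
    then show ?thesis unfolding g_def by (intro prod_zero) auto
  qed
  have g01: "0 \<le> g n x" "g n x \<le> 1" for n x
    unfolding g_def using k01 by (auto intro!: prod_nonneg prod_le_1 mult_le_one)
  show "\<bar>g n x\<bar> \<le> \<bar>indicator (cbox a b) x\<bar>" for n x
    using g0[of x n] g01[of n x] box_subset_cbox[of a b] by (auto simp: indicator_def)
  have "bump_alg (\<lambda>x. k n (x $ j - a $ j) * k n (b $ j - x $ j))" for n j
    unfolding k_def
    using bump_alg.mult[OF bump_alg.rho[of 0 "real n" j "- real n * a $ j"] bump_alg.rho[of 0 "- real n" j "real n * b $ j"]]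
    by (simp add: algebra_simps)
  then have "bump_alg (g n)" for n
    unfolding g_def[abs_def] by (intro bump_alg_prod) auto
  moreover have "bounded {x. g n x \<noteq> 0}" for n
    by (rule bounded_subset[OF bounded_box[of a b]]) (use g0 in auto)
  ultimately show "test_fun (g n)" for n
    by (simp add: test_fun_def bump_alg_smooth)
  show "(\<lambda>n. g n x) \<longlonglongrightarrow> indicator (box a b) x" for x
  proof (cases "x \<in> box a b")
    case True
    have "(\<lambda>n. g n x) \<longlonglongrightarrow> (\<Prod>j\<in>(UNIV::'n set). 1 * 1)"
      unfolding g_def using True by (intro tendsto_intros klim) (auto simp: mem_box_cart)
    then show ?thesis using True by simp
  qed (simp add: g0)
qed

section \<open>Approximation by test functions\<close>

definition test_limit :: "'n::finite l2 \<Rightarrow> bool" where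
  "test_limit f \<longleftrightarrow> (\<forall>e>0. \<exists>\<phi>. test_fun \<phi> \<and> norm (f - cls \<phi>) < e)"

lemma test_limit_test: "test_fun \<phi> \<Longrightarrow> test_limit (cls \<phi>)"
  unfolding test_limit_def by (auto intro!: exI[of _ \<phi>])

lemma test_limit_add: assumes "test_limit f" "test_limit g" shows "test_limit (f + g)"
  unfolding test_limit_def
proof (intro allI impI)
  fix e :: real assume "e > 0"
  then obtain p q where p: "test_fun p" "norm (f - cls p) < e / 2" and q: "test_fun q" "norm (g - cls q) < e / 2"
    using assms by (meson test_limit_def half_gt_zero)
  have "f + g - cls (\<lambda>x. p x + q x) = (f - cls p) + (g - cls q)"
    using p q by (simp add: cls_add L2_test)
  also have "norm \<dots> < e"
    using p q norm_triangle_ineq[of "f - cls p" "g - cls q"] by linarith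
  finally have "norm (f + g - cls (\<lambda>x. p x + q x)) < e" .
  then show "\<exists>\<phi>. test_fun \<phi> \<and> norm (f + g - cls \<phi>) < e"
    using test_fun_add[OF p(1) q(1)] by blast
qed

lemma test_limit_scale: assumes "test_limit f" shows "test_limit (c *\<^sub>R f)"
  unfolding test_limit_def
proof (intro allI impI)
  fix e :: real assume "e > 0"
  then have "e / (\<bar>c\<bar> + 1) > 0" by simp
  then obtain p where p: "test_fun p" "norm (f - cls p) < e / (\<bar>c\<bar> + 1)"
    using assms by (meson test_limit_def)
  have "c *\<^sub>R f - cls (\<lambda>x. c * p x) = c *\<^sub>R (f - cls p)"
    using p by (simp add: cls_scale L2_test algebra_simps)
  then have "norm (c *\<^sub>R f - cls (\<lambda>x. c * p x)) = \<bar>c\<bar> * norm (f - cls p)" by simp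
  also have "\<dots> \<le> (\<bar>c\<bar> + 1) * norm (f - cls p)" by (intro mult_right_mono) auto
  also have "\<dots> < e" using p(2) by (simp add: field_simps)
  finally show "\<exists>\<phi>. test_fun \<phi> \<and> norm (c *\<^sub>R f - cls \<phi>) < e"
    using test_fun_scale[OF p(1)] by blast
qed

lemma test_limit_lim: assumes "g \<longlonglongrightarrow> f" "\<And>n. test_limit (g n)" shows "test_limit f"
  unfolding test_limit_def
proof (intro allI impI)
  fix e :: real assume e: "e > 0"
  then obtain n where n: "norm (g n - f) < e / 2"
    using assms(1) by (meson LIMSEQ_D half_gt_zero order_refl)
  obtain p where p: "test_fun p" "norm (g n - cls p) < e / 2"
    using assms(2) e by (meson test_limit_def half_gt_zero)
  have "norm (f - cls p) < e"
    using norm_triangle_ineq[of "f - g n" "g n - cls p"] n p by (simp add: norm_minus_commute)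
  then show "\<exists>\<phi>. test_fun \<phi> \<and> norm (f - cls \<phi>) < e" using p(1) by blast
qed

lemma test_fun_0: "test_fun (\<lambda>x. 0)"
  using bump_alg_smooth[OF bump_alg.const[of 0]] by (simp add: test_fun_def)

lemma test_limit_0: "test_limit 0"
  using test_limit_test[OF test_fun_0] by (simp add: cls_zero)

lemma test_limit_sum: "finite A \<Longrightarrow> (\<And>i. i \<in> A \<Longrightarrow> test_limit (f i)) \<Longrightarrow> test_limit (\<Sum>i\<in>A. f i)"
  by (induction A rule: finite_induct) (auto intro: test_limit_0 test_limit_add)

lemma test_limit_box: "test_limit (cls (indicator (box a b)))"
proof -
  obtain g where g: "\<And>n. test_fun (g n)" "\<And>n x. \<bar>g n x\<bar> \<le> \<bar>indicator (cbox a b) x\<bar>"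
    "\<And>x. (\<lambda>n. g n x) \<longlonglongrightarrow> indicator (box a b) x"
    using exists_bump_sequence[of a b] by metis
  have "(\<lambda>n. cls (g n)) \<longlonglongrightarrow> cls (indicator (box a b))"
  proof (rule tendsto_cls_dominated(3)[OF _ _ g(3) L2_indicator_compact[OF compact_cbox] g(2)])
    show "g n \<in> borel_measurable lborel" for n
      using g(1)[of n] by (intro smooth_borel) (simp add: test_fun_def)
  qed auto
  then show ?thesis by (rule test_limit_lim) (auto intro: test_limit_test g)
qed

lemma L2_indicator_Int_box: "A \<in> sets borel \<Longrightarrow> L2 (indicator (A \<inter> box a b))"
  by (rule L2_dominated[OF L2_indicator_compact[OF compact_cbox[of a b]]])
    (use box_subset_cbox[of a b] in \<open>auto simp: indicator_def\<close>)

text \<open>Dynkin's argument over the system of boxes, which is closed under intersection. Cutting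
  with a fixed box keeps the complements square integrable and gives the dominating function for
  disjoint unions.\<close>

lemma test_limit_indicator:
  fixes A :: "(real^'n::finite) set"
  assumes "A \<in> sets borel"
  shows "test_limit (cls (indicator (A \<inter> box a b)))"
proof -
  have eq: "sets (borel :: (real^'n) measure) = sigma_sets UNIV (range (\<lambda>(a, b). box a b))"
    by (simp add: borel_eq_box)
  have st: "Int_stable (range (\<lambda>(a, b::real^'n). box a b))"
    by (auto simp: Int_stable_def box_Int_box)
  have "A \<in> sigma_sets UNIV (range (\<lambda>(a, b::real^'n). box a b))" using assms eq by simp
  from st Pow_UNIV[THEN equalityD2, THEN subset_trans[OF subset_UNIV]] this
  show ?thesis
  proof (induction rule: sigma_sets_induct_disjoint)
    case (basic A)
    then show ?case by (auto simp: box_Int_box intro: test_limit_box)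
  next
    case empty
    have "(indicator ({} :: (real^'n) set) :: _ \<Rightarrow> real) = (\<lambda>x. 0)" by (rule ext) simp
    then show ?case by (simp add: cls_zero test_limit_0)
  next
    case (compl A)
    then have A: "A \<in> sets borel" using eq by simp
    have "indicator ((UNIV - A) \<inter> box a b) = (\<lambda>x. indicator (UNIV \<inter> box a b) x - indicator (A \<inter> box a b) x :: real)"
      by (auto simp: indicator_def)
    then have "cls (indicator ((UNIV - A) \<inter> box a b)) = cls (indicator (UNIV \<inter> box a b)) + (-1) *\<^sub>R cls (indicator (A \<inter> box a b))"
      using L2_indicator_Int_box[OF A, of a b] L2_indicator_Int_box[of UNIV a b] by (simp add: cls_diff)
    moreover have "test_limit (cls (indicator (UNIV \<inter> box a b)) + (-1) *\<^sub>R cls (indicator (A \<inter> box a b)))"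
      using test_limit_box[of a b] compl.IH by (intro test_limit_add test_limit_scale) auto
    ultimately show ?case by simp
  next
    case (union A)
    then have A: "A i \<in> sets borel" for i using eq by auto
    \<comment> \<open>By disjointness the partial sums are indicators of partial unions. At each
      point they are eventually constant.\<close>
    define g where "g n x = (\<Sum>i<n. indicator (A i \<inter> box a b) x :: real)" for n x
    have cg: "cls (g n) = (\<Sum>i<n. cls (indicator (A i \<inter> box a b)))" for n
      unfolding g_def[abs_def] by (rule cls_sum) (auto intro: L2_indicator_Int_box A)
    have ge: "g n x = indicator ((\<Union>i<n. A i) \<inter> box a b) x" for n x
    proof -
      have "disjoint_family_on (\<lambda>i. A i \<inter> box a b) {..<n}"
        using union.hyps(1) by (auto simp: disjoint_family_on_def)
      then have "indicator (\<Union>i<n. A i \<inter> box a b) x = g n x"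
        unfolding g_def by (intro indicator_UN_disjoint) auto
      moreover have "(\<Union>i<n. A i \<inter> box a b) = (\<Union>i<n. A i) \<inter> box a b" by auto
      ultimately show ?thesis by simp
    qed
    have "(\<lambda>n. cls (g n)) \<longlonglongrightarrow> cls (indicator ((\<Union>i. A i) \<inter> box a b))"
    proof (rule tendsto_cls_dominated(3)[OF _ _ _ L2_indicator_compact[OF compact_cbox[of a b]]])
      show "g n \<in> borel_measurable lborel" for n using A by (auto simp: g_def[abs_def])
      show "indicator ((\<Union>i. A i) \<inter> box a b) \<in> borel_measurable lborel"
        using A by (intro borel_measurable_indicator) auto
      show "\<bar>g n x\<bar> \<le> \<bar>indicator (cbox a b) x\<bar>" for n x
        unfolding ge using box_subset_cbox[of a b] by (auto simp: indicator_def)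
      show "(\<lambda>n. g n x) \<longlonglongrightarrow> indicator ((\<Union>i. A i) \<inter> box a b) x" for x
      proof (rule tendsto_eventually)
        show "\<forall>\<^sub>F n in sequentially. g n x = indicator ((\<Union>i. A i) \<inter> box a b) x"
        proof (cases "x \<in> (\<Union>i. A i)")
          case True
          then obtain i where "x \<in> A i" by auto
          have "g n x = indicator ((\<Union>i. A i) \<inter> box a b) x" if "i < n" for n
            using that \<open>x \<in> A i\<close> unfolding ge by (auto simp: indicator_def)
          then show ?thesis
            by (rule eventually_mono[OF eventually_gt_at_top[of i]])
        qed (auto simp: ge indicator_def)
      qed
    qed
    then show ?case
      by (rule test_limit_lim) (auto simp: cg intro!: test_limit_sum union)
  qed
qed

text \<open>Simple functions bounded by twice the modulus of \<open>g\<close> converge to it.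
  Cutting them off to growing cubes brings their level sets within reach of
  \<open>test_limit_indicator\<close>.\<close>

lemma test_limit_all: "test_limit (f :: 'n::finite l2)"
proof (cases f rule: l2_cases)
  fix g assume g: "L2 g" "f = cls g"
  then have "g \<in> borel_measurable lborel" by (simp add: L2_def)
  from borel_measurable_implies_sequence_metric[OF this, of 0]
  obtain F where F: "\<And>i. simple_function lborel (F i)" "\<And>x. (\<lambda>i. F i x) \<longlonglongrightarrow> g x"
    "\<And>i x. \<bar>F i x\<bar> \<le> 2 * \<bar>g x\<bar>"
    by (auto simp: dist_norm)
  define B where "B n = box (- (\<chi> i. real n)) ((\<chi> i. real n) :: real^'n)" for n
  define G where "G n x = F n x * indicator (B n) x" for n x
  have Fm: "F i \<in> borel_measurable lborel" for i using F(1) by (rule borel_measurable_simple_function)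
  have "(\<lambda>n. cls (G n)) \<longlonglongrightarrow> cls g"
  proof (rule tendsto_cls_dominated(3)[where h = "\<lambda>x. 2 * g x"])
    show "G n \<in> borel_measurable lborel" for n
      unfolding G_def[abs_def] B_def using Fm[of n] by measurable
    show "g \<in> borel_measurable lborel" "L2 (\<lambda>x. 2 * g x)"
      using g by (auto simp: L2_def)
    show "\<bar>G n x\<bar> \<le> \<bar>2 * g x\<bar>" for n x
      using F(3)[of n x] by (auto simp: G_def indicator_def abs_mult)
    show "(\<lambda>n. G n x) \<longlonglongrightarrow> g x" for x
    proof -
      obtain N :: nat where N: "norm x < real N" using reals_Archimedean2 by blast
      have "x \<in> B n" if "n \<ge> N" for n
      proof -
        have "\<bar>x $ i\<bar> < real n" for i
          using component_le_norm_cart[of x i] N that by linarith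
        then show ?thesis by (simp add: B_def mem_box_cart) (simp add: abs_less_iff minus_less_iff)
      qed
      then have "\<forall>\<^sub>F n in sequentially. F n x = G n x"
        by (auto simp: eventually_sequentially G_def indicator_def)
      then show ?thesis using F(2)[of x] by (simp add: tendsto_cong)
    qed
  qed
  moreover have "test_limit (cls (G n))" for n
  proof -
    let ?A = "\<lambda>y. F n -` {y}"
    have fin: "finite (range (F n))" using simple_functionD(1)[OF F(1)[of n]] by simp
    have A: "?A y \<in> sets borel" for y using simple_functionD(2)[OF F(1)[of n], of "{y}"] by simp
    have Geq: "G n = (\<lambda>x. \<Sum>y\<in>range (F n). y * indicator (?A y \<inter> B n) x)"
    proof
      fix x
      have "(\<Sum>y\<in>range (F n). y * indicator (?A y \<inter> B n) x) = (\<Sum>y\<in>range (F n). if y = F n x then G n x else 0)"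
        by (intro sum.cong) (auto simp: indicator_def G_def)
      then show "G n x = (\<Sum>y\<in>range (F n). y * indicator (?A y \<inter> B n) x)"
        using fin by simp
    qed
    have "cls (G n) = (\<Sum>y\<in>range (F n). y *\<^sub>R cls (indicator (?A y \<inter> B n)))"
      unfolding Geq unfolding B_def
      by (subst cls_sum)
        (auto intro!: fin L2_scale L2_indicator_Int_box A sum.cong cls_scale)
    then show ?thesis
      unfolding B_def by (auto intro!: test_limit_sum test_limit_scale test_limit_indicator fin A)
  qed
  ultimately show ?thesis unfolding g(2) by (rule test_limit_lim)
qed

lemma l2_approx:
  obtains \<phi> where "\<And>n. test_fun (\<phi> n)" "(\<lambda>n. cls (\<phi> n)) \<longlonglongrightarrow> f"
proof -
  have "\<exists>\<phi>. test_fun \<phi> \<and> norm (f - cls \<phi>) < inverse (real (Suc n))" for n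
    using test_limit_all[of f] unfolding test_limit_def by (metis inverse_positive_iff_positive of_nat_0_less_iff zero_less_Suc)
  then obtain \<phi> where \<phi>: "\<And>n. test_fun (\<phi> n)" "\<And>n. norm (f - cls (\<phi> n)) < inverse (real (Suc n))"
    by metis
  have "(\<lambda>n. cls (\<phi> n) - f) \<longlonglongrightarrow> 0"
    by (rule Lim_null_comparison[OF _ LIMSEQ_inverse_real_of_nat])
      (use \<phi>(2) in \<open>auto simp: norm_minus_commute less_imp_le\<close>)
  then show ?thesis using \<phi>(1) by (intro that[of \<phi>]) (auto simp: LIM_zero_iff)
qed

text \<open>Test functions converging to \<open>f\<close> itself are inserted; in the limit the
  hypothesis becomes \<open>norm f * norm f \<le> K * norm f\<close>.\<close>

lemma norm_le_by_test:
  assumes K: "K \<ge> 0" and *: "\<And>\<phi>. test_fun \<phi> \<Longrightarrow> \<bar>inner f (cls \<phi>)\<bar> \<le> K * norm (cls \<phi>)"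
  shows "norm f \<le> K"
proof -
  obtain \<phi> where \<phi>: "\<And>n. test_fun (\<phi> n)" "(\<lambda>n. cls (\<phi> n)) \<longlonglongrightarrow> f" using l2_approx[of f] by metis
  have "(\<lambda>n. \<bar>inner f (cls (\<phi> n))\<bar>) \<longlonglongrightarrow> \<bar>inner f f\<bar>" "(\<lambda>n. K * norm (cls (\<phi> n))) \<longlonglongrightarrow> K * norm f"
    using \<phi>(2) by (intro tendsto_intros; simp)+
  then have "\<bar>inner f f\<bar> \<le> K * norm f"
    by (rule LIMSEQ_le) (use * \<phi>(1) in blast)
  then have "norm f * norm f \<le> K * norm f"
    by (simp add: power2_norm_eq_inner[symmetric] power2_eq_square)
  then show ?thesis using K by (cases "f = 0") auto
qed

lemma l2_eqI:
  assumes "\<And>\<phi>. test_fun \<phi> \<Longrightarrow> inner f (cls \<phi>) = inner g (cls \<phi>)"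
  shows "f = g"
  using norm_le_by_test[of 0 "f - g"] assms by (simp add: inner_diff_left)

section \<open>Weak derivatives as generators of translations\<close>

lemmas tau_linear_simps = linear_add[OF linear_tau] linear_diff[OF linear_tau] linear_scale[OF linear_tau]
  linear_0[OF linear_tau] linear_sum[OF linear_tau] linear_neg[OF linear_tau]

lemma inner_tau_left: "inner (tau h f) g = inner f (tau (- h) g)"
  using inner_tau[of "- h" "tau h f" g] by (simp add: tau_tau)

lemma isd_unique: "isd i f g \<Longrightarrow> isd i f g' \<Longrightarrow> g = g'"
  unfolding isd_def by (rule tendsto_unique[rotated]) auto

lemma isd_add: "isd i f f' \<Longrightarrow> isd i g g' \<Longrightarrow> isd i (f + g) (f' + g')"
  unfolding isd_def using tendsto_add
  by (fastforce simp: tau_linear_simps scaleR_diff_right scaleR_add_right add_diff_add)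

lemma isd_scale: "isd i f f' \<Longrightarrow> isd i (c *\<^sub>R f) (c *\<^sub>R f')"
  unfolding isd_def using tendsto_scaleR[OF tendsto_const[of c]]
  by (fastforce simp: tau_linear_simps scaleR_diff_right mult.commute)

lemma isd_uminus: "isd i f f' \<Longrightarrow> isd i (- f) (- f')"
  using isd_scale[of i f f' "-1"] by simp

lemma isd_diff: "isd i f f' \<Longrightarrow> isd i g g' \<Longrightarrow> isd i (f - g) (f' - g')"
  using isd_add[of i f f' "- g" "- g'"] isd_uminus[of i g g'] by simp

lemma isd_0: "isd i 0 0"
  unfolding isd_def by (simp add: tau_linear_simps)

lemma isd_sum: "finite A \<Longrightarrow> (\<And>j. j \<in> A \<Longrightarrow> isd i (f j) (g j)) \<Longrightarrow> isd i (\<Sum>j\<in>A. f j) (\<Sum>j\<in>A. g j)"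
  by (induction A rule: finite_induct) (auto intro: isd_0 isd_add)

lemma isd_tau: "isd i f g \<Longrightarrow> isd i (tau k f) (tau k g)"
proof -
  assume "isd i f g"
  then have "((\<lambda>h. tau k ((tau (h *\<^sub>R axis i 1) f - f) /\<^sub>R h)) \<longlongrightarrow> tau k g) (at 0)"
    unfolding isd_def by (rule bounded_linear.tendsto[OF bounded_linear_tau])
  then show ?thesis
    unfolding isd_def by (simp add: tau_linear_simps tau_tau add.commute)
qed

lemma tendsto_at_0_minus:
  fixes F :: "real \<Rightarrow> 'a::topological_space"
  assumes "(F \<longlongrightarrow> l) (at 0)"
  shows "((\<lambda>h. F (- h)) \<longlongrightarrow> l) (at 0)"
proof -
  have "filtermap uminus (at (0::real)) = at 0"
    using filtermap_at_minus[of "0::real"] by simp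
  then show ?thesis using assms by (simp add: tendsto_compose_filtermap[of F uminus, unfolded o_def])
qed

text \<open>Integration by parts at the discrete level: the adjoint of the translation by
  \<open>h\<close> is the translation by \<open>- h\<close>. Letting \<open>h\<close> tend to 0
  gives \<open>isd_inner\<close>.\<close>

lemma inner_diffquot:
  "inner ((tau (h *\<^sub>R e) f - f) /\<^sub>R h) p = - inner f ((tau (- h *\<^sub>R e) p - p) /\<^sub>R (- h))"
  by (simp add: inner_diff_left inner_diff_right inner_tau_left)

lemma isd_inner:
  assumes "isd i f g" "isd i p q"
  shows "inner g p = - inner f q"
proof (rule tendsto_unique)
  show "((\<lambda>h. inner ((tau (h *\<^sub>R axis i 1) f - f) /\<^sub>R h) p) \<longlongrightarrow> inner g p) (at 0)"
    using assms(1) unfolding isd_def by (intro tendsto_intros)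
  have "((\<lambda>h. (tau (- h *\<^sub>R axis i 1) p - p) /\<^sub>R (- h)) \<longlongrightarrow> q) (at 0)"
    using tendsto_at_0_minus[OF assms(2)[unfolded isd_def]] .
  then show "((\<lambda>h. inner ((tau (h *\<^sub>R axis i 1) f - f) /\<^sub>R h) p) \<longlongrightarrow> - inner f q) (at 0)"
    unfolding inner_diffquot by (intro tendsto_intros)
qed auto

lemma has_vector_derivative_iff_quotient:
  "(f has_vector_derivative f') (at x within S) \<longleftrightarrow> ((\<lambda>y. (f y - f x) /\<^sub>R (y - x)) \<longlongrightarrow> f') (at x within S)"
proof -
  have "norm (f y - f x - (y - x) *\<^sub>R f') / norm (y - x) = norm ((f y - f x) /\<^sub>R (y - x) - f')" if "y \<noteq> x" for y
  proof -
    have "(f y - f x) /\<^sub>R (y - x) - f' = inverse (y - x) *\<^sub>R (f y - f x - (y - x) *\<^sub>R f')"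
      using that by (simp add: scaleR_diff_right)
    then show ?thesis by (simp add: divide_inverse mult.commute)
  qed
  then have "((\<lambda>y. norm (f y - f x - (y - x) *\<^sub>R f') / norm (y - x)) \<longlongrightarrow> 0) (at x within S) \<longleftrightarrow>
      ((\<lambda>y. norm ((f y - f x) /\<^sub>R (y - x) - f')) \<longlongrightarrow> 0) (at x within S)"
    by (intro tendsto_cong) (auto simp: eventually_at intro!: exI[of _ 1])
  then show ?thesis
    by (simp add: has_vector_derivative_def has_derivative_iff_norm bounded_linear_scaleR_left
        tendsto_norm_zero_iff LIM_zero_iff)
qed

text \<open>The group law and the continuity of a fixed translation carry the derivative of the
  orbit from 0 to \<open>s\<close>.\<close>

lemma tau_has_vector_derivative:
  assumes "isd i f g"
  shows "((\<lambda>s. tau (s *\<^sub>R axis i 1) f) has_vector_derivative tau (s *\<^sub>R axis i 1) g) (at s)"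
proof -
  have "((\<lambda>h. tau (s *\<^sub>R axis i 1) ((tau (h *\<^sub>R axis i 1) f - f) /\<^sub>R h)) \<longlongrightarrow> tau (s *\<^sub>R axis i 1) g) (at 0)"
    using assms unfolding isd_def by (rule bounded_linear.tendsto[OF bounded_linear_tau])
  then have "((\<lambda>h. (tau ((s + h) *\<^sub>R axis i 1) f - tau (s *\<^sub>R axis i 1) f) /\<^sub>R h) \<longlongrightarrow> tau (s *\<^sub>R axis i 1) g) (at 0)"
    by (simp add: tau_linear_simps tau_tau scaleR_add_left)
  then have "((\<lambda>y. (tau (y *\<^sub>R axis i 1) f - tau (s *\<^sub>R axis i 1) f) /\<^sub>R (y - s)) \<longlongrightarrow> tau (s *\<^sub>R axis i 1) g) (at s)"
    by (subst LIM_offset_zero_iff) simp_all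
  then show ?thesis
    by (simp add: has_vector_derivative_iff_quotient)
qed

text \<open>Mean value inequality along the orbit, whose velocity has the constant norm of
  \<open>g\<close>. It yields the strong continuity of translations and a bound on difference
  quotients that is uniform in the step.\<close>

lemma norm_tau_diff_le:
  assumes "isd i f g"
  shows "norm (tau (h *\<^sub>R axis i 1) f - f) \<le> \<bar>h\<bar> * norm g"
proof -
  have "norm (tau (h *\<^sub>R axis i 1) f - tau (0 *\<^sub>R axis i 1) f) \<le> norm g * norm (h - 0)"
  proof (rule differentiable_bound[OF convex_UNIV])
    show "((\<lambda>s. tau (s *\<^sub>R axis i 1) f) has_derivative (\<lambda>x. x *\<^sub>R tau (s *\<^sub>R axis i 1) g)) (at s within UNIV)" for s
      using tau_has_vector_derivative[OF assms] by (simp add: has_vector_derivative_def)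
    show "onorm (\<lambda>x. x *\<^sub>R tau (s *\<^sub>R axis i 1) g) \<le> norm g" for s
      by (rule onorm_le) (simp add: mult.commute)
  qed auto
  then show ?thesis by (simp add: mult.commute)
qed

lemma pds_shift: "pds is (\<lambda>x. f (x + h)) = (\<lambda>x. pds is f (x + h))"
  by (induction "is") (auto simp: pdx_def fun_eq_iff add.assoc add.commute add.left_commute)

lemma test_fun_shift: 
  fixes f :: "real^'n::finite \<Rightarrow> real"
  assumes "test_fun f" shows "test_fun (\<lambda>x. f (x + h))"
proof -
  have "(\<lambda>x. pds is f (x + h)) differentiable (at x)" for "is" x
  proof -
    have "pds is f differentiable (at (x + h))" using assms by (auto simp: test_fun_def smooth_def)
    then have "(pds is f \<circ> (\<lambda>x. x + h)) differentiable (at x)"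
      by (intro differentiable_chain_at) auto
    then show ?thesis by (simp add: o_def)
  qed
  moreover have "bounded {x. f (x + h) \<noteq> 0}"
  proof -
    have "{x. f (x + h) \<noteq> 0} = (\<lambda>x. - h + x) ` {x. f x \<noteq> 0}"
      by (auto simp: image_iff intro!: exI[of _ "_ + h"])
    then show ?thesis using assms by (simp add: test_fun_def bounded_translation_minus)
  qed
  ultimately show ?thesis by (simp add: test_fun_def smooth_def pds_shift)
qed

text \<open>Strong continuity is clear for test functions and passes to their limits because
  translations are isometries.\<close>

lemma tau_tendsto_0: "((\<lambda>s. tau (s *\<^sub>R axis i 1) f) \<longlongrightarrow> f) (at 0)"
proof (rule tendstoI)
  fix e :: real assume e: "e > 0"
  obtain \<phi> where \<phi>: "test_fun \<phi>" "norm (f - cls \<phi>) < e / 3"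
    using test_limit_all[of f] e unfolding test_limit_def by (meson divide_pos_pos zero_less_numeral)
  let ?N = "norm (cls (pdx i \<phi>))"
  have *: "dist (tau (s *\<^sub>R axis i 1) f) f < e" if s: "\<bar>s\<bar> < e / (3 * (?N + 1))" for s
  proof -
    let ?t = "tau (s *\<^sub>R axis i 1)"
    have "?t f - f = ?t (f - cls \<phi>) + (?t (cls \<phi>) - cls \<phi>) + (cls \<phi> - f)"
      by (simp add: tau_linear_simps)
    then have "norm (?t f - f) \<le> norm (?t (f - cls \<phi>)) + norm (?t (cls \<phi>) - cls \<phi>) + norm (cls \<phi> - f)"
      by (metis norm_triangle_mono norm_triangle_ineq order_refl)
    moreover have "norm (?t (cls \<phi>) - cls \<phi>) \<le> \<bar>s\<bar> * (?N + 1)"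
      using norm_tau_diff_le[OF isd_test[OF \<phi>(1)], of s i] by (simp add: distrib_left)
    moreover have "\<bar>s\<bar> * (?N + 1) < e / 3"
    proof -
      have "?N + 1 > 0" using norm_ge_zero[of "cls (pdx i \<phi>)"] by linarith
      then show ?thesis using s by (simp add: field_simps)
    qed
    ultimately show ?thesis using \<phi>(2) by (simp add: dist_norm norm_minus_commute)
  qed
  have "e / (3 * (?N + 1)) > 0" using e by (intro divide_pos_pos mult_pos_pos add_nonneg_pos) auto
  then show "\<forall>\<^sub>F s in at 0. dist (tau (s *\<^sub>R axis i 1) f) f < e"
    unfolding eventually_at by (intro exI conjI ballI impI *) (auto simp: dist_norm)
qed

text \<open>Weak derivatives are strong. The curve of translates of \<open>f\<close>, minus
  \<open>s\<close> times \<open>g\<close>, has in the weak sense the velocity "translate of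
  \<open>g\<close> minus \<open>g\<close>", which is small near 0 by strong continuity. The mean
  value inequality gives this for each pairing with a test function, and
  \<open>norm_le_by_test\<close> turns it into an L^2 bound.\<close>

lemma isd_weakI:
  fixes f g :: "'n::finite l2"
  assumes w: "\<And>\<phi>. test_fun \<phi> \<Longrightarrow> inner f (cls (pdx i \<phi>)) = - inner g (cls \<phi>)"
  shows "isd i f g"
  unfolding isd_def
proof (rule tendstoI)
  fix e :: real assume e: "e > 0"
  let ?t = "\<lambda>s. tau (s *\<^sub>R axis i 1) :: 'n l2 \<Rightarrow> 'n l2"
  have "\<forall>\<^sub>F s in at 0. dist (?t s g) g < e / 2"
    using tau_tendsto_0[of i g] e by (intro tendstoD) auto
  then obtain \<delta> where \<delta>: "\<delta> > 0" "\<And>s. s \<noteq> 0 \<Longrightarrow> \<bar>s\<bar> < \<delta> \<Longrightarrow> norm (?t s g - g) < e / 2"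
    unfolding eventually_at by (auto simp: dist_norm)
  have "dist ((?t h f - f) /\<^sub>R h) g < e" if h: "h \<noteq> 0" "\<bar>h\<bar> < \<delta>" for h
  proof -
    have "norm ((?t h f - f) /\<^sub>R h - g) \<le> e / 2"
    proof (rule norm_le_by_test)
      fix \<phi> :: "real^'n \<Rightarrow> real" assume \<phi>: "test_fun \<phi>"
      let ?p = "cls \<phi>" and ?q = "cls (pdx i \<phi>)"
      have inn: "inner f (?t s ?q) = - inner g (?t s ?p)" for s
      proof -
        have "pdx i (\<lambda>x. \<phi> (x + s *\<^sub>R axis i 1)) = (\<lambda>x. pdx i \<phi> (x + s *\<^sub>R axis i 1))"
          using pds_shift[of "[i]" \<phi>] by simp
        then show ?thesis
          using w[OF test_fun_shift[OF \<phi>], of "s *\<^sub>R axis i 1"] \<phi> by (simp add: tau_cls L2_test test_fun_pdx)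
      qed
      \<comment> \<open>The translation of \<open>f\<close> is written as the opposite translation
        of the test function, whose orbit is known to be differentiable.\<close>
      define G where "G s = inner f (?t (- s) ?p) - s * inner g ?p" for s
      have G': "(G has_field_derivative inner (?t s g - g) ?p) (at s)" for s
      proof -
        have "((\<lambda>s. ?t (- s) ?p) has_vector_derivative - 1 *\<^sub>R ?t (- s) ?q) (at s)"
          using vector_diff_chain_at[of uminus "-1" s "\<lambda>s. ?t s ?p", OF _ tau_has_vector_derivative[OF isd_test[OF \<phi>]]]
          by (simp add: o_def has_vector_derivative_minus[OF has_vector_derivative_id, simplified] del: scaleR_minus_left)
        then have "((\<lambda>s. inner f (?t (- s) ?p)) has_vector_derivative inner f (- 1 *\<^sub>R ?t (- s) ?q)) (at s)"
          by (rule bounded_linear.has_vector_derivative[OF bounded_linear_inner_right])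
        then have "((\<lambda>s. inner f (?t (- s) ?p)) has_field_derivative inner f (- 1 *\<^sub>R ?t (- s) ?q)) (at s)"
          by (simp add: has_real_derivative_iff_has_vector_derivative)
        then have "(G has_field_derivative (inner f (- 1 *\<^sub>R ?t (- s) ?q) - inner g ?p)) (at s)"
          unfolding G_def[abs_def] by (auto intro!: derivative_eq_intros)
        moreover have "inner f (- 1 *\<^sub>R ?t (- s) ?q) - inner g ?p = inner (?t s g - g) ?p"
          using inn[of "- s"] by (simp add: inner_diff_left inner_tau_left)
        ultimately show ?thesis by simp
      qed
      have "norm (G h - G 0) \<le> (e / 2 * norm ?p) * norm (h - 0)"
      proof (rule field_differentiable_bound[of "closed_segment 0 h" _ "\<lambda>s. inner (?t s g - g) ?p"])
        show "(G has_real_derivative inner (?t z g - g) ?p) (at z within closed_segment 0 h)" for z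
          using G' by (rule has_field_derivative_at_within)
        fix z assume "z \<in> closed_segment 0 h"
        then have "\<bar>z\<bar> < \<delta>" using h by (auto simp: closed_segment_eq_real_ivl split: if_splits)
        then have "norm (?t z g - g) \<le> e / 2" using \<delta>(2)[of z] e by (cases "z = 0") auto
        then show "norm (inner (?t z g - g) ?p) \<le> e / 2 * norm ?p"
          using Cauchy_Schwarz_ineq2[of "?t z g - g" ?p] mult_right_mono[OF _ norm_ge_zero, of "norm (?t z g - g)" "e / 2" ?p]
          unfolding real_norm_def by linarith
      qed auto
      moreover have "G h - G 0 = h * inner ((?t h f - f) /\<^sub>R h - g) ?p"
      proof -
        have "h * inverse h = 1" using h by simp
        then show ?thesis
          by (simp add: G_def inner_diff_left inner_tau_left right_diff_distrib flip: mult.assoc)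
      qed
      ultimately have "\<bar>h\<bar> * \<bar>inner ((?t h f - f) /\<^sub>R h - g) ?p\<bar> \<le> \<bar>h\<bar> * (e / 2 * norm ?p)"
        by (simp add: abs_mult mult_ac)
      then show "\<bar>inner ((?t h f - f) /\<^sub>R h - g) ?p\<bar> \<le> e / 2 * norm ?p"
        using h by (simp add: mult_le_cancel_left)
    qed (use e in auto)
    then show ?thesis using e by (simp add: dist_norm)
  qed
  then show "\<forall>\<^sub>F h in at 0. dist ((?t h f - f) /\<^sub>R h) g < e"
    unfolding eventually_at using \<delta>(1) by (auto simp: dist_norm)
qed

lemma isd_weakD: "isd i f g \<Longrightarrow> test_fun \<phi> \<Longrightarrow> inner f (cls (pdx i \<phi>)) = - inner g (cls \<phi>)"
  using isd_inner[OF _ isd_test[of \<phi> i], of f g] by simp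

text \<open>Only one of the two mixed derivatives is assumed to exist. The difference quotient in
  direction \<open>k\<close> commutes with the derivative in direction \<open>i\<close> and can be
  moved to the other factor; the limit of the resulting identity says that \<open>g\<close> has the
  weak derivative \<open>q\<close>.\<close>

lemma isd_commute:
  assumes "isd i f g" "isd k f p" "isd i p q"
  shows "isd k g q"
proof (rule isd_weakI)
  fix \<phi> :: "real^'a \<Rightarrow> real" assume \<phi>: "test_fun \<phi>"
  let ?D = "\<lambda>h f. (tau (h *\<^sub>R axis k 1) f - f) /\<^sub>R h"
  have "((\<lambda>h. inner g (?D h (cls \<phi>))) \<longlongrightarrow> inner g (cls (pdx k \<phi>))) (at 0)"
    using isd_test[OF \<phi>, of k] unfolding isd_def by (intro tendsto_intros)
  moreover have "inner g (?D h (cls \<phi>)) = inner (?D (- h) f) (cls (pdx i \<phi>))" for h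
  proof -
    have "isd i (?D (- h) f) (?D (- h) g)"
      by (intro isd_scale isd_diff isd_tau assms(1))
    from isd_weakD[OF this \<phi>] have "inner (?D (- h) f) (cls (pdx i \<phi>)) = - inner (?D (- h) g) (cls \<phi>)" .
    also have "\<dots> = inner g (?D h (cls \<phi>))"
      unfolding inner_diffquot[of "- h"] by simp
    finally show ?thesis by simp
  qed
  moreover have "((\<lambda>h. inner (?D (- h) f) (cls (pdx i \<phi>))) \<longlongrightarrow> inner p (cls (pdx i \<phi>))) (at 0)"
    using tendsto_at_0_minus[OF assms(2)[unfolded isd_def]] by (intro tendsto_intros)
  ultimately have "inner g (cls (pdx k \<phi>)) = inner p (cls (pdx i \<phi>))"
    by (intro tendsto_unique[of "at (0::real)"]) auto
  also have "\<dots> = - inner q (cls \<phi>)" by (rule isd_weakD[OF assms(3) \<phi>])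
  finally show "inner g (cls (pdx k \<phi>)) = - inner q (cls \<phi>)" .
qed

lemma smooth_bdd_pds: "smooth_bdd m \<Longrightarrow> smooth_bdd (pds is m)"
  unfolding smooth_bdd_def using smooth_pds by (metis pds_append)

lemma smooth_bdd_pdx: "smooth_bdd m \<Longrightarrow> smooth_bdd (pdx i m)"
  using smooth_bdd_pds[of m "[i]"] by simp

lemma smooth_bdd_mbdd: assumes "smooth_bdd m" obtains K where "mbdd m K"
proof -
  have "bounded (range (pds [] m))" using assms unfolding smooth_bdd_def by blast
  then obtain K where "\<forall>x. \<bar>m x\<bar> \<le> K" by (auto simp: bounded_iff)
  then show ?thesis using assms smooth_borel[of m] that[of K] by (auto simp: mbdd_def smooth_bdd_def)
qed

lemma mbdd_shift: "mbdd m K \<Longrightarrow> mbdd (\<lambda>x. m (x + h)) K"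
  by (auto simp: mbdd_def)

lemma mbdd_diff: "mbdd m K \<Longrightarrow> mbdd m' K' \<Longrightarrow> mbdd (\<lambda>x. m x - m' x) (K + K')"
  using mbdd_add[OF _ mbdd_scale[of m' K' "-1"], of m K] by simp

lemma mul_diff_left: assumes "mbdd m K" "mbdd m' K'"
  shows "mul (\<lambda>x. m x - m' x) f = mul m f - mul m' f"
  using mul_add_left[OF assms(1) mbdd_scale[OF assms(2), of "-1"]] mul_scale_left[OF assms(2), of "-1"] by simp

text \<open>The quotient of the product splits exactly into three terms. The first converges by
  hypothesis, the second by strong continuity of translations, and the third has a multiplier of
  order \<open>h\<close>.\<close>

lemma isd_mul:
  fixes f g :: "'n::finite l2"
  assumes m: "smooth_bdd m" and f: "isd i f g"
  shows "isd i (mul m f) (mul m g + mul (pdx i m) f)"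
proof -
  obtain K0 where K0: "mbdd m K0" using smooth_bdd_mbdd[OF m] .
  obtain K1 where K1: "mbdd (pdx i m) K1" using smooth_bdd_mbdd[OF smooth_bdd_pdx[OF m]] .
  obtain K2 where K2: "mbdd (pdx i (pdx i m)) K2" using smooth_bdd_mbdd[OF smooth_bdd_pdx[OF smooth_bdd_pdx[OF m]]] .
  let ?e = "axis i 1 :: real^'n"
  let ?t = "\<lambda>s. tau (s *\<^sub>R ?e) :: 'n l2 \<Rightarrow> 'n l2"
  \<comment> \<open>The Taylor remainder of \<open>m\<close> divided by \<open>h\<close>, small
    uniformly in \<open>x\<close> because the second derivatives of \<open>m\<close> are
    bounded.\<close>
  define r where "r h x = inverse h * (m (x + h *\<^sub>R ?e) - m x) - pdx i m x" for h x
  have r: "mbdd (r h) (K2 * \<bar>h\<bar>)" if "h \<noteq> 0" for h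
  proof -
    have "mbdd (r h) (\<bar>inverse h\<bar> * (K0 + K0) + K1)"
      unfolding r_def by (intro mbdd_diff mbdd_scale mbdd_shift K0 K1)
    moreover have "\<bar>r h x\<bar> \<le> K2 * \<bar>h\<bar>" for x
    proof -
      have sm: "smooth m" "smooth (pdx i m)" using m smooth_bdd_pdx[OF m] by (auto simp: smooth_bdd_def)
      have "\<bar>m (x + h *\<^sub>R ?e) - m x - h * pdx i m x\<bar> \<le> K2 * h\<^sup>2"
        using second_order_bound[of "\<lambda>h. m (x + h *\<^sub>R ?e)" "\<lambda>h. pdx i m (x + h *\<^sub>R ?e)"
            "\<lambda>h. pdx i (pdx i m) (x + h *\<^sub>R ?e)" K2 h]
          pdx_line[OF smooth_differentiable[OF sm(1)]] pdx_line[OF smooth_differentiable[OF sm(2)]] K2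
        by (simp add: mbdd_def)
      moreover have "m (x + h *\<^sub>R ?e) - m x - h * pdx i m x = h * r h x"
        using that by (simp add: r_def field_simps)
      moreover have "K2 * h\<^sup>2 = \<bar>h\<bar> * (K2 * \<bar>h\<bar>)"
        by (simp add: power2_eq_square abs_mult_self_eq mult.left_commute)
      ultimately have "\<bar>h\<bar> * \<bar>r h x\<bar> \<le> \<bar>h\<bar> * (K2 * \<bar>h\<bar>)"
        by (simp only: abs_mult)
      then show ?thesis using that by (simp add: mult_le_cancel_left)
    qed
    ultimately show ?thesis by (simp add: mbdd_def)
  qed
  have eq: "(?t h (mul m f) - mul m f) /\<^sub>R h
      = mul m ((?t h f - f) /\<^sub>R h) + mul (pdx i m) (?t h f) + mul (r h) (?t h f)" if "h \<noteq> 0" for h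
  proof -
    have "mul (r h) (?t h f) = inverse h *\<^sub>R (mul (\<lambda>x. m (x + h *\<^sub>R ?e)) (?t h f) - mul m (?t h f)) - mul (pdx i m) (?t h f)"
      unfolding r_def
      by (simp add: mul_diff_left[OF mbdd_scale[OF mbdd_diff[OF mbdd_shift[OF K0] K0]] K1]
         mul_scale_left[OF mbdd_diff[OF mbdd_shift[OF K0] K0]] mul_diff_left[OF mbdd_shift[OF K0] K0])
    then show ?thesis
      by (simp add: tau_mul[OF K0] linear_scale[OF linear_mul[OF K0]] linear_diff[OF linear_mul[OF K0]] algebra_simps)
  qed
  have tf: "((\<lambda>h. ?t h f) \<longlongrightarrow> f) (at 0)" by (rule tau_tendsto_0)
  have "((\<lambda>h. mul (r h) (?t h f)) \<longlongrightarrow> 0) (at 0)"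
  proof (rule Lim_null_comparison)
    show "\<forall>\<^sub>F h in at 0. norm (mul (r h) (?t h f)) \<le> K2 * \<bar>h\<bar> * norm f"
      using norm_mul_le[OF r, of _ "?t _ f"] by (auto simp: eventually_at intro!: exI[of _ 1])
    show "((\<lambda>h. K2 * \<bar>h\<bar> * norm f) \<longlongrightarrow> 0) (at (0::real))"
      by (rule tendsto_eq_intros | simp)+
  qed
  moreover have "((\<lambda>h. mul m ((?t h f - f) /\<^sub>R h) + mul (pdx i m) (?t h f)) \<longlongrightarrow> mul m g + mul (pdx i m) f) (at 0)"
    using f unfolding isd_def
    by (intro tendsto_add bounded_linear.tendsto[OF bounded_linear_mul[OF K0]] bounded_linear.tendsto[OF bounded_linear_mul[OF K1]] tf)
  ultimately have "((\<lambda>h. mul m ((?t h f - f) /\<^sub>R h) + mul (pdx i m) (?t h f) + mul (r h) (?t h f)) \<longlongrightarrow> mul m g + mul (pdx i m) f) (at 0)"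
    using tendsto_add by fastforce
  then show ?thesis
    unfolding isd_def
    by (rule Lim_transform_eventually) (auto simp: eventually_at eq intro!: exI[of _ 1])
qed

section \<open>Sobolev spaces\<close>

text \<open>A total operator. Outside the domain of the generator its value is arbitrary, hence the
  \<open>sob\<close> hypotheses in all the rules for \<open>dd\<close>.\<close>

definition dd :: "'n::finite \<Rightarrow> 'n l2 \<Rightarrow> 'n l2" where
  "dd i f = (THE g. isd i f g)"

lemma dd_eq: "isd i f g \<Longrightarrow> dd i f = g"
  unfolding dd_def by (rule the_equality) (auto dest: isd_unique)

text \<open>The space H^k as an iterated domain, with no norm attached, so that closure properties
  are plain inductions on \<open>k\<close>.\<close>

primrec sob :: "nat \<Rightarrow> 'n::finite l2 \<Rightarrow> bool" where
  "sob 0 f \<longleftrightarrow> True"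
| "sob (Suc k) f \<longleftrightarrow> (\<forall>i. isd i f (dd i f) \<and> sob k (dd i f))"

lemma sob_SucI:
  assumes "\<And>i. isd i f (g i)" "\<And>i. sob k (g i)"
  shows "sob (Suc k) f"
proof -
  have "dd i f = g i" for i by (rule dd_eq[OF assms(1)])
  then show ?thesis using assms by simp
qed

lemma sob_isd: "sob (Suc k) f \<Longrightarrow> isd i f (dd i f)" and sob_dd: "sob (Suc k) f \<Longrightarrow> sob k (dd i f)"
  by simp_all

lemma sob_Suc_imp: "sob (Suc k) f \<Longrightarrow> sob k f"
proof (induction k arbitrary: f)
  case (Suc k)
  then show ?case by (metis sob.simps(2))
qed simp

lemma sob_mono: "sob l f \<Longrightarrow> k \<le> l \<Longrightarrow> sob k f"
proof (induction l arbitrary: k)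
  case (Suc l)
  then show ?case using sob_Suc_imp by (metis le_Suc_eq)
qed simp

lemma sob_add: "sob k f \<Longrightarrow> sob k g \<Longrightarrow> sob k (f + g)"
proof (induction k arbitrary: f g)
  case (Suc k)
  then show ?case by (intro sob_SucI[where g = "\<lambda>i. dd i f + dd i g"] isd_add) auto
qed simp

lemma sob_scale: "sob k f \<Longrightarrow> sob k (c *\<^sub>R f)"
proof (induction k arbitrary: f)
  case (Suc k)
  then show ?case by (intro sob_SucI[where g = "\<lambda>i. c *\<^sub>R dd i f"] isd_scale) auto
qed simp

lemma sob_diff: "sob k f \<Longrightarrow> sob k g \<Longrightarrow> sob k (f - g)"
  using sob_add[of k f "(-1) *\<^sub>R g"] sob_scale[of k g "-1"] by simp

lemma sob_0: "sob k 0"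
  by (induction k) (auto intro: sob_SucI[where g = "\<lambda>i. 0"] isd_0 simp del: sob.simps(2))

lemma sob_tau: "sob k f \<Longrightarrow> sob k (tau h f)"
proof (induction k arbitrary: f)
  case (Suc k)
  then show ?case by (intro sob_SucI[where g = "\<lambda>i. tau h (dd i f)"] isd_tau) auto
qed simp

lemma sob_sum: "finite A \<Longrightarrow> (\<And>j. j \<in> A \<Longrightarrow> sob k (f j)) \<Longrightarrow> sob k (\<Sum>j\<in>A. f j)"
  by (induction A rule: finite_induct) (auto intro: sob_0 sob_add)

lemma sob_mul: "smooth_bdd m \<Longrightarrow> sob k f \<Longrightarrow> sob k (mul m f)"
proof (induction k arbitrary: m f)
  case (Suc k)
  then show ?case
    by (intro sob_SucI[where g = "\<lambda>i. mul m (dd i f) + mul (pdx i m) f"] isd_mul sob_add Suc.IH)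
      (auto intro: smooth_bdd_pdx sob_Suc_imp simp del: sob.simps dest: sob_isd sob_dd)
qed simp

lemma sob_test: "test_fun \<phi> \<Longrightarrow> sob k (cls \<phi>)"
proof (induction k arbitrary: \<phi>)
  case (Suc k)
  then show ?case by (intro sob_SucI[where g = "\<lambda>i. cls (pdx i \<phi>)"] isd_test) (auto intro: test_fun_pdx)
qed simp

lemma dd_add: "sob (Suc 0) f \<Longrightarrow> sob (Suc 0) g \<Longrightarrow> dd i (f + g) = dd i f + dd i g"
  by (intro dd_eq isd_add) auto
lemma dd_diff: "sob (Suc 0) f \<Longrightarrow> sob (Suc 0) g \<Longrightarrow> dd i (f - g) = dd i f - dd i g"
  by (intro dd_eq isd_diff) auto
lemma dd_scale: "sob (Suc 0) f \<Longrightarrow> dd i (c *\<^sub>R f) = c *\<^sub>R dd i f"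
  by (intro dd_eq isd_scale) auto
lemma dd_tau: "sob (Suc 0) f \<Longrightarrow> dd i (tau h f) = tau h (dd i f)"
  by (intro dd_eq isd_tau) auto
lemma dd_sum: "finite A \<Longrightarrow> (\<And>j. j \<in> A \<Longrightarrow> sob (Suc 0) (f j)) \<Longrightarrow> dd i (\<Sum>j\<in>A. f j) = (\<Sum>j\<in>A. dd i (f j))"
  by (intro dd_eq isd_sum) auto
lemma dd_mul: "smooth_bdd m \<Longrightarrow> sob (Suc 0) f \<Longrightarrow> dd i (mul m f) = mul m (dd i f) + mul (pdx i m) f"
  by (intro dd_eq isd_mul) auto
lemma dd_inner: "sob (Suc 0) f \<Longrightarrow> sob (Suc 0) g \<Longrightarrow> inner (dd i f) g = - inner f (dd i g)"
  by (rule isd_inner) auto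
lemma dd_0: "dd i 0 = 0"
  by (intro dd_eq isd_0)

lemma dd_commute: "sob (Suc (Suc 0)) f \<Longrightarrow> dd k (dd i f) = dd i (dd k f)"
  by (rule dd_eq, rule isd_commute[of i f _ k "dd k f"]) auto

text \<open>The square of \<open>Hnorm\<close>, see \<open>Hnorm_sq\<close>. The recursion counts a
  mixed derivative once for every order of its directions, exactly as the sum over lists does.
  Squares are kept because energies are quadratic.\<close>

primrec nn :: "nat \<Rightarrow> 'n::finite l2 \<Rightarrow> real" where
  "nn 0 f = (norm f)\<^sup>2"
| "nn (Suc k) f = (norm f)\<^sup>2 + (\<Sum>i\<in>UNIV. nn k (dd i f))"

lemma nn_nonneg [simp]: "0 \<le> nn k f"
  by (induction k arbitrary: f) (simp_all add: sum_nonneg)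

lemma norm_le_nn: "(norm f)\<^sup>2 \<le> nn k f"
  by (cases k) (auto intro: sum_nonneg)

lemma nn_dd_le: "nn k (dd i f) \<le> nn (Suc k) f"
proof -
  have "nn k (dd i f) \<le> (\<Sum>i\<in>UNIV. nn k (dd i f))"
    by (intro member_le_sum) auto
  then show ?thesis by simp (smt (verit) zero_le_power2)
qed

lemma nn_Suc_ge: "nn k f \<le> nn (Suc k) f"
proof (induction k arbitrary: f)
  case (Suc k)
  have "(\<Sum>i\<in>UNIV. nn k (dd i f)) \<le> (\<Sum>i\<in>UNIV. nn (Suc k) (dd i f))"
    by (intro sum_mono Suc.IH)
  then show ?case
    using nn.simps(2)[of k f] nn.simps(2)[of "Suc k" f] by linarith
qed (auto intro: sum_nonneg)

lemma nn_mono: "k \<le> l \<Longrightarrow> nn k f \<le> nn l f"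
  by (rule lift_Suc_mono_le[of "\<lambda>k. nn k f"]) (rule nn_Suc_ge)

lemma norm_add_sq: "(norm (f + g))\<^sup>2 \<le> 2 * (norm f)\<^sup>2 + 2 * (norm (g :: 'a::real_inner))\<^sup>2"
proof -
  have "(norm (f + g))\<^sup>2 + (norm (f - g))\<^sup>2 = 2 * (norm f)\<^sup>2 + 2 * (norm g)\<^sup>2"
    by (simp add: power2_norm_eq_inner inner_add_left inner_add_right inner_diff_left inner_diff_right)
  then show ?thesis by (smt (verit) zero_le_power2)
qed

lemma nn_add: "sob k f \<Longrightarrow> sob k g \<Longrightarrow> nn k (f + g) \<le> 2 * nn k f + 2 * nn k g"
proof (induction k arbitrary: f g)
  case (Suc k)
  have 1: "sob (Suc 0) f" "sob (Suc 0) g" using Suc.prems sob_mono[of "Suc k" _ "Suc 0"] by auto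
  have "nn k (dd i (f + g)) \<le> 2 * nn k (dd i f) + 2 * nn k (dd i g)" for i
    using Suc.IH[OF sob_dd[OF Suc.prems(1), of i] sob_dd[OF Suc.prems(2), of i]] dd_add[OF 1, of i] by simp
  then have "(\<Sum>i\<in>UNIV. nn k (dd i (f + g))) \<le> (\<Sum>i\<in>UNIV. 2 * nn k (dd i f) + 2 * nn k (dd i g))"
    by (rule sum_mono)
  then show ?case using norm_add_sq[of f g] by (simp add: sum.distrib sum_distrib_left)
qed (simp add: norm_add_sq)

lemma nn_scale: "sob k f \<Longrightarrow> nn k (c *\<^sub>R f) = c\<^sup>2 * nn k f"
proof (induction k arbitrary: f)
  case (Suc k)
  have 1: "sob (Suc 0) f" using Suc.prems sob_mono[of "Suc k" _ "Suc 0"] by auto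
  have "nn k (dd i (c *\<^sub>R f)) = c\<^sup>2 * nn k (dd i f)" for i
    using Suc.IH[OF sob_dd[OF Suc.prems(1), of i]] dd_scale[OF 1, of i] by simp
  then show ?case by (simp add: sum_distrib_left distrib_left power_mult_distrib)
qed (simp add: power_mult_distrib)

lemma nn_diff: "sob k f \<Longrightarrow> sob k g \<Longrightarrow> nn k (f - g) \<le> 2 * nn k f + 2 * nn k g"
  using nn_add[of k f "(-1) *\<^sub>R g"] nn_scale[of k g "-1"] sob_scale[of k g "-1"] by simp

lemma nn_tau: "sob k f \<Longrightarrow> nn k (tau h f) = nn k f"
proof (induction k arbitrary: f)
  case (Suc k)
  have 1: "sob (Suc 0) f" using Suc.prems sob_mono[of "Suc k" _ "Suc 0"] by auto
  have "nn k (dd i (tau h f)) = nn k (dd i f)" for i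
    using Suc.IH[OF sob_dd[OF Suc.prems(1), of i]] dd_tau[OF 1, of i] by simp
  then show ?case by simp
qed simp

section \<open>Sobolev functions and their classes\<close>

lemma weak_deriv_iff:
  assumes "L2 f" "L2 g"
  shows "weak_deriv is f g \<longleftrightarrow>
    (\<forall>\<phi>. test_fun \<phi> \<longrightarrow> inner (cls f) (cls (pds is \<phi>)) = (-1) ^ length is * inner (cls g) (cls \<phi>))"
  unfolding weak_deriv_def using assms by (simp add: inner_cls L2_test test_fun_pds)

lemma wd_props:
  assumes "\<exists>g. L2 g \<and> weak_deriv is f g"
  shows "L2 (wd is f)" "weak_deriv is f (wd is f)"
  using someI_ex[OF assms] by (auto simp: wd_def)

lemma weak_deriv_unique:
  assumes "L2 f" "L2 g" "L2 h" "weak_deriv is f g" "weak_deriv is f h"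
  shows "cls g = cls h"
  by (rule l2_eqI) (use assms in \<open>simp add: weak_deriv_iff\<close>)

lemma weak_deriv_Nil: "L2 f \<Longrightarrow> weak_deriv [] f f"
  by (simp add: weak_deriv_def)

lemma wd_Nil: assumes "L2 f" shows "L2 (wd [] f)" "cls (wd [] f) = cls f"
proof -
  have ex: "\<exists>g. L2 g \<and> weak_deriv [] f g" using weak_deriv_Nil[OF assms] assms by blast
  show "L2 (wd [] f)" using wd_props[OF ex] by simp
  show "cls (wd [] f) = cls f"
    using weak_deriv_unique[OF assms _ assms _ weak_deriv_Nil[OF assms]] wd_props[OF ex] by blast
qed

lemma sobolev_L2: "sobolev k f \<Longrightarrow> L2 f"
  by (simp add: sobolev_def)

lemma sobolev_wd:
  assumes "sobolev k f" "length is \<le> k"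
  shows "L2 (wd is f)" "weak_deriv is f (wd is f)"
  using wd_props[of "is" f] assms by (auto simp: sobolev_def)

text \<open>The new direction is appended at the end because \<open>pds\<close> applies the last
  entry of its list first: the derivative in direction \<open>i\<close> then falls directly on the
  test function.\<close>

lemma sobolev_isd:
  assumes f: "sobolev k f" and l: "length is < k"
  shows "isd i (cls (wd is f)) (cls (wd (is @ [i]) f))"
proof (rule isd_weakI)
  fix \<phi> :: "real^'a \<Rightarrow> real" assume \<phi>: "test_fun \<phi>"
  note 1 = sobolev_wd[OF f less_imp_le[OF l]]
  have l2: "length (is @ [i]) \<le> k" using l by simp
  note 2 = sobolev_wd[OF f l2]
  have "inner (cls f) (cls (pds is (pdx i \<phi>))) = (-1) ^ length is * inner (cls (wd is f)) (cls (pdx i \<phi>))"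
    using 1(2) test_fun_pdx[OF \<phi>] unfolding weak_deriv_iff[OF sobolev_L2[OF f] 1(1)] by blast
  moreover have "inner (cls f) (cls (pds (is @ [i]) \<phi>)) = (-1) ^ length (is @ [i]) * inner (cls (wd (is @ [i]) f)) (cls \<phi>)"
    using 2(2) \<phi> unfolding weak_deriv_iff[OF sobolev_L2[OF f] 2(1)] by blast
  ultimately have "(-1) ^ length is * inner (cls (wd is f)) (cls (pdx i \<phi>)) = (-1) ^ length is * (- inner (cls (wd (is @ [i]) f)) (cls \<phi>))"
    by (simp add: pds_append)
  then show "inner (cls (wd is f)) (cls (pdx i \<phi>)) = - inner (cls (wd (is @ [i]) f)) (cls \<phi>)"
    by (cases "even (length is)") auto
qed

lemma finite_lists_le: "finite {js :: 'a::finite list. length js \<le> k}"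
  using finite_lists_length_le[of "UNIV :: 'a set" k] by simp

lemma sum_lists_Suc:
  fixes h :: "'n::finite list \<Rightarrow> real"
  shows "(\<Sum>js\<in>{js. length js \<le> Suc k}. h js) = h [] + (\<Sum>i\<in>UNIV. \<Sum>js\<in>{js. length js \<le> k}. h (i # js))"
proof -
  have eq: "{js :: 'n list. length js \<le> Suc k} = insert [] ((\<lambda>(i, js). i # js) ` (UNIV \<times> {js. length js \<le> k}))"
  proof (intro set_eqI)
    fix js :: "'n list"
    show "js \<in> {js. length js \<le> Suc k} \<longleftrightarrow> js \<in> insert [] ((\<lambda>(i, js). i # js) ` (UNIV \<times> {js. length js \<le> k}))"
      by (cases js) (auto simp: image_iff)
  qed
  have inj: "inj_on (\<lambda>(i, js). i # js) (UNIV \<times> {js :: 'n list. length js \<le> k})"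
    by (auto simp: inj_on_def)
  have fin: "finite ((\<lambda>(i, js). i # js) ` (UNIV \<times> {js :: 'n list. length js \<le> k}))"
    by (intro finite_imageI finite_cartesian_product finite_lists_le) simp
  have "(\<Sum>js\<in>{js. length js \<le> Suc k}. h js) = h [] + (\<Sum>js\<in>(\<lambda>(i, js). i # js) ` (UNIV \<times> {js. length js \<le> k}). h js)"
    unfolding eq using fin by (subst sum.insert) auto
  also have "(\<Sum>js\<in>(\<lambda>(i, js). i # js) ` (UNIV \<times> {js. length js \<le> k}). h js)
     = (\<Sum>(i, js)\<in>UNIV \<times> {js. length js \<le> k}. h (i # js))"
    by (subst sum.reindex[OF inj]) (simp add: case_prod_unfold o_def)
  finally show ?thesis by (simp add: sum.cartesian_product)
qed

text \<open>The prefix \<open>is\<close> is carried through the induction because a choice made by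
  \<open>wd\<close> along a longer list is related to \<open>wd is f\<close> only at the level of
  classes.\<close>

lemma sobolev_sob_nn:
  assumes f: "sobolev K f"
  shows "length is + k \<le> K \<Longrightarrow> sob k (cls (wd is f)) \<and>
    nn k (cls (wd is f)) = (\<Sum>js\<in>{js. length js \<le> k}. (L2norm (wd (is @ js) f))\<^sup>2)"
proof (induction k arbitrary: "is")
  case 0
  then have "L2 (wd is f)" using sobolev_wd[OF f] by simp
  then show ?case by (simp add: norm_cls)
next
  case (Suc k)
  have isd: "isd i (cls (wd is f)) (cls (wd (is @ [i]) f))" for i
    using Suc.prems by (intro sobolev_isd[OF f]) simp
  have IH: "sob k (cls (wd (is @ [i]) f)) \<and> nn k (cls (wd (is @ [i]) f)) = 
     (\<Sum>js\<in>{js. length js \<le> k}. (L2norm (wd ((is @ [i]) @ js) f))\<^sup>2)" for i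
    using Suc.prems by (intro Suc.IH) simp
  have "L2 (wd is f)" using sobolev_wd[OF f] Suc.prems by simp
  moreover have "sob (Suc k) (cls (wd is f))" using isd IH by (intro sob_SucI) auto
  ultimately show ?case
    unfolding sum_lists_Suc using IH by (simp add: dd_eq[OF isd] norm_cls)
qed

lemma sobolev_sob: "sobolev k f \<Longrightarrow> sob k (cls f)"
  using sobolev_sob_nn[of k f "[]" k] wd_Nil(2)[OF sobolev_L2, of k f] by simp

lemma Hnorm_sq: "sobolev k f \<Longrightarrow> (Hnorm k f)\<^sup>2 = nn k (cls f)"
  using sobolev_sob_nn[of k f "[]" k] wd_Nil[OF sobolev_L2, of k f]
  by (simp add: Hnorm_def sum_nonneg)

lemma Hnorm_nonneg [simp]: "0 \<le> Hnorm k f"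
  by (simp add: Hnorm_def sum_nonneg)

lemma Hnorm_eq: "sobolev k f \<Longrightarrow> Hnorm k f = sqrt (nn k (cls f))"
  by (simp flip: Hnorm_sq)

lemma sobolev_dd: 
  assumes "sobolev (Suc k) f"
  shows "L2 (wd [i] f)" "cls (wd [i] f) = dd i (cls f)"
proof -
  show "L2 (wd [i] f)" using sobolev_wd[OF assms, of "[i]"] by simp
  show "cls (wd [i] f) = dd i (cls f)"
    using dd_eq[OF sobolev_isd[OF assms, of "[]" i]] wd_Nil[OF sobolev_L2[OF assms]] by simp
qed

text \<open>Identifies the derivative chosen by \<open>wd\<close>, as it occurs in the equation,
  with one computed by the product rule.\<close>

lemma isd_wd:
  assumes "L2 f" "isd i (cls f) g"
  shows "L2 (wd [i] f)" "cls (wd [i] f) = g"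
proof -
  obtain g' where g': "L2 g'" "g = cls g'" by (rule l2_cases)
  have w: "weak_deriv [i] f g'"
    unfolding weak_deriv_iff[OF assms(1) g'(1)] using isd_weakD[OF assms(2)] g'(2) by simp
  have ex: "\<exists>g. L2 g \<and> weak_deriv [i] f g" using w g' by blast
  show "L2 (wd [i] f)" using wd_props[OF ex] by simp
  show "cls (wd [i] f) = g"
    using weak_deriv_unique[OF assms(1) wd_props(1)[OF ex] g'(1) wd_props(2)[OF ex] w] g'(2) by simp
qed

lemma sobolev_lincomb:
  assumes "sobolev k f" "sobolev k g"
  shows "sobolev k (\<lambda>x. c * f x + e * g x)"
  unfolding sobolev_def
proof (intro conjI allI impI)
  note L = sobolev_L2[OF assms(1)] sobolev_L2[OF assms(2)]
  show Lc: "L2 (\<lambda>x. c * f x + e * g x)" by (intro L2_add L2_scale L)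
  fix "is" :: "'a list" assume l: "length is \<le> k"
  note F = sobolev_wd[OF assms(1) l] and G = sobolev_wd[OF assms(2) l]
  have L': "L2 (\<lambda>x. c * wd is f x + e * wd is g x)" by (intro L2_add L2_scale F G)
  have "weak_deriv is (\<lambda>x. c * f x + e * g x) (\<lambda>x. c * wd is f x + e * wd is g x)"
    unfolding weak_deriv_iff[OF Lc L']
    using F(2) G(2) unfolding weak_deriv_iff[OF L(1) F(1)] weak_deriv_iff[OF L(2) G(1)]
    by (simp add: cls_add cls_scale L2_scale L F G inner_add_left distrib_left mult.left_commute)
  with L' show "\<exists>h. L2 h \<and> weak_deriv is (\<lambda>x. c * f x + e * g x) h" by blast
qed

lemma sobolev_diff: "sobolev k f \<Longrightarrow> sobolev k g \<Longrightarrow> sobolev k (\<lambda>x. f x - g x)"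
  using sobolev_lincomb[of k f g 1 "-1"] by simp

lemma sobolev_mono: "sobolev l f \<Longrightarrow> k \<le> l \<Longrightarrow> sobolev k f"
  unfolding sobolev_def by auto

lemma sobolev_0_iff: "sobolev 0 f \<longleftrightarrow> L2 f"
  unfolding sobolev_def using weak_deriv_Nil by auto

lemma H_deriv_nn:
  assumes "H_deriv k u v t" "t \<ge> 0" "\<And>s. s \<ge> 0 \<Longrightarrow> sobolev k (u s)" "sobolev k (v t)"
  shows "((\<lambda>s. nn k ((cls (u s) - cls (u t)) /\<^sub>R (s - t) - cls (v t))) \<longlongrightarrow> 0) (at t within {0..})"
proof -
  have "((\<lambda>s. (Hnorm k (\<lambda>x. (u s x - u t x) / (s - t) - v t x))\<^sup>2) \<longlongrightarrow> 0\<^sup>2) (at t within {0..})"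
    using assms(1) unfolding H_deriv_def by (intro tendsto_power)
  moreover have "(Hnorm k (\<lambda>x. (u s x - u t x) / (s - t) - v t x))\<^sup>2 = nn k ((cls (u s) - cls (u t)) /\<^sub>R (s - t) - cls (v t))"
    if "s \<ge> 0" for s
  proof -
    have s: "sobolev k (\<lambda>x. inverse (s - t) * (u s x - u t x) + 0 * v t x)"
      using that assms by (intro sobolev_lincomb sobolev_diff) auto
    then have "sobolev k (\<lambda>x. (inverse (s - t) * (u s x - u t x)) - v t x)"
      using sobolev_diff[OF s assms(4)] by simp
    moreover have L: "L2 (u s)" "L2 (u t)" "L2 (v t)" using assms that by (auto intro: sobolev_L2)
    ultimately show ?thesis
      by (simp add: divide_inverse mult.commute[of _ "inverse _"] Hnorm_sq cls_diff cls_scale L2_diff L2_scale)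
  qed
  ultimately show ?thesis
    by (subst (asm) tendsto_cong[where g = "\<lambda>s. nn k ((cls (u s) - cls (u t)) /\<^sub>R (s - t) - cls (v t))"])
      (auto simp: eventually_at intro!: exI[of _ 1])
qed

lemma tendsto_of_sq_le:
  assumes "(g \<longlongrightarrow> 0) F" "\<And>x. (norm (f x))\<^sup>2 \<le> g x"
  shows "(f \<longlongrightarrow> 0) F"
proof (rule Lim_null_comparison)
  show "\<forall>\<^sub>F x in F. norm (f x) \<le> sqrt (g x)"
    by (intro always_eventually allI real_le_rsqrt assms(2))
  show "((\<lambda>x. sqrt (g x)) \<longlongrightarrow> 0) F" using tendsto_real_sqrt[OF assms(1)] by simp
qed

lemma H_deriv_vector:
  assumes "H_deriv k u v t" "t \<ge> 0" "\<And>s. s \<ge> 0 \<Longrightarrow> sobolev k (u s)" "sobolev k (v t)"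
  shows "((\<lambda>s. cls (u s)) has_vector_derivative cls (v t)) (at t within {0..})"
  unfolding has_vector_derivative_iff_quotient
  using tendsto_of_sq_le[OF H_deriv_nn[OF assms] norm_le_nn]
  by (simp add: LIM_zero_iff)

lemma H_deriv_vector_dd:
  assumes "H_deriv (Suc k) u v t" "t \<ge> 0" "\<And>s. s \<ge> 0 \<Longrightarrow> sobolev (Suc k) (u s)" "sobolev (Suc k) (v t)"
  shows "((\<lambda>s. dd i (cls (u s))) has_vector_derivative dd i (cls (v t))) (at t within {0..})"
proof -
  have sb: "sob (Suc 0) (cls (u s))" if "s \<ge> 0" for s
    using sob_mono[OF sobolev_sob[OF assms(3)[OF that]], of "Suc 0"] by simp
  have sv: "sob (Suc 0) (cls (v t))" 
    using sob_mono[OF sobolev_sob[OF assms(4)], of "Suc 0"] by simp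
  have "((\<lambda>s. dd i ((cls (u s) - cls (u t)) /\<^sub>R (s - t) - cls (v t))) \<longlongrightarrow> 0) (at t within {0..})"
    by (rule tendsto_of_sq_le[OF H_deriv_nn[OF assms] order_trans[OF norm_le_nn[of _ k] nn_dd_le]])
  moreover have "dd i ((cls (u s) - cls (u t)) /\<^sub>R (s - t) - cls (v t)) = (dd i (cls (u s)) - dd i (cls (u t))) /\<^sub>R (s - t) - dd i (cls (v t))"
    if "s \<ge> 0" for s
    using sb[OF that] sb[OF assms(2)] sv by (simp only: dd_diff dd_scale sob_diff sob_scale)
  ultimately have "((\<lambda>s. (dd i (cls (u s)) - dd i (cls (u t))) /\<^sub>R (s - t) - dd i (cls (v t))) \<longlongrightarrow> 0) (at t within {0..})"
    by (subst (asm) tendsto_cong[where g = "\<lambda>s. (dd i (cls (u s)) - dd i (cls (u t))) /\<^sub>R (s - t) - dd i (cls (v t))"])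
      (auto simp: eventually_at intro!: exI[of _ 1])
  then show ?thesis
    unfolding has_vector_derivative_iff_quotient by (simp add: LIM_zero_iff)
qed

section \<open>Energies\<close>

text \<open>The exceptional null set is mapped by \<open>f\<close> to a null set of values, so if the bound failed then
  some value outside that null set would be attained for the last time at a point with negative
  derivative.\<close>
lemma lipschitz_AE_deriv_le:
  fixes f :: "real \<Rightarrow> real"
  assumes ab: "a \<le> b"
    and lip: "\<And>s t. s \<in> {a..b} \<Longrightarrow> t \<in> {a..b} \<Longrightarrow> \<bar>f s - f t\<bar> \<le> L * \<bar>s - t\<bar>"
    and der: "AE t in lborel. t \<in> {a<..<b} \<longrightarrow> (\<exists>D. (f has_real_derivative D) (at t) \<and> D \<le> K)"
  shows "f b - f a \<le> K * (b - a)"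
proof (rule ccontr)
  assume "\<not> f b - f a \<le> K * (b - a)"
  then have lt: "f b - f a > K * (b - a)" by simp
  then have "a < b" using ab by (cases "a = b") auto
  \<comment> \<open>Half of the excess slope. After tilting by \<open>K + e\<close> the function
    still increases from \<open>a\<close> to \<open>b\<close>, yet off the null set its derivative
    is at most \<open>- e\<close>.\<close>
  define e where "e = (f b - f a - K * (b - a)) / (2 * (b - a))"
  have e: "e > 0" using lt \<open>a < b\<close> by (simp add: e_def)
  define g where "g t = f t - (K + e) * t" for t
  have gab: "g a < g b"
  proof -
    have "2 * (b - a) * e = f b - f a - K * (b - a)" using \<open>a < b\<close> by (simp add: e_def)
    moreover have "(b - a) * e > 0" using \<open>a < b\<close> e by simp
    ultimately have "f b - f a - K * (b - a) - (b - a) * e > 0" by linarith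
    then show ?thesis by (simp add: g_def algebra_simps)
  qed
  have glip: "\<bar>g s - g t\<bar> \<le> (L + \<bar>K + e\<bar>) * \<bar>s - t\<bar>" if "s \<in> {a..b}" "t \<in> {a..b}" for s t
  proof -
    have "g s - g t = (f s - f t) - (K + e) * (s - t)" by (simp add: g_def algebra_simps)
    then have "\<bar>g s - g t\<bar> \<le> \<bar>f s - f t\<bar> + \<bar>(K + e) * (s - t)\<bar>" by linarith
    moreover have "\<bar>(K + e) * (s - t)\<bar> = \<bar>K + e\<bar> * \<bar>s - t\<bar>" by (rule abs_mult)
    moreover have "(L + \<bar>K + e\<bar>) * \<bar>s - t\<bar> = L * \<bar>s - t\<bar> + \<bar>K + e\<bar> * \<bar>s - t\<bar>" by (rule distrib_right)
    ultimately show ?thesis using lip[OF that] by linarith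
  qed
  have gcont: "continuous_on {a..b} g"
  proof -
    have "(max 0 (L + \<bar>K + e\<bar>))-lipschitz_on {a..b} g"
    proof (rule lipschitz_onI)
      fix s t assume st: "s \<in> {a..b}" "t \<in> {a..b}"
      have "(L + \<bar>K + e\<bar>) * \<bar>s - t\<bar> \<le> max 0 (L + \<bar>K + e\<bar>) * \<bar>s - t\<bar>"
        by (intro mult_right_mono) auto
      then show "dist (g s) (g t) \<le> max 0 (L + \<bar>K + e\<bar>) * dist s t"
        using glip[OF st] by (simp add: dist_real_def)
    qed simp
    then show ?thesis by (rule lipschitz_on_continuous_on)
  qed
  obtain N where N: "N \<in> null_sets lborel"
    "{t. \<not> (t \<in> {a<..<b} \<longrightarrow> (\<exists>D. (f has_real_derivative D) (at t) \<and> D \<le> K))} \<subseteq> N"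
    using der by (auto elim!: AE_E simp: null_sets_def)
  have "negligible N" using N(1) by (simp add: negligible_iff_null_sets null_sets_completionI)
  then have "negligible (N \<inter> {a..b})" by (rule negligible_subset) auto
  then have negl: "negligible (g ` (N \<inter> {a..b}))"
  proof (rule negligible_locally_Lipschitz_image[rotated])
    show "DIM(real) \<le> DIM(real)" by simp
    fix x assume x: "x \<in> N \<inter> {a..b}"
    show "\<exists>T B. open T \<and> x \<in> T \<and> (\<forall>y\<in>N \<inter> {a..b} \<inter> T. norm (g y - g x) \<le> B * norm (y - x))"
      by (intro exI[of _ UNIV] exI[of _ "L + \<bar>K + e\<bar>"]) (use x glip in auto)
  qed
  have "\<not> negligible {g a<..<g b}"
    using gab negligible_interval(2)[of "g a" "g b"] by (simp add: box_real)
  then have "\<not> {g a<..<g b} \<subseteq> g ` (N \<inter> {a..b})"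
    using negligible_subset[OF negl] by blast
  then obtain y where y: "g a < y" "y < g b" "y \<notin> g ` (N \<inter> {a..b})"
    by (meson greaterThanLessThan_iff subsetI)
  define Z where "Z = {t \<in> {a..b}. g t = y}"
  have Zc: "compact Z"
  proof -
    have "Z = {a..b} \<inter> g -` {y}" by (auto simp: Z_def)
    moreover have "closed ({a..b} \<inter> g -` {y})" by (intro continuous_closed_preimage gcont) auto
    ultimately show ?thesis using bounded_subset[of "{a..b}" Z] by (auto simp: compact_eq_bounded_closed)
  qed
  have "\<exists>t. a \<le> t \<and> t \<le> b \<and> g t = y"
    using IVT'[of g a y b] y ab gcont by auto
  then have "Z \<noteq> {}" by (auto simp: Z_def)
  define c where "c = Sup Z"
  have cZ: "c \<in> Z" unfolding c_def
    by (rule closed_contains_Sup) (use Zc \<open>Z \<noteq> {}\<close> in \<open>auto simp: compact_eq_bounded_closed intro: bounded_imp_bdd_above\<close>)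
  have cmax: "t \<le> c" if "t \<in> Z" for t
    unfolding c_def by (rule cSup_upper[OF that]) (use Zc in \<open>auto simp: compact_eq_bounded_closed intro: bounded_imp_bdd_above\<close>)
  have c: "c \<in> {a..b}" "g c = y" using cZ by (auto simp: Z_def)
  then have cab: "a < c" "c < b" using y by (auto simp: less_le)
  have "c \<notin> N" using y c by auto
  then obtain D where D: "(f has_real_derivative D) (at c)" "D \<le> K"
    using N(2) cab by auto
  have "(g has_real_derivative D - (K + e)) (at c)"
    unfolding g_def[abs_def] by (auto intro!: derivative_eq_intros D(1))
  then obtain d where d: "d > 0" "\<And>h. h > 0 \<Longrightarrow> h < d \<Longrightarrow> g (c + h) < g c"
    using DERIV_neg_dec_right[of g "D - (K + e)" c] D(2) e by auto
  define h where "h = min (d / 2) ((b - c) / 2)"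
  have h: "h > 0" "h < d" "c + h < b" using d cab by (auto simp: h_def min_def field_simps)
  have "g (c + h) \<le> y" using d(2)[OF h(1,2)] c by simp
  then have "\<exists>t. c + h \<le> t \<and> t \<le> b \<and> g t = y"
    using y(2) h cab by (intro IVT' continuous_on_subset[OF gcont]) auto
  then obtain t where "c + h \<le> t" "t \<le> b" "g t = y" by auto
  then have "t \<in> Z" using cab h by (auto simp: Z_def)
  then show False using cmax[of t] \<open>c + h \<le> t\<close> h by linarith
qed

text \<open>The integrating factor turns a forcing that grows like
  \<open>exp (lam * (t - t0))\<close> into a constant one. This growth is exactly that of the H^3
  bound assumed in \<open>level2_energy\<close>.\<close>

lemma lipschitz_AE_gronwall:
  fixes E :: "real \<Rightarrow> real"
  assumes st: "t0 \<le> t1" and lam: "lam \<ge> 0"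
    and lip: "\<And>s t. s \<in> {t0..t1} \<Longrightarrow> t \<in> {t0..t1} \<Longrightarrow> \<bar>E s - E t\<bar> \<le> L * \<bar>s - t\<bar>"
    and der: "AE t in lborel. t \<in> {t0<..<t1} \<longrightarrow>
      (\<exists>D. (E has_real_derivative D) (at t) \<and> D \<le> lam * E t + K * exp (lam * (t - t0)))"
  shows "E t1 \<le> exp (lam * (t1 - t0)) * (E t0 + K * (t1 - t0))"
proof -
  define w where "w t = exp (- (lam * (t - t0)))" for t
  define g where "g t = w t * E t" for t
  have w01: "0 < w t" "w t \<le> 1" if "t \<ge> t0" for t using that lam by (auto simp: w_def)
  have wder: "(w has_real_derivative - lam * w t) (at t)" for t
    unfolding w_def by (auto intro!: derivative_eq_intros)
  have wlip: "\<bar>w s - w t\<bar> \<le> lam * \<bar>s - t\<bar>" if "s \<in> {t0..t1}" "t \<in> {t0..t1}" for s t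
  proof -
    have "norm (w s - w t) \<le> lam * norm (s - t)"
    proof (rule field_differentiable_bound[of "{t0..t1}" w "\<lambda>t. - lam * w t"])
      show "(w has_real_derivative - lam * w z) (at z within {t0..t1})" for z
        using wder by (rule has_field_derivative_at_within)
      show "norm (- lam * w z) \<le> lam" if "z \<in> {t0..t1}" for z
        using w01[of z] that lam mult_left_mono[of "w z" 1 lam] by (simp add: abs_mult)
    qed (use that in auto)
    then show ?thesis by simp
  qed
  have Lnn: "L \<ge> 0" if "t0 < t1"
  proof -
    have "0 \<le> L * \<bar>t0 - t1\<bar>"
      using lip[of t0 t1] that by (intro order_trans[OF abs_ge_zero]) auto
    then show ?thesis using that by (simp add: zero_le_mult_iff)
  qed
  have Ebd: "\<bar>E t\<bar> \<le> \<bar>E t0\<bar> + L * (t1 - t0)" if "t \<in> {t0..t1}" for t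
  proof (cases "t0 < t1")
    case True
    have "\<bar>E t - E t0\<bar> \<le> L * \<bar>t - t0\<bar>" using that by (intro lip) auto
    also have "\<dots> \<le> L * (t1 - t0)" using that Lnn[OF True] by (intro mult_left_mono) auto
    finally show ?thesis by linarith
  qed (use that st in auto)
  have glip: "\<bar>g s - g t\<bar> \<le> (L + (\<bar>E t0\<bar> + L * (t1 - t0)) * lam) * \<bar>s - t\<bar>" if "s \<in> {t0..t1}" "t \<in> {t0..t1}" for s t
  proof -
    have "g s - g t = w s * (E s - E t) + E t * (w s - w t)" by (simp add: g_def algebra_simps)
    then have "\<bar>g s - g t\<bar> \<le> \<bar>w s\<bar> * \<bar>E s - E t\<bar> + \<bar>E t\<bar> * \<bar>w s - w t\<bar>"
      by (metis abs_mult abs_triangle_ineq)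
    also have "\<dots> \<le> 1 * (L * \<bar>s - t\<bar>) + (\<bar>E t0\<bar> + L * (t1 - t0)) * (lam * \<bar>s - t\<bar>)"
      using w01[of s] that lip[OF that] wlip[OF that] Ebd[OF that(2)] order_trans[OF abs_ge_zero Ebd[OF that(2)]]
      by (intro add_mono mult_mono) auto
    finally show ?thesis by (simp add: algebra_simps)
  qed
  have "g t1 - g t0 \<le> K * (t1 - t0)"
  proof (rule lipschitz_AE_deriv_le[OF st glip])
    show "AE t in lborel. t \<in> {t0<..<t1} \<longrightarrow> (\<exists>D. (g has_real_derivative D) (at t) \<and> D \<le> K)"
      using der
    proof eventually_elim
      case (elim t)
      show ?case
      proof
        assume t: "t \<in> {t0<..<t1}"
        then obtain D where D: "(E has_real_derivative D) (at t)" "D \<le> lam * E t + K * exp (lam * (t - t0))"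
          using elim by auto
        have "(g has_real_derivative - lam * w t * E t + D * w t) (at t)"
          unfolding g_def[abs_def] by (rule DERIV_mult[OF wder D(1)])
        moreover have "- lam * w t * E t + D * w t \<le> K"
        proof -
          have "w t > 0" using t w01 by auto
          have "D * w t \<le> (lam * E t + K * exp (lam * (t - t0))) * w t"
            using \<open>w t > 0\<close> D(2) by (intro mult_right_mono) auto
          also have "\<dots> = lam * w t * E t + K * (exp (lam * (t - t0)) * w t)"
            by (simp add: algebra_simps)
          also have "exp (lam * (t - t0)) * w t = 1" by (simp add: w_def exp_minus)
          finally show ?thesis by simp
        qed
        ultimately show "\<exists>D. (g has_real_derivative D) (at t) \<and> D \<le> K" by blast
      qed
    qed
  qed auto
  moreover have "g t0 = E t0" by (simp add: g_def w_def)
  ultimately have "g t1 \<le> E t0 + K * (t1 - t0)" by linarith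
  then have "w t1 * E t1 \<le> E t0 + K * (t1 - t0)" by (simp only: g_def)
  then have "exp (lam * (t1 - t0)) * (w t1 * E t1) \<le> exp (lam * (t1 - t0)) * (E t0 + K * (t1 - t0))"
    by (intro mult_left_mono) auto
  moreover have "exp (lam * (t1 - t0)) * (w t1 * E t1) = E t1"
    by (simp add: w_def exp_minus)
  ultimately show ?thesis by simp
qed

text \<open>The operator \<open>div (m grad w)\<close>, expanded so that no product has to be differentiated.\<close>
definition Qop :: "(real^'n::finite \<Rightarrow> real) \<Rightarrow> 'n l2 \<Rightarrow> 'n l2" where
  "Qop m w = (\<Sum>i\<in>UNIV. mul m (dd i (dd i w)) + mul (pdx i m) (dd i w))"

definition Bform :: "(real^'n::finite \<Rightarrow> real) \<Rightarrow> 'n l2 \<Rightarrow> 'n l2 \<Rightarrow> real" where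
  "Bform m w p = (\<Sum>i\<in>UNIV. inner (mul m (dd i w)) (dd i p))"

lemma smooth_bdd_linear_mul: "smooth_bdd m \<Longrightarrow> linear (mul m)"
  using smooth_bdd_mbdd linear_mul by metis

lemma Qop_div:
  assumes "smooth_bdd m" "sob 2 w"
  shows "Qop m w = (\<Sum>i\<in>UNIV. dd i (mul m (dd i w)))"
  unfolding Qop_def using assms by (intro sum.cong) (auto simp: dd_mul numeral_2_eq_2)

lemma Qop_inner:
  assumes "smooth_bdd m" "sob 2 w" "sob 1 p"
  shows "inner (Qop m w) p = - Bform m w p"
proof -
  have "inner (dd i (mul m (dd i w))) p = - inner (mul m (dd i w)) (dd i p)" for i
    using assms by (intro dd_inner sob_mul) (auto simp: numeral_2_eq_2)
  then show ?thesis
    unfolding Qop_div[OF assms(1,2)] Bform_def by (simp add: inner_sum_left sum_negf)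
qed

lemma Bform_commute: "smooth_bdd m \<Longrightarrow> Bform m w p = Bform m p w"
proof -
  assume "smooth_bdd m"
  then obtain K where K: "mbdd m K" by (rule smooth_bdd_mbdd)
  show ?thesis unfolding Bform_def
    by (intro sum.cong refl) (metis inner_mul[OF K] inner_commute)
qed

lemma Qop_diff: "smooth_bdd m \<Longrightarrow> sob 2 f \<Longrightarrow> sob 2 g \<Longrightarrow> Qop m (f - g) = Qop m f - Qop m g"
  unfolding Qop_def
  by (simp add: numeral_2_eq_2 dd_diff linear_diff[OF smooth_bdd_linear_mul] smooth_bdd_pdx sum_subtractf[symmetric] algebra_simps)

lemma Qop_selfadjoint:
  assumes "smooth_bdd m" "sob 2 w" "sob 2 p"
  shows "inner (Qop m w) p = inner w (Qop m p)"
proof -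
  have "sob 1 w" "sob 1 p" using sob_mono[OF assms(2)] sob_mono[OF assms(3)] one_le_numeral by blast+
  then show ?thesis
    using assms by (simp add: Qop_inner inner_commute[of w] Bform_commute[of m w p])
qed

text \<open>Difference of squares for a symmetric form, then integration by parts. All derivatives
  end up on the sum \<open>f + g\<close>, so the variation of the Dirichlet form is controlled by
  the L^2 distance of \<open>f\<close> and \<open>g\<close>.\<close>

lemma Bform_diff_sq:
  assumes "smooth_bdd m" "sob 2 f" "sob 2 g"
  shows "Bform m f f - Bform m g g = - inner (Qop m f + Qop m g) (f - g)"
proof -
  have "sob 1 f" "sob 1 g" using sob_mono[OF assms(2)] sob_mono[OF assms(3)] one_le_numeral by blast+
  then show ?thesis using assms
    by (simp add: inner_add_left inner_diff_right Qop_inner Bform_commute[of m f g])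
qed

text \<open>Boundedness and density reduce the claim to pairings with test functions; there
  self-adjointness moves the operator to the smooth side, and convergence of \<open>w\<close> in L^2
  suffices.\<close>

lemma Qop_weakly_continuous:
  fixes w :: "real \<Rightarrow> 'n::finite l2"
  assumes m: "smooth_bdd m" and F: "eventually (\<lambda>s. sob 2 (w s) \<and> norm (Qop m (w s)) \<le> M) F"
    and l: "sob 2 w0" "(w \<longlongrightarrow> w0) F"
  shows "((\<lambda>s. inner (Qop m (w s)) p) \<longlongrightarrow> inner (Qop m w0) p) F"
proof (rule tendstoI)
  fix e :: real assume e: "e > 0"
  define M' where "M' = \<bar>M\<bar> + norm (Qop m w0) + 1"
  have M': "M' > 0" by (simp add: M'_def add_nonneg_pos)
  obtain \<phi> where \<phi>: "test_fun \<phi>" "norm (p - cls \<phi>) < e / (4 * M')"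
    using test_limit_all[of p] e M' unfolding test_limit_def by (meson divide_pos_pos mult_pos_pos zero_less_numeral)
  have s2: "sob 2 (cls \<phi>)" by (rule sob_test[OF \<phi>(1)])
  have "((\<lambda>s. inner (w s) (Qop m (cls \<phi>))) \<longlongrightarrow> inner w0 (Qop m (cls \<phi>))) F"
    using l(2) by (intro tendsto_intros)
  then have "\<forall>\<^sub>F s in F. dist (inner (w s) (Qop m (cls \<phi>))) (inner w0 (Qop m (cls \<phi>))) < e / 2"
    using e by (intro tendstoD) auto
  with F show "\<forall>\<^sub>F s in F. dist (inner (Qop m (w s)) p) (inner (Qop m w0) p) < e"
  proof eventually_elim
    case (elim s)
    have 1: "\<bar>inner q (p - cls \<phi>)\<bar> \<le> e / 4" if "norm q \<le> M'" for q
    proof -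
      have "\<bar>inner q (p - cls \<phi>)\<bar> \<le> norm q * norm (p - cls \<phi>)" by (rule Cauchy_Schwarz_ineq2)
      also have "\<dots> \<le> M' * (e / (4 * M'))" using \<phi>(2) that M' by (intro mult_mono) auto
      finally show ?thesis using M' by simp
    qed
    have "norm (Qop m (w s)) \<le> M'"
      using conjunct2[OF elim(1)] norm_ge_zero[of "Qop m w0"] abs_ge_self[of M] unfolding M'_def by linarith
    moreover have "norm (Qop m w0) \<le> M'" by (simp add: M'_def)
    moreover have "\<bar>inner (Qop m (w s)) (cls \<phi>) - inner (Qop m w0) (cls \<phi>)\<bar> < e / 2"
      using elim s2 l(1) by (simp add: Qop_selfadjoint[OF m] dist_real_def)
    moreover have "inner (Qop m (w s)) p - inner (Qop m w0) p = inner (Qop m (w s)) (p - cls \<phi>)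
      + (inner (Qop m (w s)) (cls \<phi>) - inner (Qop m w0) (cls \<phi>)) - inner (Qop m w0) (p - cls \<phi>)"
      by (simp add: inner_diff_right)
    ultimately show ?case
      using 1[of "Qop m (w s)"] 1[of "Qop m w0"] unfolding dist_real_def by linarith
  qed
qed

text \<open>In the applications to derivatives of \<open>u\<close> the velocity \<open>y\<close> is
  known only in L^2. By \<open>Bform_diff_sq\<close> the difference quotient of the form is minus
  the pairing of \<open>Qop m (w s) + Qop m (w t)\<close> with the quotient of \<open>w\<close>. The
  first factor is bounded and converges weakly, the second converges in norm, so the pairing
  converges.\<close>

lemma Bform_has_derivative:
  fixes w :: "real \<Rightarrow> 'n::finite l2"
  assumes m: "smooth_bdd m" and ev: "\<And>s. s \<in> {t0..t1} \<Longrightarrow> sob 2 (w s) \<and> norm (Qop m (w s)) \<le> M"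
    and t: "t \<in> {t0<..<t1}" and w: "(w has_vector_derivative y) (at t)"
  shows "((\<lambda>s. Bform m (w s) (w s)) has_real_derivative - 2 * inner (Qop m (w t)) y) (at t)"
proof -
  define q where "q s = (w s - w t) /\<^sub>R (s - t)" for s
  have evI: "\<forall>\<^sub>F s in at t. s \<in> {t0..t1}"
    using eventually_at_in_open'[of "{t0<..<t1}" t] t by (auto elim!: eventually_mono)
  have q: "(q \<longlongrightarrow> y) (at t)"
    using w unfolding has_vector_derivative_iff_quotient q_def[abs_def] .
  have wc: "(w \<longlongrightarrow> w t) (at t)"
    using has_vector_derivative_continuous[OF w] by (simp add: continuous_at)
  have wt: "sob 2 (w t)" "norm (Qop m (w t)) \<le> M" using ev[of t] t by auto
  have 1: "((\<lambda>s. inner (Qop m (w s)) y) \<longlongrightarrow> inner (Qop m (w t)) y) (at t)"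
    using evI ev by (intro Qop_weakly_continuous[OF m _ wt(1) wc, of M]) (auto elim!: eventually_mono)
  have 2: "((\<lambda>s. inner (Qop m (w s)) (q s - y)) \<longlongrightarrow> 0) (at t)"
  proof (rule Lim_null_comparison)
    show "\<forall>\<^sub>F s in at t. norm (inner (Qop m (w s)) (q s - y)) \<le> M * norm (q s - y)"
      using evI
    proof eventually_elim
      case (elim s)
      have "norm (inner (Qop m (w s)) (q s - y)) \<le> norm (Qop m (w s)) * norm (q s - y)"
        by (simp add: Cauchy_Schwarz_ineq2)
      also have "\<dots> \<le> M * norm (q s - y)" using ev[OF elim] by (intro mult_right_mono) auto
      finally show ?case .
    qed
    show "((\<lambda>s. M * norm (q s - y)) \<longlongrightarrow> 0) (at t)"
      using q by (intro tendsto_mult_right_zero tendsto_norm_zero) (simp add: LIM_zero)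
  qed
  have "((\<lambda>s. - (inner (Qop m (w s)) y + inner (Qop m (w s)) (q s - y) + inner (Qop m (w t)) (q s)))
     \<longlongrightarrow> - (inner (Qop m (w t)) y + 0 + inner (Qop m (w t)) y)) (at t)"
    by (intro tendsto_intros 1 2 q)
  note lim = this
  have eq: "- (inner (Qop m (w s)) y + inner (Qop m (w s)) (q s - y) + inner (Qop m (w t)) (q s))
      = (Bform m (w s) (w s) - Bform m (w t) (w t)) / (s - t)" if "s \<in> {t0..t1}" for s
    using ev[OF that] wt(1) by (simp add: Bform_diff_sq[OF m] q_def inner_diff_right inner_add_left divide_inverse algebra_simps)
  have "((\<lambda>s. (Bform m (w s) (w s) - Bform m (w t) (w t)) / (s - t))
      \<longlongrightarrow> - (inner (Qop m (w t)) y + 0 + inner (Qop m (w t)) y)) (at t)"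
    by (rule Lim_transform_eventually[OF lim eventually_mono[OF evI eq]])
  then show ?thesis by (simp add: has_field_derivative_iff)
qed

lemma quad_has_derivative:
  assumes al: "mbdd al K" and y: "(y has_vector_derivative z) (at t)"
  shows "((\<lambda>s. inner (mul al (y s)) (y s)) has_real_derivative 2 * inner (y t) (mul al z)) (at t)"
proof -
  have "((\<lambda>s. mul al (y s)) has_vector_derivative mul al z) (at t)"
    by (rule bounded_linear.has_vector_derivative[OF bounded_linear_mul[OF al] y])
  then have "((\<lambda>s. inner (mul al (y s)) (y s)) has_derivative
     (\<lambda>h. inner (mul al (y t)) (h *\<^sub>R z) + inner (h *\<^sub>R mul al z) (y t))) (at t)"
    using y unfolding has_vector_derivative_def by (intro has_derivative_inner)
  moreover have "inner (mul al (y t)) z = inner (y t) (mul al z)" "inner (mul al z) (y t) = inner (y t) (mul al z)"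
    by (rule inner_mul[OF al], rule inner_commute)
  ultimately have "((\<lambda>s. inner (mul al (y s)) (y s)) has_derivative
     (\<lambda>h. 2 * inner (y t) (mul al z) * h)) (at t)"
    by (simp add: algebra_simps)
  then show ?thesis by (simp add: has_field_derivative_def)
qed

text \<open>The velocity \<open>y\<close> is an independent argument because the functional is also
  applied to derivatives, to difference quotients and to \<open>u - g\<close>. The weight
  \<open>al\<close> is meant to be \<open>1 / a\<close>, which removes the factor \<open>a\<close>
  of the equation from the kinetic term.\<close>

definition Een :: "(real^'n::finite \<Rightarrow> real) \<Rightarrow> (real^'n \<Rightarrow> real) \<Rightarrow> 'n l2 \<Rightarrow> 'n l2 \<Rightarrow> real" where
  "Een al m w y = inner (mul al y) y + Bform m w w"

text \<open>For an exact solution the residual \<open>mul al z - Qop m (w t)\<close> vanishes. For a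
  differentiated or shifted solution it consists of commutators and of the shift, and these are all
  that remains to be estimated.\<close>

lemma Een_has_derivative:
  fixes w :: "real \<Rightarrow> 'n::finite l2"
  assumes m: "smooth_bdd m" and al: "mbdd al K"
    and ev: "\<And>s. s \<in> {t0..t1} \<Longrightarrow> sob 2 (w s) \<and> norm (Qop m (w s)) \<le> M"
    and t: "t \<in> {t0<..<t1}" and w: "(w has_vector_derivative y t) (at t)"
    and y: "(y has_vector_derivative z) (at t)"
  shows "((\<lambda>s. Een al m (w s) (y s)) has_real_derivative 2 * inner (y t) (mul al z - Qop m (w t))) (at t)"
proof -
  from DERIV_add[OF quad_has_derivative[OF al y] Bform_has_derivative[OF m ev t w]]
  show ?thesis unfolding Een_def by (simp add: inner_diff_right inner_commute[of "y t"] algebra_simps)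
qed

lemma Een_lipschitz:
  fixes w :: "real \<Rightarrow> 'n::finite l2"
  assumes m: "smooth_bdd m" and al: "mbdd al K"
    and ev: "\<And>s. s \<in> S \<Longrightarrow> sob 2 (w s) \<and> norm (Qop m (w s)) \<le> M"
    and L: "L \<ge> 0" "\<And>s t. s \<in> S \<Longrightarrow> t \<in> S \<Longrightarrow> norm (w s - w t) \<le> L * \<bar>s - t\<bar>"
      "\<And>s t. s \<in> S \<Longrightarrow> t \<in> S \<Longrightarrow> norm (y s - y t) \<le> L * \<bar>s - t\<bar>"
    and Y: "\<And>s. s \<in> S \<Longrightarrow> norm (y s) \<le> Y"
    and st: "s \<in> S" "t \<in> S"
  shows "\<bar>Een al m (w s) (y s) - Een al m (w t) (y t)\<bar> \<le> (2 * K * Y * L + 2 * M * L) * \<bar>s - t\<bar>"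
proof -
  have K: "K \<ge> 0" by (rule mbdd_nonneg[OF al])
  have M: "M \<ge> 0" using ev[OF st(1)] norm_ge_zero order_trans by blast
  have Y0: "Y \<ge> 0" using Y[OF st(1)] norm_ge_zero order_trans by blast
  have "inner (mul al (y s)) (y s) - inner (mul al (y t)) (y t) = inner (mul al (y s) + mul al (y t)) (y s - y t)"
    by (simp add: inner_add_left inner_diff_right inner_mul[OF al] inner_commute[of "y s" "mul al (y t)"] inner_mul[OF al, of "y t"])
  also have "\<bar>\<dots>\<bar> \<le> norm (mul al (y s) + mul al (y t)) * norm (y s - y t)" by (rule Cauchy_Schwarz_ineq2)
  also have "\<dots> \<le> (K * Y + K * Y) * (L * \<bar>s - t\<bar>)"
  proof (rule mult_mono)
    have "norm (mul al (y r)) \<le> K * Y" if "r \<in> S" for r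
      using norm_mul_le[OF al, of "y r"] mult_left_mono[OF Y[OF that] K] by linarith
    then show "norm (mul al (y s) + mul al (y t)) \<le> K * Y + K * Y"
      using st by (intro norm_triangle_mono) auto
    show "norm (y s - y t) \<le> L * \<bar>s - t\<bar>" using L(3) st by blast
  qed (use K Y0 in auto)
  finally have 1: "\<bar>inner (mul al (y s)) (y s) - inner (mul al (y t)) (y t)\<bar> \<le> (K * Y + K * Y) * (L * \<bar>s - t\<bar>)" .
  have "Bform m (w s) (w s) - Bform m (w t) (w t) = - inner (Qop m (w s) + Qop m (w t)) (w s - w t)"
    using ev st by (intro Bform_diff_sq m) auto
  also have "\<bar>\<dots>\<bar> \<le> norm (Qop m (w s) + Qop m (w t)) * norm (w s - w t)"
    by (simp add: Cauchy_Schwarz_ineq2)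
  also have "\<dots> \<le> (M + M) * (L * \<bar>s - t\<bar>)"
    using ev st L(2) M by (intro mult_mono norm_triangle_mono) auto
  finally have 2: "\<bar>Bform m (w s) (w s) - Bform m (w t) (w t)\<bar> \<le> (M + M) * (L * \<bar>s - t\<bar>)" .
  have "(K * Y + K * Y) * (L * \<bar>s - t\<bar>) + (M + M) * (L * \<bar>s - t\<bar>) = (2 * K * Y * L + 2 * M * L) * \<bar>s - t\<bar>"
    by (simp add: algebra_simps)
  then show ?thesis using 1 2 unfolding Een_def by linarith
qed

declare sob.simps(2) [simp del] nn.simps(2) [simp del]

section \<open>Bounds that are uniform in the strength of the mirror\<close>

text \<open>A coinduction principle: any class of bounded differentiable functions closed under
  \<open>pdx\<close> consists of smooth bounded functions.\<close>

lemma smooth_bddI_closed: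
  fixes f :: "real^'n::finite \<Rightarrow> real"
  assumes "P f"
    and "\<And>g. P g \<Longrightarrow> (\<forall>x. g differentiable (at x)) \<and> bounded (range g) \<and> (\<forall>i. P (pdx i g))"
  shows "smooth_bdd f"
proof -
  have "P (pds is f)" for "is" by (induction "is") (use assms in auto)
  then show ?thesis using assms(2) by (auto simp: smooth_bdd_def smooth_def)
qed

text \<open>Sums of products of iterated derivatives. The class is closed under \<open>pdx\<close>
  by the product rule and takes the place of an explicit Leibniz formula for lists of
  directions.\<close>

inductive pd_alg :: "(real^'n::finite \<Rightarrow> real) \<Rightarrow> (real^'n \<Rightarrow> real) \<Rightarrow> (real^'n \<Rightarrow> real) \<Rightarrow> bool" for f g where
  mult: "pd_alg f g (\<lambda>x. pds is f x * pds js g x)"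
| add: "pd_alg f g p \<Longrightarrow> pd_alg f g q \<Longrightarrow> pd_alg f g (\<lambda>x. p x + q x)"

lemma smooth_bdd_mult:
  fixes f g :: "real^'n::finite \<Rightarrow> real"
  assumes f: "smooth_bdd f" and g: "smooth_bdd g"
  shows "smooth_bdd (\<lambda>x. f x * g x)"
proof (rule smooth_bddI_closed[of "pd_alg f g"])
  show "pd_alg f g (\<lambda>x. f x * g x)" using pd_alg.mult[of f g "[]" "[]"] by simp
  fix q assume "pd_alg f g q"
  then show "(\<forall>x. q differentiable (at x)) \<and> bounded (range q) \<and> (\<forall>i. pd_alg f g (pdx i q))"
  proof induction
    case (mult "is" js)
    let ?p = "pds is f" and ?q = "pds js g"
    have pq: "smooth_bdd ?p" "smooth_bdd ?q" using f g by (auto intro: smooth_bdd_pds)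
    have d: "?p differentiable (at x)" "?q differentiable (at x)" for x
      using pq by (auto simp: smooth_bdd_def intro: smooth_differentiable)
    obtain K1 K2 where "mbdd ?p K1" "mbdd ?q K2" using smooth_bdd_mbdd[OF pq(1)] smooth_bdd_mbdd[OF pq(2)] by metis
    then have "mbdd (\<lambda>x. ?p x * ?q x) (K1 * K2)" by (rule mbdd_mult)
    then have "bounded (range (\<lambda>x. ?p x * ?q x))" by (auto simp: mbdd_def bounded_iff)
    moreover have "pdx i (\<lambda>x. ?p x * ?q x) = (\<lambda>x. pds (i # is) f x * pds js g x + pds is f x * pds (i # js) g x)" for i
    proof (rule ext, rule pdx_eqI)
      fix x
      have "((\<lambda>h. ?p (x + h *\<^sub>R axis i 1) * ?q (x + h *\<^sub>R axis i 1)) has_field_derivative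
         pdx i ?p x * ?q (x + 0 *\<^sub>R axis i 1) + pdx i ?q x * ?p (x + 0 *\<^sub>R axis i 1)) (at 0)"
        by (intro DERIV_mult pdx_has_deriv d)
      then show "((\<lambda>h. ?p (x + h *\<^sub>R axis i 1) * ?q (x + h *\<^sub>R axis i 1)) has_field_derivative
         pds (i # is) f x * pds js g x + pds is f x * pds (i # js) g x) (at 0)" by (simp add: mult.commute)
    qed
    moreover have "pd_alg f g (\<lambda>x. pds (i # is) f x * pds js g x + pds is f x * pds (i # js) g x)" for i
      by (intro pd_alg.intros)
    ultimately show ?case using d by (simp add: differentiable_mult)
  next
    case (add p q)
    then have "bounded (range (\<lambda>x. p x + q x))"
      by (intro bounded_plus_comp) auto
    moreover have "pdx i (\<lambda>x. p x + q x) = (\<lambda>x. pdx i p x + pdx i q x)" for i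
      using add by (intro ext pdx_eqI DERIV_add pdx_has_deriv) auto
    ultimately show ?case using add by (auto intro: pd_alg.add)
  qed
qed

lemma smooth_bdd_add:
  assumes f: "smooth_bdd f" and g: "smooth_bdd g"
  shows "smooth_bdd (\<lambda>x. f x + g x)"
  using f g unfolding smooth_bdd_def
  by (auto simp: smooth_add pds_add intro!: bounded_plus_comp)

lemma smooth_bdd_scale:
  assumes f: "smooth_bdd f"
  shows "smooth_bdd (\<lambda>x. c * f x)"
proof -
  have "bounded (range (\<lambda>x. c * pds is f x))" for "is"
    using f bounded_scaling[of "range (pds is f)" c] unfolding smooth_bdd_def by (simp add: image_image)
  then show ?thesis using f unfolding smooth_bdd_def by (simp add: smooth_scale pds_scale)
qed

lemma pdx_lincomb:
  assumes "smooth_bdd f" "smooth_bdd g"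
  shows "pdx i (\<lambda>x. f x + c * g x) = (\<lambda>x. pdx i f x + c * pdx i g x)"
  using pds_add[of f "\<lambda>x. c * g x" "[i]"] pds_scale[of g "[i]" c] assms
  by (simp add: smooth_bdd_def smooth_scale)

lemma mul_lincomb_left:
  assumes "smooth_bdd f" "smooth_bdd g"
  shows "mul (\<lambda>x. f x + c * g x) w = mul f w + c *\<^sub>R mul g w"
proof -
  obtain K K' where K: "mbdd f K" and K': "mbdd g K'"
    using smooth_bdd_mbdd assms by metis
  show ?thesis using mul_add_left[OF K mbdd_scale[OF K', of c]] mul_scale_left[OF K', of c] by simp
qed

lemma Qop_lincomb:
  assumes "smooth_bdd f" "smooth_bdd g"
  shows "Qop (\<lambda>x. f x + c * g x) w = Qop f w + c *\<^sub>R Qop g w"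
  unfolding Qop_def pdx_lincomb[OF assms]
  by (simp add: mul_lincomb_left[OF assms] mul_lincomb_left[OF smooth_bdd_pdx[OF assms(1)] smooth_bdd_pdx[OF assms(2)]]
      scaleR_sum_right sum.distrib[symmetric] scaleR_add_right add_ac)

section \<open>Sobolev bounds for multiplication and for \<open>Qop\<close>\<close>

text \<open>The multiplier is generalized in the induction because the product rule brings in
  \<open>pdx i m\<close>.\<close>

lemma nn_mul:
  fixes m :: "real^'n::finite \<Rightarrow> real"
  assumes "smooth_bdd m"
  shows "\<exists>C\<ge>0. \<forall>f. sob k f \<longrightarrow> nn k (mul m f) \<le> C * nn k f"
  using assms
proof (induction k arbitrary: m)
  case 0
  obtain K where K: "mbdd m K" by (rule smooth_bdd_mbdd[OF 0])
  have "(norm (mul m f))\<^sup>2 \<le> K\<^sup>2 * (norm f)\<^sup>2" for f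
    using power_mono[OF norm_mul_le[OF K, of f], of 2] by (simp add: power_mult_distrib)
  then show ?case by (intro exI[of _ "K\<^sup>2"]) auto
next
  case (Suc k)
  obtain K where K: "mbdd m K" by (rule smooth_bdd_mbdd[OF Suc.prems])
  obtain C1 where C1: "C1 \<ge> 0" "\<And>f. sob k f \<Longrightarrow> nn k (mul m f) \<le> C1 * nn k f"
    using Suc.IH[OF Suc.prems] by blast
  have "\<forall>i. \<exists>C\<ge>0. \<forall>f. sob k f \<longrightarrow> nn k (mul (pdx i m) f) \<le> C * nn k f"
    using Suc.IH[OF smooth_bdd_pdx[OF Suc.prems]] by blast
  then obtain C2 where C2: "\<And>i. C2 i \<ge> 0" "\<And>i f. sob k f \<Longrightarrow> nn k (mul (pdx i m) f) \<le> C2 i * nn k f"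
    by metis
  show ?case
  proof (intro exI conjI allI impI)
    show "0 \<le> K\<^sup>2 + (2 * C1 + (\<Sum>i\<in>UNIV. 2 * C2 i))"
      using C1 C2 by (simp add: sum_nonneg)
    fix f :: "'n l2" assume f: "sob (Suc k) f"
    have f1: "sob (Suc 0) f" by (rule sob_mono[OF f]) simp
    have fk: "sob k f" by (rule sob_mono[OF f]) simp
    have "nn k (dd i (mul m f)) \<le> 2 * C1 * nn k (dd i f) + 2 * C2 i * nn k f" for i
    proof -
      have fi: "sob k (dd i f)" using sob_dd[OF f] .
      have "nn k (dd i (mul m f)) \<le> 2 * nn k (mul m (dd i f)) + 2 * nn k (mul (pdx i m) f)"
        unfolding dd_mul[OF Suc.prems f1]
        by (intro nn_add sob_mul Suc.prems smooth_bdd_pdx fi fk)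
      then show ?thesis using C1(2)[OF fi] C2(2)[OF fk, of i] by linarith
    qed
    then have "(\<Sum>i\<in>UNIV. nn k (dd i (mul m f))) \<le> (\<Sum>i\<in>UNIV. 2 * C1 * nn k (dd i f) + 2 * C2 i * nn k f)"
      by (rule sum_mono)
    also have "\<dots> = 2 * C1 * (\<Sum>i\<in>UNIV. nn k (dd i f)) + (\<Sum>i\<in>UNIV. 2 * C2 i) * nn k f"
      by (simp add: sum.distrib sum_distrib_left sum_distrib_right)
    also have "\<dots> \<le> 2 * C1 * nn (Suc k) f + (\<Sum>i\<in>UNIV. 2 * C2 i) * nn (Suc k) f"
      using C1 C2 nn_Suc_ge[of k f] by (intro add_mono mult_left_mono sum_nonneg) (auto simp: nn.simps(2))
    finally have s: "(\<Sum>i\<in>UNIV. nn k (dd i (mul m f))) \<le> (2 * C1 + (\<Sum>i\<in>UNIV. 2 * C2 i)) * nn (Suc k) f"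
      by (simp add: distrib_right)
    have "(norm (mul m f))\<^sup>2 \<le> K\<^sup>2 * (norm f)\<^sup>2"
      using power_mono[OF norm_mul_le[OF K, of f], of 2] by (simp add: power_mult_distrib)
    also have "\<dots> \<le> K\<^sup>2 * nn (Suc k) f" by (intro mult_left_mono norm_le_nn) auto
    finally show "nn (Suc k) (mul m f) \<le> (K\<^sup>2 + (2 * C1 + (\<Sum>i\<in>UNIV. 2 * C2 i))) * nn (Suc k) f"
      using s unfolding nn.simps(2)[of k "mul m f"] distrib_right[of "K\<^sup>2"] by linarith
  qed
qed

lemma nn_0: "nn k (0 :: 'n::finite l2) = 0"
  using nn_scale[OF sob_0, where c = 0 and k = k and 'a = 'n] by simp

text \<open>The crude power of 2 comes from iterating the two-term bound
  \<open>nn_add\<close>.\<close>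

lemma nn_sum: "finite A \<Longrightarrow> (\<And>j. j \<in> A \<Longrightarrow> sob k (f j)) \<Longrightarrow> nn k (\<Sum>j\<in>A. f j) \<le> 2 ^ card A * (\<Sum>j\<in>A. nn k (f j))"
proof (induction A rule: finite_induct)
  case empty
  show ?case by (simp add: nn_0)
next
  case (insert x A)
  have "nn k (f x + (\<Sum>j\<in>A. f j)) \<le> 2 * nn k (f x) + 2 * nn k (\<Sum>j\<in>A. f j)"
    using insert by (intro nn_add sob_sum) auto
  also have "\<dots> \<le> 2 * (2 ^ card A * nn k (f x)) + 2 * (2 ^ card A * (\<Sum>j\<in>A. nn k (f j)))"
  proof -
    have "1 * nn k (f x) \<le> 2 ^ card A * nn k (f x)" by (intro mult_right_mono) auto
    moreover have "nn k (\<Sum>j\<in>A. f j) \<le> 2 ^ card A * (\<Sum>j\<in>A. nn k (f j))" using insert by auto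
    ultimately show ?thesis by simp
  qed
  finally show ?case using insert by (simp add: distrib_left)
qed

lemma sob_Qop: "smooth_bdd m \<Longrightarrow> sob (k + 2) w \<Longrightarrow> sob k (Qop m w)"
  unfolding Qop_def
  by (intro sob_sum sob_add sob_mul smooth_bdd_pdx) (auto intro: sob_Suc_imp simp: numeral_2_eq_2 simp del: sob.simps dest: sob_dd)

lemma Qop_nn:
  fixes m :: "real^'n::finite \<Rightarrow> real"
  assumes m: "smooth_bdd m"
  shows "\<exists>C\<ge>0. \<forall>w. sob (k + 2) w \<longrightarrow> nn k (Qop m w) \<le> C * nn (k + 2) w"
proof -
  obtain C1 where C1: "C1 \<ge> 0" "\<And>f. sob k f \<Longrightarrow> nn k (mul m f) \<le> C1 * nn k f"
    using nn_mul[OF m, of k] by blast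
  have "\<forall>i. \<exists>C\<ge>0. \<forall>f. sob k f \<longrightarrow> nn k (mul (pdx i m) f) \<le> C * nn k f"
    using nn_mul[OF smooth_bdd_pdx[OF m]] by blast
  then obtain C2 where C2: "\<And>i. C2 i \<ge> 0" "\<And>i f. sob k f \<Longrightarrow> nn k (mul (pdx i m) f) \<le> C2 i * nn k f"
    by metis
  let ?N = "2 ^ card (UNIV :: 'n set) :: real"
  show ?thesis
  proof (intro exI conjI allI impI)
    show "0 \<le> ?N * (\<Sum>i\<in>UNIV. 2 * C1 + 2 * C2 i)"
      using C1 C2 by (simp add: sum_nonneg)
    fix w :: "'n l2" assume w: "sob (k + 2) w"
    have s: "sob k (dd i w)" "sob k (dd i (dd i w))" for i
      using w by (auto simp: numeral_2_eq_2 simp del: sob.simps intro: sob_dd sob_Suc_imp)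
    have le: "nn k (dd i w) \<le> nn (k + 2) w" "nn k (dd i (dd i w)) \<le> nn (k + 2) w" for i
      using nn_dd_le[of k i w] nn_dd_le[of k i "dd i w"] nn_dd_le[of "Suc k" i w] nn_Suc_ge[of "Suc k" w]
      by (auto simp: numeral_2_eq_2 simp del: nn.simps)
    have "nn k (mul m (dd i (dd i w)) + mul (pdx i m) (dd i w)) \<le> (2 * C1 + 2 * C2 i) * nn (k + 2) w" for i
    proof -
      have "nn k (mul m (dd i (dd i w)) + mul (pdx i m) (dd i w)) \<le> 2 * nn k (mul m (dd i (dd i w))) + 2 * nn k (mul (pdx i m) (dd i w))"
        by (intro nn_add sob_mul smooth_bdd_pdx m s)
      also have "\<dots> \<le> 2 * (C1 * nn k (dd i (dd i w))) + 2 * (C2 i * nn k (dd i w))"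
        using C1(2)[OF s(2)] C2(2)[OF s(1)] by (intro add_mono mult_left_mono) auto
      also have "\<dots> \<le> 2 * (C1 * nn (k + 2) w) + 2 * (C2 i * nn (k + 2) w)"
        using C1 C2 le by (intro add_mono mult_left_mono) auto
      finally show ?thesis by (simp add: distrib_right)
    qed
    then have "(\<Sum>i\<in>UNIV. nn k (mul m (dd i (dd i w)) + mul (pdx i m) (dd i w))) \<le> (\<Sum>i\<in>UNIV. 2 * C1 + 2 * C2 i) * nn (k + 2) w"
      unfolding sum_distrib_right by (rule sum_mono)
    moreover have "nn k (Qop m w) \<le> ?N * (\<Sum>i\<in>UNIV. nn k (mul m (dd i (dd i w)) + mul (pdx i m) (dd i w)))"
      unfolding Qop_def by (intro nn_sum sob_add sob_mul smooth_bdd_pdx m s) auto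
    ultimately show "nn k (Qop m w) \<le> ?N * (\<Sum>i\<in>UNIV. 2 * C1 + 2 * C2 i) * nn (k + 2) w"
      by (smt (verit, best) mult.assoc mult_left_mono zero_le_power)
  qed
qed

text \<open>One constant serves every strength \<open>kap\<close>: the operator is affine in
  \<open>kap\<close>, so its square grows at most like \<open>(1 + kap)\<^sup>2\<close>.\<close>

lemma Qop_kappa:
  fixes b p :: "real^'n::finite \<Rightarrow> real"
  assumes b: "smooth_bdd b" and p: "smooth_bdd p"
  shows "\<exists>C\<ge>0. \<forall>kap w. kap \<ge> 0 \<longrightarrow> sob 2 w \<longrightarrow> (norm (Qop (\<lambda>x. b x + kap * p x) w))\<^sup>2 \<le> C * (1 + kap)\<^sup>2 * nn 2 w"
proof -
  obtain C1 where C1: "C1 \<ge> 0" "\<And>w. sob 2 w \<Longrightarrow> (norm (Qop b w))\<^sup>2 \<le> C1 * nn 2 w"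
    using Qop_nn[OF b, of 0] by (auto simp del: add_2_eq_Suc add_2_eq_Suc')
  obtain C2 where C2: "C2 \<ge> 0" "\<And>w. sob 2 w \<Longrightarrow> (norm (Qop p w))\<^sup>2 \<le> C2 * nn 2 w"
    using Qop_nn[OF p, of 0] by (auto simp del: add_2_eq_Suc add_2_eq_Suc')
  show ?thesis
  proof (intro exI conjI allI impI)
    show "0 \<le> 2 * C1 + 2 * C2" using C1 C2 by simp
    fix kap :: real and w :: "'n l2" assume k: "kap \<ge> 0" and w: "sob 2 w"
    have "(norm (Qop (\<lambda>x. b x + kap * p x) w))\<^sup>2 \<le> 2 * (norm (Qop b w))\<^sup>2 + 2 * (norm (kap *\<^sub>R Qop p w))\<^sup>2"
      unfolding Qop_lincomb[OF b p] by (rule norm_add_sq)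
    also have "\<dots> \<le> 2 * (C1 * nn 2 w) + 2 * (kap\<^sup>2 * (C2 * nn 2 w))"
      using C1(2)[OF w] C2(2)[OF w] by (intro add_mono mult_left_mono) (auto simp: power_mult_distrib intro!: mult_left_mono)
    also have "\<dots> \<le> 2 * ((1 + kap)\<^sup>2 * (C1 * nn 2 w)) + 2 * ((1 + kap)\<^sup>2 * (C2 * nn 2 w))"
    proof (intro add_mono mult_left_mono mult_right_mono)
      have "1\<^sup>2 \<le> (1 + kap)\<^sup>2" using k by (intro power_mono) auto
      then have "1 * (C1 * nn 2 w) \<le> (1 + kap)\<^sup>2 * (C1 * nn 2 w)"
        using C1 by (intro mult_right_mono) auto
      then show "C1 * nn 2 w \<le> (1 + kap)\<^sup>2 * (C1 * nn 2 w)" by simp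
      show "kap\<^sup>2 \<le> (1 + kap)\<^sup>2" using k by (intro power_mono) auto
    qed (use C2 in auto)
    also have "\<dots> = (2 * C1 + 2 * C2) * (1 + kap)\<^sup>2 * nn 2 w" by (simp add: algebra_simps)
    finally show "(norm (Qop (\<lambda>x. b x + kap * p x) w))\<^sup>2 \<le> (2 * C1 + 2 * C2) * (1 + kap)\<^sup>2 * nn 2 w" .
  qed
qed

text \<open>The commutator of a derivative with the divergence form is the same form with a
  differentiated coefficient. It is therefore of second order and obeys the same bounds.\<close>

lemma dd_Qop:
  assumes m: "smooth_bdd m" and w: "sob 3 w"
  shows "dd k (Qop m w) = Qop m (dd k w) + Qop (pdx k m) w"
proof -
  have s3: "sob (Suc (Suc (Suc 0))) w" using w by (simp add: numeral_3_eq_3)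
  have s2: "sob 2 w" "sob 2 (dd k w)" "sob (Suc (Suc 0)) (dd i w)" "sob (Suc (Suc 0)) w" "sob (Suc 0) (dd i w)" for i
    using sob_Suc_imp[OF s3] sob_dd[OF s3] sob_Suc_imp[OF sob_dd[OF s3]] by (simp_all only: numeral_2_eq_2)
  have s1: "sob (Suc 0) (dd j (dd i w))" for i j by (rule sob_dd[OF s2(3)])
  have "dd k (dd i (mul m (dd i w))) = dd i (mul m (dd i (dd k w))) + dd i (mul (pdx k m) (dd i w))" for i
  proof -
    have "dd k (dd i (mul m (dd i w))) = dd i (dd k (mul m (dd i w)))"
      by (intro dd_commute sob_mul m s2)
    also have "dd k (mul m (dd i w)) = mul m (dd k (dd i w)) + mul (pdx k m) (dd i w)"
      by (intro dd_mul m s2)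
    also have "dd k (dd i w) = dd i (dd k w)" by (intro dd_commute s2)
    also have "dd i (mul m (dd i (dd k w)) + mul (pdx k m) (dd i w)) = dd i (mul m (dd i (dd k w))) + dd i (mul (pdx k m) (dd i w))"
      by (intro dd_add sob_mul smooth_bdd_pdx m s1 s2)
    finally show ?thesis .
  qed
  moreover have "dd k (Qop m w) = (\<Sum>i\<in>UNIV. dd k (dd i (mul m (dd i w))))"
    unfolding Qop_div[OF m s2(1)] by (intro dd_sum sob_dd sob_mul m s2) auto
  ultimately show ?thesis
    unfolding Qop_div[OF m s2(2)] Qop_div[OF smooth_bdd_pdx[OF m] s2(1)] by (simp add: sum.distrib)
qed

section \<open>First-order energy estimate\<close>

text \<open>The constant is forgotten on purpose. Lipschitz continuity only justifies passing from
  an a.e. differential inequality to an integrated one; its constant may depend on the strength of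
  the mirror or on the step of a difference quotient without entering any estimate.\<close>

definition lipr :: "real set \<Rightarrow> (real \<Rightarrow> 'a::metric_space) \<Rightarrow> bool" where
  "lipr S f \<longleftrightarrow> (\<exists>L\<ge>0. \<forall>s\<in>S. \<forall>t\<in>S. dist (f s) (f t) \<le> L * \<bar>s - t\<bar>)"

lemma liprI: "L \<ge> 0 \<Longrightarrow> (\<And>s t. s \<in> S \<Longrightarrow> t \<in> S \<Longrightarrow> dist (f s) (f t) \<le> L * \<bar>s - t\<bar>) \<Longrightarrow> lipr S f"
  by (auto simp: lipr_def)

lemma lipr_subset: "lipr S f \<Longrightarrow> T \<subseteq> S \<Longrightarrow> lipr T f"
  unfolding lipr_def by blast

lemma lipr_add:
  fixes f g :: "real \<Rightarrow> 'a::real_normed_vector"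
  assumes "lipr S f" "lipr S g" shows "lipr S (\<lambda>t. f t + g t)"
proof -
  obtain L L' where L: "L \<ge> 0" "\<And>s t. s \<in> S \<Longrightarrow> t \<in> S \<Longrightarrow> dist (f s) (f t) \<le> L * \<bar>s - t\<bar>"
    "L' \<ge> 0" "\<And>s t. s \<in> S \<Longrightarrow> t \<in> S \<Longrightarrow> dist (g s) (g t) \<le> L' * \<bar>s - t\<bar>"
    using assms by (auto simp: lipr_def)
  show ?thesis
  proof (rule liprI[of "L + L'"])
    fix s t assume st: "s \<in> S" "t \<in> S"
    have "dist (f s + g s) (f t + g t) \<le> dist (f s) (f t) + dist (g s) (g t)" by (rule dist_triangle_add)
    then show "dist (f s + g s) (f t + g t) \<le> (L + L') * \<bar>s - t\<bar>"
      using L(2,4)[OF st] by (simp add: distrib_right)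
  qed (use L in simp)
qed

lemma lipr_const: "lipr S (\<lambda>t. c)"
  by (rule liprI[of 0]) auto

lemma lipr_sum:
  fixes f :: "'i \<Rightarrow> real \<Rightarrow> 'a::real_normed_vector"
  shows "finite A \<Longrightarrow> (\<And>i. i \<in> A \<Longrightarrow> lipr S (f i)) \<Longrightarrow> lipr S (\<lambda>t. \<Sum>i\<in>A. f i t)"
  by (induction A rule: finite_induct) (auto intro: lipr_const lipr_add)

lemma lipr_bounded_linear:
  assumes "bounded_linear T" "lipr S f" shows "lipr S (\<lambda>t. T (f t))"
proof -
  interpret T: bounded_linear T by fact
  obtain L where L: "L \<ge> 0" "\<And>s t. s \<in> S \<Longrightarrow> t \<in> S \<Longrightarrow> dist (f s) (f t) \<le> L * \<bar>s - t\<bar>"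
    using assms by (auto simp: lipr_def)
  obtain K where K: "K \<ge> 0" "\<And>x. norm (T x) \<le> norm x * K" using T.nonneg_bounded by blast
  show ?thesis
  proof (rule liprI[of "L * K"])
    fix s t assume st: "s \<in> S" "t \<in> S"
    have "dist (T (f s)) (T (f t)) \<le> norm (f s - f t) * K"
      using K(2)[of "f s - f t"] by (simp add: dist_norm T.diff)
    also have "\<dots> \<le> (L * \<bar>s - t\<bar>) * K" using L(2)[OF st] K by (intro mult_right_mono) (auto simp: dist_norm)
    finally show "dist (T (f s)) (T (f t)) \<le> L * K * \<bar>s - t\<bar>" by (simp add: mult_ac)
  qed (use L K in simp)
qed

lemma lipr_bounded:
  fixes f :: "real \<Rightarrow> 'a::real_normed_vector"
  assumes "lipr {t0..t1} f" obtains Y where "Y \<ge> 0" "\<And>t. t \<in> {t0..t1} \<Longrightarrow> norm (f t) \<le> Y"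
proof -
  obtain L where L: "L \<ge> 0" "\<And>s t. s \<in> {t0..t1} \<Longrightarrow> t \<in> {t0..t1} \<Longrightarrow> dist (f s) (f t) \<le> L * \<bar>s - t\<bar>"
    using assms by (auto simp: lipr_def)
  have "norm (f t) \<le> norm (f t0) + L * \<bar>t1 - t0\<bar>" if t: "t \<in> {t0..t1}" for t
  proof -
    have "norm (f t - f t0) \<le> L * \<bar>t - t0\<bar>" using L(2)[of t t0] t by (simp add: dist_norm)
    also have "\<dots> \<le> L * \<bar>t1 - t0\<bar>" using L(1) t by (intro mult_left_mono) auto
    finally show ?thesis using norm_triangle_sub[of "f t" "f t0"] by linarith
  qed
  then show ?thesis using L(1) by (intro that[of "norm (f t0) + L * \<bar>t1 - t0\<bar>"]) auto
qed

lemma lipr_norm_sq: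
  fixes f :: "real \<Rightarrow> 'a::real_inner"
  assumes "lipr {t0..t1} f" shows "lipr {t0..t1} (\<lambda>t. (norm (f t))\<^sup>2)"
proof -
  obtain L where L: "L \<ge> 0" "\<And>s t. s \<in> {t0..t1} \<Longrightarrow> t \<in> {t0..t1} \<Longrightarrow> dist (f s) (f t) \<le> L * \<bar>s - t\<bar>"
    using assms by (auto simp: lipr_def)
  obtain Y where Y: "Y \<ge> 0" "\<And>t. t \<in> {t0..t1} \<Longrightarrow> norm (f t) \<le> Y" using lipr_bounded[OF assms] by metis
  show ?thesis
  proof (rule liprI[of "2 * Y * L"])
    fix s t assume st: "s \<in> {t0..t1}" "t \<in> {t0..t1}"
    have "(norm (f s))\<^sup>2 - (norm (f t))\<^sup>2 = inner (f s + f t) (f s - f t)"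
      by (simp add: power2_norm_eq_inner inner_add_left inner_diff_right inner_commute[of "f t" "f s"])
    then have "\<bar>(norm (f s))\<^sup>2 - (norm (f t))\<^sup>2\<bar> \<le> norm (f s + f t) * norm (f s - f t)"
      by (simp add: Cauchy_Schwarz_ineq2)
    also have "\<dots> \<le> (Y + Y) * (L * \<bar>s - t\<bar>)"
      using L(2)[OF st] Y st by (intro mult_mono norm_triangle_mono) (auto simp: dist_norm)
    finally show "dist ((norm (f s))\<^sup>2) ((norm (f t))\<^sup>2) \<le> 2 * Y * L * \<bar>s - t\<bar>"
      by (simp add: dist_real_def mult_ac)
  qed (use L Y in simp)
qed

lemma lipr_Een:
  assumes m: "smooth_bdd m" and al: "mbdd al K"
    and ev: "\<And>s. s \<in> {t0..t1} \<Longrightarrow> sob 2 (w s) \<and> norm (Qop m (w s)) \<le> M"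
    and L: "lipr {t0..t1} w" "lipr {t0..t1} y"
  shows "lipr {t0..t1} (\<lambda>t. Een al m (w t) (y t))"
proof (cases "t0 \<le> t1")
  case True
  obtain L1 where L1: "L1 \<ge> 0" "\<And>s t. s \<in> {t0..t1} \<Longrightarrow> t \<in> {t0..t1} \<Longrightarrow> dist (w s) (w t) \<le> L1 * \<bar>s - t\<bar>"
    using L(1) by (auto simp: lipr_def)
  obtain L2 where L2: "L2 \<ge> 0" "\<And>s t. s \<in> {t0..t1} \<Longrightarrow> t \<in> {t0..t1} \<Longrightarrow> dist (y s) (y t) \<le> L2 * \<bar>s - t\<bar>"
    using L(2) by (auto simp: lipr_def)
  obtain Y where Y: "Y \<ge> 0" "\<And>t. t \<in> {t0..t1} \<Longrightarrow> norm (y t) \<le> Y" using lipr_bounded[OF L(2)] by metis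
  have M: "M \<ge> 0" using ev[of t0] True norm_ge_zero order_trans by (metis atLeastAtMost_iff order_refl)
  have K: "K \<ge> 0" by (rule mbdd_nonneg[OF al])
  let ?L = "L1 + L2"
  have *: "norm (w s - w t) \<le> ?L * \<bar>s - t\<bar>" "norm (y s - y t) \<le> ?L * \<bar>s - t\<bar>" if "s \<in> {t0..t1}" "t \<in> {t0..t1}" for s t
    using L1(2)[OF that] L2(2)[OF that] mult_nonneg_nonneg[OF L1(1) abs_ge_zero[of "s - t"]]
      mult_nonneg_nonneg[OF L2(1) abs_ge_zero[of "s - t"]]
    unfolding dist_norm distrib_right by linarith+
  show ?thesis
  proof (rule liprI[of "2 * K * Y * ?L + 2 * M * ?L"])
    fix s t assume st: "s \<in> {t0..t1}" "t \<in> {t0..t1}"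
    show "dist (Een al m (w s) (y s)) (Een al m (w t) (y t)) \<le> (2 * K * Y * ?L + 2 * M * ?L) * \<bar>s - t\<bar>"
      unfolding dist_real_def
      by (rule Een_lipschitz[OF m al ev _ *(1) *(2) Y(2) st]) (use L1 L2 in auto)
  qed (use L1 L2 K Y M in simp)
qed (auto simp: lipr_def)

lemma gronwall_lipr:
  fixes E :: "real \<Rightarrow> real"
  assumes "t0 \<le> t1" "lam \<ge> 0" "lipr {t0..t1} E"
    and "AE t in lborel. t \<in> {t0<..<t1} \<longrightarrow>
      (\<exists>D. (E has_real_derivative D) (at t) \<and> D \<le> lam * E t + K * exp (lam * (t - t0)))"
  shows "E t1 \<le> exp (lam * (t1 - t0)) * (E t0 + K * (t1 - t0))"
proof -
  obtain L where "\<And>s t. s \<in> {t0..t1} \<Longrightarrow> t \<in> {t0..t1} \<Longrightarrow> \<bar>E s - E t\<bar> \<le> L * \<bar>s - t\<bar>"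
    using assms(3) unfolding lipr_def dist_real_def by metis
  then show ?thesis by (rule lipschitz_AE_gronwall[OF assms(1,2) _ assms(4)])
qed

text \<open>The solution class of the wave equation with a coefficient \<open>m\<close> that is constant in time,
  on a time interval.\<close>
definition wave_on :: "(real^'n::finite \<Rightarrow> real) \<Rightarrow> (real^'n \<Rightarrow> real) \<Rightarrow> real \<Rightarrow> real \<Rightarrow> (real \<Rightarrow> 'n l2) \<Rightarrow> (real \<Rightarrow> 'n l2) \<Rightarrow> bool" where
  "wave_on a m t0 t1 u v \<longleftrightarrow>
    (\<forall>t\<in>{t0..t1}. sob 3 (u t) \<and> sob 1 (v t)) \<and>
    (\<exists>M. \<forall>t\<in>{t0..t1}. nn 3 (u t) \<le> M) \<and>
    lipr {t0..t1} u \<and> lipr {t0..t1} v \<and>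
    (\<forall>i. lipr {t0..t1} (\<lambda>t. dd i (u t)) \<and> lipr {t0..t1} (\<lambda>t. dd i (v t))) \<and>
    (\<forall>t\<in>{t0<..<t1}. (u has_vector_derivative v t) (at t) \<and>
       (\<forall>i. ((\<lambda>s. dd i (u s)) has_vector_derivative dd i (v t)) (at t))) \<and>
    (AE t in lborel. t \<in> {t0<..<t1} \<longrightarrow> (\<exists>z. sob 1 z \<and> (v has_vector_derivative z) (at t) \<and>
       (\<forall>i. ((\<lambda>s. dd i (v s)) has_vector_derivative dd i z) (at t)) \<and> z = mul a (Qop m (u t))))"

lemma wave_on_subset:
  assumes "wave_on a m t0 t1 u v" "t0 \<le> s0" "s1 \<le> t1"
  shows "wave_on a m s0 s1 u v"
proof -
  have sub: "{s0..s1} \<subseteq> {t0..t1}" "{s0<..<s1} \<subseteq> {t0<..<t1}" using assms by auto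
  have ae: "AE t in lborel. t \<in> {t0<..<t1} \<longrightarrow> (\<exists>z. sob 1 z \<and> (v has_vector_derivative z) (at t) \<and>
       (\<forall>i. ((\<lambda>s. dd i (v s)) has_vector_derivative dd i z) (at t)) \<and> z = mul a (Qop m (u t)))"
    using assms(1) unfolding wave_on_def by blast
  have ae': "AE t in lborel. t \<in> {s0<..<s1} \<longrightarrow> (\<exists>z. sob 1 z \<and> (v has_vector_derivative z) (at t) \<and>
       (\<forall>i. ((\<lambda>s. dd i (v s)) has_vector_derivative dd i z) (at t)) \<and> z = mul a (Qop m (u t)))"
    using ae sub(2) by (auto elim!: eventually_mono)
  note A = assms(1)[unfolded wave_on_def]
  note A1 = conjunct1[OF A] note B1 = conjunct2[OF A]
  note A2 = conjunct1[OF B1] note B2 = conjunct2[OF B1]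
  note A3 = conjunct1[OF B2] note B3 = conjunct2[OF B2]
  note A4 = conjunct1[OF B3] note B4 = conjunct2[OF B3]
  note A5 = conjunct1[OF B4] note A6 = conjunct1[OF conjunct2[OF B4]]
  show ?thesis
    unfolding wave_on_def
    using A1 A2 A3 A4 A5 A6 ae' sub
    by (intro conjI allI lipr_subset[OF A3 sub(1)] lipr_subset[OF A4 sub(1)]
        lipr_subset[OF conjunct1[OF spec[OF A5]] sub(1)] lipr_subset[OF conjunct2[OF spec[OF A5]] sub(1)])
      (fast | assumption)+
qed

text \<open>Here \<open>p\<close> stands for \<open>b \<chi>\<close>, so that the coefficient is \<open>b + \<kappa> p\<close> while the mirror acts.\<close>
locale wave_coeffs =
  fixes a b p :: "real^'n::finite \<Rightarrow> real" and a_lo a_hi b_lo :: real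
  assumes smooth_a: "smooth_bdd a" and smooth_b: "smooth_bdd b" and smooth_p: "smooth_bdd p"
    and a_lo: "a_lo > 0" "\<And>x. a_lo \<le> a x" and a_hi: "\<And>x. a x \<le> a_hi"
    and b_lo: "b_lo > 0" "\<And>x. b_lo \<le> b x" and p_nonneg: "\<And>x. 0 \<le> p x"
begin

definition al :: "real^'n \<Rightarrow> real" where "al x = 1 / a x"

lemma a_pos: "a x > 0"
  using a_lo(1) a_lo(2)[of x] by linarith

lemma a_hi_pos: "a_hi > 0"
  using a_pos[of 0] a_hi[of 0] by linarith

lemma mbdd_al: "mbdd al (1 / a_lo)"
proof -
  have "a \<in> borel_measurable lborel" using smooth_a unfolding smooth_bdd_def by (intro smooth_borel) simp
  then have "al \<in> borel_measurable lborel" unfolding al_def[abs_def] by measurable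
  moreover have "\<bar>al x\<bar> \<le> 1 / a_lo" for x
    using a_pos[of x] a_lo(1) a_lo(2)[of x] by (simp add: al_def frac_le)
  ultimately show ?thesis by (simp add: mbdd_def)
qed

lemma al_ge: "1 / a_hi \<le> al x"
  using a_pos[of x] a_hi[of x] by (simp add: al_def frac_le)

lemma mul_al_a: "mul al (mul a f) = f"
proof -
  obtain K where K: "mbdd a K" by (rule smooth_bdd_mbdd[OF smooth_a])
  have "(\<lambda>x. al x * a x) = (\<lambda>x. 1)" using a_pos by (auto simp: al_def less_imp_neq[symmetric])
  then show ?thesis by (simp add: mul_mul[OF mbdd_al K] mul_one)
qed

abbreviation bk :: "real \<Rightarrow> real^'n \<Rightarrow> real" where "bk kap \<equiv> \<lambda>x. b x + kap * p x"

lemma smooth_bk: "smooth_bdd (bk kap)"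
  by (intro smooth_bdd_add smooth_bdd_scale smooth_b smooth_p)

definition gsq :: "'n l2 \<Rightarrow> real" where "gsq w = (\<Sum>i\<in>UNIV. (norm (dd i w))\<^sup>2)"

lemma gsq_nonneg [simp]: "0 \<le> gsq w"
  by (simp add: gsq_def sum_nonneg)

text \<open>The sign of \<open>p\<close> matters here: the mirror only adds potential energy, so the
  lower bound is uniform in \<open>kap\<close>.\<close>

lemma Een_lower: "kap \<ge> 0 \<Longrightarrow> 1 / a_hi * (norm y)\<^sup>2 + b_lo * gsq w \<le> Een al (bk kap) w y"
proof -
  assume k: "kap \<ge> 0"
  obtain K where K: "mbdd (bk kap) K" by (rule smooth_bdd_mbdd[OF smooth_bk])
  have "b_lo \<le> bk kap x" for x using b_lo(2)[of x] p_nonneg[of x] k by (simp add: add_increasing2)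
  then have "b_lo * (norm (dd i w))\<^sup>2 \<le> inner (mul (bk kap) (dd i w)) (dd i w)" for i
    by (intro inner_mul_ge[OF K])
  then have "b_lo * gsq w \<le> Bform (bk kap) w w"
    unfolding gsq_def Bform_def sum_distrib_left by (rule sum_mono)
  moreover have "1 / a_hi * (norm y)\<^sup>2 \<le> inner (mul al y) y"
    using al_ge by (intro inner_mul_ge[OF mbdd_al])
  ultimately show ?thesis by (simp add: Een_def)
qed

lemma Een_upper: "\<exists>C\<ge>0. \<forall>kap w y. kap \<ge> 0 \<longrightarrow> Een al (bk kap) w y \<le> C * (norm y)\<^sup>2 + C * (1 + kap) * gsq w"
proof -
  obtain K1 where K1: "mbdd b K1" by (rule smooth_bdd_mbdd[OF smooth_b])
  obtain K2 where K2: "mbdd p K2" by (rule smooth_bdd_mbdd[OF smooth_p])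
  note nn = mbdd_nonneg[OF K1] mbdd_nonneg[OF K2] mbdd_nonneg[OF mbdd_al]
  define C where "C = K1 + K2 + 1 / a_lo"
  have "Een al (bk kap) w y \<le> C * (norm y)\<^sup>2 + C * (1 + kap) * gsq w" if k: "kap \<ge> 0" for kap w y
  proof -
    have Kk: "mbdd (bk kap) (K1 + \<bar>kap\<bar> * K2)" by (intro mbdd_add mbdd_scale K1 K2)
    have ub: "inner (mul m f) f \<le> K * (norm f)\<^sup>2" if "mbdd m K" for m K and f :: "'n l2"
    proof -
      have "inner (mul m f) f \<le> norm (mul m f) * norm f" by (rule norm_cauchy_schwarz)
      also have "\<dots> \<le> (K * norm f) * norm f" by (intro mult_right_mono norm_mul_le[OF that]) auto
      finally show ?thesis by (simp add: power2_eq_square mult.assoc)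
    qed
    have "Bform (bk kap) w w \<le> (K1 + \<bar>kap\<bar> * K2) * gsq w"
      unfolding gsq_def Bform_def sum_distrib_left by (intro sum_mono ub Kk)
    also have "\<dots> \<le> (C * (1 + kap)) * gsq w"
    proof (rule mult_right_mono)
      have "K1 + kap * K2 \<le> (K1 + K2) * (1 + kap)" using nn k by (simp add: algebra_simps)
      also have "\<dots> \<le> C * (1 + kap)" using nn k by (intro mult_right_mono) (auto simp: C_def)
      finally show "K1 + \<bar>kap\<bar> * K2 \<le> C * (1 + kap)" using k by simp
    qed simp
    finally have "Bform (bk kap) w w \<le> C * (1 + kap) * gsq w" .
    moreover have "inner (mul al y) y \<le> 1 / a_lo * (norm y)\<^sup>2" by (rule ub[OF mbdd_al])
    moreover have "1 / a_lo * (norm y)\<^sup>2 \<le> C * (norm y)\<^sup>2" using nn by (intro mult_right_mono) (auto simp: C_def)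
    ultimately show ?thesis by (simp add: Een_def)
  qed
  moreover have "C \<ge> 0" using nn by (simp add: C_def)
  ultimately show ?thesis by blast
qed

text \<open>Used with \<open>w = u - g\<close> and \<open>y = \<partial>\<^sub>t u\<close>, where \<open>g\<close> does not depend on time.\<close>
definition Ftot :: "real \<Rightarrow> 'n l2 \<Rightarrow> 'n l2 \<Rightarrow> real" where
  "Ftot kap w y = (norm w)\<^sup>2 + Een al (bk kap) w y + (\<Sum>k\<in>UNIV. Een al (bk kap) (dd k w) (dd k y))"

lemma nn_2_eq: "nn 2 w = (norm w)\<^sup>2 + gsq w + (\<Sum>k\<in>UNIV. gsq (dd k w))"
  by (simp add: numeral_2_eq_2 nn.simps gsq_def sum.distrib)

lemma nn_1_eq: "nn 1 w = (norm w)\<^sup>2 + (\<Sum>k\<in>UNIV. (norm (dd k w))\<^sup>2)"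
  by (simp add: nn.simps)

lemma Ftot_lower: "\<exists>c>0. \<forall>kap w y. kap \<ge> 0 \<longrightarrow> c * (nn 2 w + nn 1 y) \<le> Ftot kap w y"
proof -
  define c where "c = min 1 (min (1 / a_hi) b_lo)"
  have c: "c > 0" "c \<le> 1" "c \<le> 1 / a_hi" "c \<le> b_lo" using a_hi_pos b_lo by (auto simp: c_def)
  have "c * (nn 2 w + nn 1 y) \<le> Ftot kap w y" if k: "kap \<ge> 0" for kap w y
  proof -
    have E: "c * ((norm y)\<^sup>2 + gsq w) \<le> Een al (bk kap) w y" for w y
    proof -
      have "c * ((norm y)\<^sup>2 + gsq w) \<le> 1 / a_hi * (norm y)\<^sup>2 + b_lo * gsq w"
        unfolding distrib_left using c by (intro add_mono mult_right_mono) auto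
      then show ?thesis using Een_lower[OF k, of y w] by linarith
    qed
    have "c * (nn 2 w + nn 1 y) = c * (norm w)\<^sup>2 + c * ((norm y)\<^sup>2 + gsq w) + (\<Sum>k\<in>UNIV. c * ((norm (dd k y))\<^sup>2 + gsq (dd k w)))"
      unfolding nn_2_eq nn_1_eq by (simp add: sum.distrib sum_distrib_left distrib_left algebra_simps)
    also have "\<dots> \<le> Ftot kap w y"
      unfolding Ftot_def using c mult_right_mono[of c 1 "(norm w)\<^sup>2"] by (intro add_mono sum_mono E) auto
    finally show ?thesis .
  qed
  then show ?thesis using c(1) by blast
qed

lemma Ftot_upper: "\<exists>C\<ge>0. \<forall>kap w y. kap \<ge> 0 \<longrightarrow> Ftot kap w y \<le> C * (1 + kap) * nn 2 w + C * nn 1 y"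
proof -
  obtain C where C: "C \<ge> 0" "\<And>kap w y. kap \<ge> 0 \<Longrightarrow> Een al (bk kap) w y \<le> C * (norm y)\<^sup>2 + C * (1 + kap) * gsq w"
    using Een_upper by blast
  have "Ftot kap w y \<le> (C + 1) * (1 + kap) * nn 2 w + (C + 1) * nn 1 y" if k: "kap \<ge> 0" for kap w y
  proof -
    have E: "Een al (bk kap) w y \<le> (C + 1) * (norm y)\<^sup>2 + (C + 1) * (1 + kap) * gsq w" for w y
    proof -
      have "C * (norm y)\<^sup>2 + C * (1 + kap) * gsq w \<le> (C + 1) * (norm y)\<^sup>2 + (C + 1) * (1 + kap) * gsq w"
        using k by (intro add_mono mult_right_mono) auto
      then show ?thesis using C(2)[OF k, of w y] by linarith
    qed
    have "1 * (norm w)\<^sup>2 \<le> ((C + 1) * (1 + kap)) * (norm w)\<^sup>2"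
      using C k mult_mono[of 1 "C + 1" 1 "1 + kap"] by (intro mult_right_mono) auto
    then have "Ftot kap w y \<le> ((C + 1) * (1 + kap)) * (norm w)\<^sup>2 + ((C + 1) * (norm y)\<^sup>2 + (C + 1) * (1 + kap) * gsq w)
        + (\<Sum>k\<in>UNIV. (C + 1) * (norm (dd k y))\<^sup>2 + (C + 1) * (1 + kap) * gsq (dd k w))"
      unfolding Ftot_def by (intro add_mono sum_mono E) auto
    also have "\<dots> = (C + 1) * (1 + kap) * nn 2 w + (C + 1) * nn 1 y"
      unfolding nn_2_eq nn_1_eq by (simp add: sum.distrib sum_distrib_left[symmetric] distrib_left add_ac)
    finally show ?thesis .
  qed
  then show ?thesis using C(1) by (intro exI[of _ "C + 1"]) auto
qed

end

lemma sob_3_imp: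
  assumes "sob 3 w"
  shows "sob 2 w" "sob 1 w" "sob 2 (dd i w)" "sob 1 (dd i w)" "sob 1 (dd j (dd i w))"
proof -
  have s3: "sob (Suc (Suc (Suc 0))) w" using assms by (simp add: numeral_3_eq_3)
  show "sob 2 w" "sob 1 w" "sob 2 (dd i w)" "sob 1 (dd i w)" "sob 1 (dd j (dd i w))"
    using sob_Suc_imp[OF s3] sob_Suc_imp[OF sob_Suc_imp[OF s3]] sob_dd[OF s3] sob_Suc_imp[OF sob_dd[OF s3]] sob_dd[OF sob_dd[OF s3]]
    by (simp_all only: numeral_2_eq_2 One_nat_def)
qed

lemma sob_2_imp:
  assumes "sob 2 w" shows "sob 1 w" "sob 1 (dd i w)"
proof -
  have s: "sob (Suc (Suc 0)) w" using assms by (simp add: numeral_2_eq_2)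
  show "sob 1 w" "sob 1 (dd i w)"
    using sob_Suc_imp[OF s] sob_dd[OF s] by (simp_all only: One_nat_def)
qed

lemma nn_dd_le_num: "nn 2 (dd i w) \<le> nn 3 w" "nn 1 (dd i w) \<le> nn 2 w" "(norm (dd i w))\<^sup>2 \<le> nn 1 w"
  using nn_dd_le[of 2 i w] nn_dd_le[of 1 i w] nn_dd_le[of 0 i w]
  by (simp_all only: numeral_3_eq_3 numeral_2_eq_2 One_nat_def nn.simps(1))

lemma lipr_cong: "(\<And>t. t \<in> S \<Longrightarrow> f t = g t) \<Longrightarrow> lipr S f = lipr S g"
  unfolding lipr_def by (metis (mono_tags, lifting))

lemma norm_sq_has_derivative:
  fixes w :: "real \<Rightarrow> 'a::real_inner"
  assumes "(w has_vector_derivative y) (at t)"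
  shows "((\<lambda>s. (norm (w s))\<^sup>2) has_real_derivative 2 * inner (w t) y) (at t)"
proof -
  have "((\<lambda>s. inner (w s) (w s)) has_derivative (\<lambda>h. inner (w t) (h *\<^sub>R y) + inner (h *\<^sub>R y) (w t))) (at t)"
    using assms unfolding has_vector_derivative_def by (intro has_derivative_inner)
  then have "((\<lambda>s. inner (w s) (w s)) has_derivative (\<lambda>h. 2 * inner (w t) y * h)) (at t)"
    by (simp add: inner_commute[of y "w t"] algebra_simps)
  then show ?thesis by (simp add: has_field_derivative_def power2_norm_eq_inner)
qed

lemma young_inner:
  fixes x y :: "'a::real_inner"
  assumes "c > 0"
  shows "2 * inner x y \<le> c * (norm x)\<^sup>2 + (norm y)\<^sup>2 / c"
proof -
  have "0 \<le> (norm (c *\<^sub>R x - y))\<^sup>2" by simp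
  also have "\<dots> = c * (c * (norm x)\<^sup>2 - 2 * inner x y) + (norm y)\<^sup>2"
    by (simp add: power2_norm_eq_inner inner_diff_left inner_diff_right inner_commute[of y x] algebra_simps)
  finally have "c * (2 * inner x y) \<le> c * (c * (norm x)\<^sup>2 + (norm y)\<^sup>2 / c)"
    using assms by (simp add: algebra_simps)
  then show ?thesis using assms by (simp add: mult_le_cancel_left)
qed

context wave_coeffs
begin

lemma Qop_bk: obtains C where "C \<ge> 0"
    "\<And>kap w. kap \<ge> 0 \<Longrightarrow> sob 2 w \<Longrightarrow> (norm (Qop (bk kap) w))\<^sup>2 \<le> C * (1 + kap)\<^sup>2 * nn 2 w"
  using Qop_kappa[OF smooth_b smooth_p] by blast

text \<open>The formal time derivative of \<open>Ftot\<close>, with \<open>z\<close> in the place of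
  the time derivative of \<open>y\<close>. Each energy contributes twice the pairing of its velocity
  with its residual.\<close>

definition Fder :: "real \<Rightarrow> 'n l2 \<Rightarrow> 'n l2 \<Rightarrow> 'n l2 \<Rightarrow> real" where
  "Fder kap w y z = 2 * inner w y + 2 * inner y (mul al z - Qop (bk kap) w)
     + (\<Sum>k\<in>UNIV. 2 * inner (dd k y) (mul al (dd k z) - Qop (bk kap) (dd k w)))"

text \<open>The third derivatives of \<open>U\<close> cancel between the two sides, so that third
  derivatives fall only on \<open>g\<close>. The other two terms are the commutators of the
  derivative with the divergence form and with \<open>a\<close>, both of second order in
  \<open>U\<close>. The estimate thus closes in H^2 for \<open>U\<close>, at the cost of the H^3
  norm of the fixed function \<open>g\<close>.\<close>

lemma residual_dd:
  assumes U: "sob 3 U" and g: "sob 3 g"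
  shows "mul al (dd k (mul a (Qop (bk kap) U))) - Qop (bk kap) (dd k (U - g))
    = Qop (bk kap) (dd k g) + (Qop (pdx k (bk kap)) U + mul al (mul (pdx k a) (Qop (bk kap) U)))"
proof -
  note U' = sob_3_imp[OF U] and g' = sob_3_imp[OF g]
  have q: "sob (Suc 0) (Qop (bk kap) U)"
    using sob_Qop[OF smooth_bk, of 1 U] U by (simp add: numeral_3_eq_3)
  have "mul al (dd k (mul a (Qop (bk kap) U))) = dd k (Qop (bk kap) U) + mul al (mul (pdx k a) (Qop (bk kap) U))"
    unfolding dd_mul[OF smooth_a q] linear_add[OF linear_mul[OF mbdd_al]] mul_al_a ..
  moreover have "dd k (U - g) = dd k U - dd k g"
    using U'(2) g'(2) by (intro dd_diff) simp_all
  ultimately show ?thesis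
    by (simp add: dd_Qop[OF smooth_bk U] Qop_diff[OF smooth_bk U'(3) g'(3)])
qed

text \<open>The residuals are of order \<open>1 + kap\<close> in norm, and Young's inequality
  weighted by \<open>1 + kap\<close> spends exactly one such factor. This keeps the growth rate
  linear in \<open>kap\<close>, which a pulse whose duration is proportional to
  \<open>1 / kap\<close> can afford.\<close>

lemma Fder_bound: "\<exists>C\<ge>0. \<forall>kap U g y. kap \<ge> 0 \<longrightarrow> sob 3 U \<longrightarrow> sob 3 g \<longrightarrow>
   Fder kap (U - g) y (mul a (Qop (bk kap) U)) \<le> C * (1 + kap) * (nn 2 (U - g) + nn 1 y + nn 3 g)"
proof -
  obtain CQ where CQ: "CQ \<ge> 0" "\<And>kap w. kap \<ge> 0 \<Longrightarrow> sob 2 w \<Longrightarrow> (norm (Qop (bk kap) w))\<^sup>2 \<le> CQ * (1 + kap)\<^sup>2 * nn 2 w"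
    by (rule Qop_bk) blast
  have "\<forall>k. \<exists>C\<ge>0. \<forall>kap w. kap \<ge> 0 \<longrightarrow> sob 2 w \<longrightarrow> (norm (Qop (pdx k (bk kap)) w))\<^sup>2 \<le> C * (1 + kap)\<^sup>2 * nn 2 w"
    unfolding pdx_lincomb[OF smooth_b smooth_p]
    using Qop_kappa[OF smooth_bdd_pdx[OF smooth_b] smooth_bdd_pdx[OF smooth_p]] by blast
  then obtain Ck where Ck: "\<And>k. Ck k \<ge> 0"
    "\<And>k kap w. kap \<ge> 0 \<Longrightarrow> sob 2 w \<Longrightarrow> (norm (Qop (pdx k (bk kap)) w))\<^sup>2 \<le> Ck k * (1 + kap)\<^sup>2 * nn 2 w"
    by metis
  have "\<forall>k. \<exists>K. mbdd (pdx k a) K" using smooth_bdd_mbdd[OF smooth_bdd_pdx[OF smooth_a]] by metis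
  then obtain Ka where Ka: "\<And>k. mbdd (pdx k a) (Ka k)" by metis
  define Kal where "Kal = 1 / a_lo"
  \<comment> \<open>The residual has three summands. Splitting its square twice gives the weights 2,
    4 and 4, and the bound \<open>nn 2 U \<le> 2 * N\<close> doubles the last two.\<close>
  define CR where "CR k = 2 * CQ + 8 * Ck k + 8 * ((Kal * Ka k)\<^sup>2 * CQ)" for k
  have CR0: "CR k \<ge> 0" for k using CQ(1) Ck(1)[of k] by (simp add: CR_def)
  define C where "C = 1 + CQ + (\<Sum>k\<in>UNIV. CR k)"
  have "Fder kap (U - g) y (mul a (Qop (bk kap) U)) \<le> 2 * C * (1 + kap) * (nn 2 (U - g) + nn 1 y + nn 3 g)"
    if k: "kap \<ge> 0" and U: "sob 3 U" and g: "sob 3 g" for kap U g y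
  proof -
    note U' = sob_3_imp[OF U] and g' = sob_3_imp[OF g]
    \<comment> \<open>Controls the third derivatives of \<open>g\<close> and, up to a factor 2, the
      second derivatives of \<open>U\<close> as the sum of \<open>U - g\<close> and
      \<open>g\<close>.\<close>
    define N where "N = nn 2 (U - g) + nn 3 g"
    have N0: "N \<ge> 0" by (simp add: N_def)
    have g23: "nn 2 g \<le> nn 3 g" by (rule nn_mono) simp
    have "nn 2 (U - g + g) \<le> 2 * nn 2 (U - g) + 2 * nn 2 g"
      by (intro nn_add sob_diff U' g')
    then have nU: "nn 2 U \<le> 2 * N" using g23 by (simp add: N_def)
    have K1: "1 + kap > 0" using k by simp
    let ?k2 = "(1 + kap)\<^sup>2"
    have QU: "(norm (Qop (bk kap) U))\<^sup>2 \<le> CQ * ?k2 * (2 * N)"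
      using CQ(2)[OF k U'(1)] mult_left_mono[OF nU, of "CQ * ?k2"] CQ(1) by (auto intro: order_trans)
    have R: "(norm (mul al (dd j (mul a (Qop (bk kap) U))) - Qop (bk kap) (dd j (U - g))))\<^sup>2 \<le> CR j * ?k2 * N" for j
    proof -
      let ?A = "Qop (bk kap) (dd j g)" and ?B = "Qop (pdx j (bk kap)) U" and ?C = "mul al (mul (pdx j a) (Qop (bk kap) U))"
      have A: "(norm ?A)\<^sup>2 \<le> CQ * ?k2 * N"
      proof -
        have "(norm ?A)\<^sup>2 \<le> CQ * ?k2 * nn 2 (dd j g)" by (rule CQ(2)[OF k g'(3)])
        also have "\<dots> \<le> CQ * ?k2 * N"
          using add_increasing[OF nn_nonneg[of 2 "U - g"] nn_dd_le_num(1)[of j g]] CQ(1) by (intro mult_left_mono) (auto simp: N_def)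
        finally show ?thesis .
      qed
      have B: "(norm ?B)\<^sup>2 \<le> Ck j * ?k2 * (2 * N)"
        using Ck(2)[OF k U'(1), of j] mult_left_mono[OF nU, of "Ck j * ?k2"] Ck(1)[of j] by (auto intro: order_trans)
      have C: "(norm ?C)\<^sup>2 \<le> (Kal * Ka j)\<^sup>2 * (CQ * ?k2 * (2 * N))"
      proof -
        have "norm ?C \<le> Kal * norm (mul (pdx j a) (Qop (bk kap) U))"
          unfolding Kal_def by (rule norm_mul_le[OF mbdd_al])
        also have "\<dots> \<le> Kal * (Ka j * norm (Qop (bk kap) U))"
          using mbdd_nonneg[OF mbdd_al] unfolding Kal_def by (intro mult_left_mono norm_mul_le[OF Ka])
        finally have "(norm ?C)\<^sup>2 \<le> (Kal * Ka j * norm (Qop (bk kap) U))\<^sup>2"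
          by (intro power_mono) (auto simp: mult.assoc)
        also have "\<dots> = (Kal * Ka j)\<^sup>2 * (norm (Qop (bk kap) U))\<^sup>2" by (simp add: power_mult_distrib)
        also have "\<dots> \<le> (Kal * Ka j)\<^sup>2 * (CQ * ?k2 * (2 * N))" by (intro mult_left_mono QU) auto
        finally show ?thesis .
      qed
      have "(norm (?A + (?B + ?C)))\<^sup>2 \<le> 2 * (norm ?A)\<^sup>2 + 4 * (norm ?B)\<^sup>2 + 4 * (norm ?C)\<^sup>2"
        using norm_add_sq[of ?A "?B + ?C"] norm_add_sq[of ?B ?C] by linarith
      also have "\<dots> \<le> 2 * (CQ * ?k2 * N) + 4 * (Ck j * ?k2 * (2 * N)) + 4 * ((Kal * Ka j)\<^sup>2 * (CQ * ?k2 * (2 * N)))"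
        using A B C by linarith
      also have "\<dots> = CR j * ?k2 * N" by (simp add: CR_def algebra_simps)
      finally show ?thesis unfolding residual_dd[OF U g] .
    qed
    \<comment> \<open>Weighted Young inequality: dividing the squared residual, of order
      \<open>(1 + kap)\<^sup>2\<close>, by the weight leaves a single factor
      \<open>1 + kap\<close>.\<close>
    have young: "2 * inner x r \<le> (1 + kap) * (norm x)\<^sup>2 + c * (1 + kap) * N" if "(norm r)\<^sup>2 \<le> c * ?k2 * N" for x r :: "'n l2" and c
    proof -
      have "(norm r)\<^sup>2 / (1 + kap) \<le> (c * ?k2 * N) / (1 + kap)" using that K1 by (intro divide_right_mono) auto
      also have "\<dots> = c * (1 + kap) * N" using K1 by (simp add: power2_eq_square)
      finally show ?thesis using young_inner[OF K1, of x r] by linarith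
    qed
    have 1: "2 * inner (U - g) y \<le> (1 + kap) * ((norm y)\<^sup>2 + nn 2 (U - g))"
    proof -
      have "2 * inner (U - g) y \<le> 1 * (norm (U - g))\<^sup>2 + (norm y)\<^sup>2 / 1" by (rule young_inner) simp
      also have "\<dots> \<le> 1 * ((norm y)\<^sup>2 + nn 2 (U - g))" using norm_le_nn[of "U - g" 2] by simp
      also have "\<dots> \<le> (1 + kap) * ((norm y)\<^sup>2 + nn 2 (U - g))" using k by (intro mult_right_mono) auto
      finally show ?thesis .
    qed
    have 2: "2 * inner y (mul al (mul a (Qop (bk kap) U)) - Qop (bk kap) (U - g)) \<le> (1 + kap) * (norm y)\<^sup>2 + CQ * (1 + kap) * N"
    proof (rule young)
      have "mul al (mul a (Qop (bk kap) U)) - Qop (bk kap) (U - g) = Qop (bk kap) g"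
        by (simp add: mul_al_a Qop_diff[OF smooth_bk U'(1) g'(1)])
      moreover have "(norm (Qop (bk kap) g))\<^sup>2 \<le> CQ * ?k2 * N"
      proof -
        have "(norm (Qop (bk kap) g))\<^sup>2 \<le> CQ * ?k2 * nn 2 g" by (rule CQ(2)[OF k g'(1)])
        also have "\<dots> \<le> CQ * ?k2 * N"
          using add_increasing[OF nn_nonneg[of 2 "U - g"] g23] CQ(1) by (intro mult_left_mono) (auto simp: N_def)
        finally show ?thesis .
      qed
      ultimately show "(norm (mul al (mul a (Qop (bk kap) U)) - Qop (bk kap) (U - g)))\<^sup>2 \<le> CQ * ?k2 * N" by simp
    qed
    have 3: "(\<Sum>j\<in>UNIV. 2 * inner (dd j y) (mul al (dd j (mul a (Qop (bk kap) U))) - Qop (bk kap) (dd j (U - g))))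
      \<le> (\<Sum>j\<in>UNIV. (1 + kap) * (norm (dd j y))\<^sup>2 + CR j * (1 + kap) * N)"
      by (intro sum_mono young R)
    have "Fder kap (U - g) y (mul a (Qop (bk kap) U)) \<le> (1 + kap) * ((norm y)\<^sup>2 + nn 2 (U - g)) + ((1 + kap) * (norm y)\<^sup>2 + CQ * (1 + kap) * N)
       + (\<Sum>j\<in>UNIV. (1 + kap) * (norm (dd j y))\<^sup>2 + CR j * (1 + kap) * N)"
      unfolding Fder_def using 1 2 3 by linarith
    also have "\<dots> = (1 + kap) * ((norm y)\<^sup>2 + nn 2 (U - g) + nn 1 y + CQ * N + (\<Sum>j\<in>UNIV. CR j) * N)"
      unfolding nn_1_eq by (simp add: sum.distrib sum_distrib_left[symmetric] sum_distrib_right[symmetric] algebra_simps)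
    also have "\<dots> \<le> (1 + kap) * ((2 * C) * (N + nn 1 y))"
    proof (rule mult_left_mono)
      have C1: "C \<ge> 1" using CQ CR0 by (simp add: C_def sum_nonneg)
      have "(norm y)\<^sup>2 + nn 2 (U - g) + nn 1 y + CQ * N + (\<Sum>j\<in>UNIV. CR j) * N \<le> 2 * nn 1 y + C * N"
      proof -
        have "C * N = N + CQ * N + (\<Sum>k\<in>UNIV. CR k) * N" by (simp add: C_def distrib_right)
        moreover have "nn 2 (U - g) \<le> N" by (simp add: N_def)
        ultimately show ?thesis using norm_le_nn[of y 1] by linarith
      qed
      also have "\<dots> \<le> (2 * C) * nn 1 y + (2 * C) * N"
        using C1 N0 nn_nonneg[of 1 y] by (intro add_mono mult_right_mono) auto
      finally show "(norm y)\<^sup>2 + nn 2 (U - g) + nn 1 y + CQ * N + (\<Sum>j\<in>UNIV. CR j) * N \<le> (2 * C) * (N + nn 1 y)"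
        by (simp add: distrib_left)
    qed (use K1 in simp)
    finally show ?thesis by (simp add: N_def algebra_simps)
  qed
  moreover have "2 * C \<ge> 0" using CQ CR0 by (simp add: C_def sum_nonneg)
  ultimately show ?thesis by blast
qed

lemma wave_on_bounds:
  assumes W: "wave_on a m t0 t1 u v" and g: "sob 3 g"
  obtains N where "N \<ge> 0" "\<And>t. t \<in> {t0..t1} \<Longrightarrow> sob 3 (u t - g)" "\<And>t. t \<in> {t0..t1} \<Longrightarrow> nn 3 (u t - g) \<le> N"
proof -
  obtain M where M: "\<And>t. t \<in> {t0..t1} \<Longrightarrow> nn 3 (u t) \<le> M" using W unfolding wave_on_def by blast
  have s: "sob 3 (u t)" if "t \<in> {t0..t1}" for t using W that unfolding wave_on_def by blast
  show ?thesis
  proof (rule that[of "2 * \<bar>M\<bar> + 2 * nn 3 g"])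
    fix t assume t: "t \<in> {t0..t1}"
    show "sob 3 (u t - g)" by (intro sob_diff s t g)
    have "nn 3 (u t - g) \<le> 2 * nn 3 (u t) + 2 * nn 3 g" by (intro nn_diff s t g)
    then show "nn 3 (u t - g) \<le> 2 * \<bar>M\<bar> + 2 * nn 3 g" using M[OF t] by linarith
  qed simp
qed

lemma Qop_norm_bound:
  assumes "kap \<ge> 0" "N \<ge> 0"
  obtains M where "\<And>w :: 'n l2. sob 2 w \<Longrightarrow> nn 2 w \<le> N \<Longrightarrow> norm (Qop (bk kap) w) \<le> M"
proof -
  obtain CQ where CQ: "CQ \<ge> 0" "\<And>w :: 'n l2. sob 2 w \<Longrightarrow> (norm (Qop (bk kap) w))\<^sup>2 \<le> CQ * (1 + kap)\<^sup>2 * nn 2 w"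
    using Qop_bk assms(1) by metis
  show ?thesis
  proof (rule that[of "sqrt (CQ * (1 + kap)\<^sup>2 * N)"])
    fix w :: "'n l2" assume w: "sob 2 w" "nn 2 w \<le> N"
    have "(norm (Qop (bk kap) w))\<^sup>2 \<le> CQ * (1 + kap)\<^sup>2 * N"
      using CQ(2)[OF w(1)] mult_left_mono[OF w(2), of "CQ * (1 + kap)\<^sup>2"] CQ(1) by simp
    then show "norm (Qop (bk kap) w) \<le> sqrt (CQ * (1 + kap)\<^sup>2 * N)" by (rule real_le_rsqrt)
  qed
qed

text \<open>Purely qualitative. The bound \<open>M\<close> on \<open>Qop\<close> depends on the
  strength and on the particular solution, but it only licenses the differentiation of the
  energies.\<close>

lemma Ftot_regularity:
  assumes k: "kap \<ge> 0" and W: "wave_on a (bk kap) t0 t1 u v" and g: "sob 3 g"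
  shows "lipr {t0..t1} (\<lambda>t. Ftot kap (u t - g) (v t))"
    and "AE t in lborel. t \<in> {t0<..<t1} \<longrightarrow>
      ((\<lambda>t. Ftot kap (u t - g) (v t)) has_real_derivative Fder kap (u t - g) (v t) (mul a (Qop (bk kap) (u t)))) (at t)"
proof -
  obtain N where N: "N \<ge> 0" "\<And>t. t \<in> {t0..t1} \<Longrightarrow> sob 3 (u t - g)" "\<And>t. t \<in> {t0..t1} \<Longrightarrow> nn 3 (u t - g) \<le> N"
    using wave_on_bounds[OF W g] by metis
  obtain M where M: "\<And>w. sob 2 w \<Longrightarrow> nn 2 w \<le> N \<Longrightarrow> norm (Qop (bk kap) w) \<le> M"
    using Qop_norm_bound[OF k N(1)] by metis
  have u3: "sob 3 (u t)" if "t \<in> {t0..t1}" for t using W that unfolding wave_on_def by blast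
  have ev0: "sob 2 (u t - g) \<and> norm (Qop (bk kap) (u t - g)) \<le> M" if "t \<in> {t0..t1}" for t
    using sob_3_imp(1)[OF N(2)[OF that]] nn_mono[of 2 3 "u t - g"] N(3)[OF that] M[of "u t - g"] by simp
  have evk: "sob 2 (dd i (u t - g)) \<and> norm (Qop (bk kap) (dd i (u t - g))) \<le> M" if "t \<in> {t0..t1}" for t i
    using sob_3_imp(3)[OF N(2)[OF that]] nn_dd_le_num(1)[of i "u t - g"] N(3)[OF that] M[of "dd i (u t - g)"] by simp
  have ddeq: "dd i (u t - g) = dd i (u t) - dd i g" if "t \<in> {t0..t1}" for t i
    using sob_3_imp(2)[OF u3[OF that]] sob_3_imp(2)[OF g] by (intro dd_diff) simp_all
  have L: "lipr {t0..t1} u" "lipr {t0..t1} v" "\<And>i. lipr {t0..t1} (\<lambda>t. dd i (u t))" "\<And>i. lipr {t0..t1} (\<lambda>t. dd i (v t))"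
    using W unfolding wave_on_def by blast+
  have Lw: "lipr {t0..t1} (\<lambda>t. u t - g)" 
    using lipr_add[OF L(1) lipr_const[of _ "- g"]] by simp
  have Lwi: "lipr {t0..t1} (\<lambda>t. dd i (u t - g))" for i
    using lipr_add[OF L(3)[of i] lipr_const[of _ "- dd i g"]] by (subst lipr_cong[OF ddeq]) simp_all
  show "lipr {t0..t1} (\<lambda>t. Ftot kap (u t - g) (v t))"
    unfolding Ftot_def
    by (intro lipr_add lipr_norm_sq lipr_sum Lw lipr_Een[OF smooth_bk mbdd_al ev0 Lw L(2)]
        lipr_Een[OF smooth_bk mbdd_al evk Lwi L(4)]) simp_all
  have hd: "(u has_vector_derivative v t) (at t)" "((\<lambda>s. dd i (u s)) has_vector_derivative dd i (v t)) (at t)"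
    if "t \<in> {t0<..<t1}" for t i using W that unfolding wave_on_def by blast+
  have ae: "AE t in lborel. t \<in> {t0<..<t1} \<longrightarrow> (\<exists>z. sob 1 z \<and> (v has_vector_derivative z) (at t) \<and>
       (\<forall>i. ((\<lambda>s. dd i (v s)) has_vector_derivative dd i z) (at t)) \<and> z = mul a (Qop (bk kap) (u t)))"
    using W unfolding wave_on_def by blast
  then show "AE t in lborel. t \<in> {t0<..<t1} \<longrightarrow>
      ((\<lambda>t. Ftot kap (u t - g) (v t)) has_real_derivative Fder kap (u t - g) (v t) (mul a (Qop (bk kap) (u t)))) (at t)"
  proof eventually_elim
    case (elim t)
    show ?case
    proof
      assume t: "t \<in> {t0<..<t1}"
      define z where "z = mul a (Qop (bk kap) (u t))"
      have z: "(v has_vector_derivative z) (at t)" "\<And>i. ((\<lambda>s. dd i (v s)) has_vector_derivative dd i z) (at t)"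
        using elim t by (auto simp: z_def)
      have w: "((\<lambda>s. u s - g) has_vector_derivative v t) (at t)"
        using has_vector_derivative_diff[OF hd(1)[OF t] has_vector_derivative_const[of g]] by simp
      have wi: "((\<lambda>s. dd i (u s - g)) has_vector_derivative dd i (v t)) (at t)" for i
      proof (rule has_vector_derivative_transform_within_open[of "\<lambda>s. dd i (u s) - dd i g"])
        show "((\<lambda>s. dd i (u s) - dd i g) has_vector_derivative dd i (v t)) (at t)"
          using has_vector_derivative_diff[OF hd(2)[OF t, of i] has_vector_derivative_const[of "dd i g"]] by simp
        show "dd i (u s) - dd i g = dd i (u s - g)" if "s \<in> {t0<..<t1}" for s
          using ddeq[of s i] that by simp
      qed (use t in auto)
      show "((\<lambda>t. Ftot kap (u t - g) (v t)) has_real_derivative Fder kap (u t - g) (v t) (mul a (Qop (bk kap) (u t)))) (at t)"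
        unfolding Ftot_def Fder_def z_def[symmetric]
        by (intro DERIV_add DERIV_sum norm_sq_has_derivative w Een_has_derivative[OF smooth_bk mbdd_al ev0 t w z(1)]
            Een_has_derivative[OF smooth_bk mbdd_al evk t wi z(2)])
    qed
  qed
qed

text \<open>Gronwall's inequality for \<open>Ftot\<close>. The duration enters only through
  \<open>(1 + kap) * (t1 - t0)\<close>, and outside the exponential the strength multiplies nothing
  but the initial distance to \<open>g\<close>. Free evolution is the case \<open>kap = 0\<close>
  and \<open>g = 0\<close>.\<close>

lemma level1_estimate: "\<exists>C\<ge>0. \<forall>kap t0 t1 u v g. kap \<ge> 0 \<longrightarrow> t0 \<le> t1 \<longrightarrow> wave_on a (bk kap) t0 t1 u v \<longrightarrow> sob 3 g \<longrightarrow>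
   nn 2 (u t1 - g) + nn 1 (v t1) \<le> C * exp (C * ((1 + kap) * (t1 - t0))) * ((1 + kap) * nn 2 (u t0 - g) + nn 1 (v t0) + nn 3 g)"
proof -
  obtain C1 where C1: "C1 \<ge> 0" "\<And>kap U g y. kap \<ge> 0 \<Longrightarrow> sob 3 U \<Longrightarrow> sob 3 g \<Longrightarrow>
     Fder kap (U - g) y (mul a (Qop (bk kap) U)) \<le> C1 * (1 + kap) * (nn 2 (U - g) + nn 1 y + nn 3 g)"
    using Fder_bound by blast
  obtain C2 where C2: "C2 \<ge> 0" "\<And>kap w y. kap \<ge> 0 \<Longrightarrow> Ftot kap w y \<le> C2 * (1 + kap) * nn 2 w + C2 * nn 1 y"
    using Ftot_upper by blast
  obtain c where c: "c > 0" "\<And>kap w y. kap \<ge> 0 \<Longrightarrow> c * (nn 2 w + nn 1 y) \<le> Ftot kap w y"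
    using Ftot_lower by blast
  \<comment> \<open>Large enough for the prefactor \<open>(C1 + C2) / c\<close> and for the exponent
    \<open>C1 / c + 1\<close>. The extra 1 in the exponent pays for replacing \<open>r\<close> by
    \<open>exp r\<close>, both for the forcing and for the initial value.\<close>
  define C where "C = (C1 + C2) / c + (C1 / c + 1)"
  have C0: "C \<ge> 0" "C1 / c + 1 \<le> C" "(C1 + C2) / c \<le> C" using C1 C2 c by (simp_all add: C_def)
  have "nn 2 (u t1 - g) + nn 1 (v t1) \<le> C * exp (C * ((1 + kap) * (t1 - t0))) * ((1 + kap) * nn 2 (u t0 - g) + nn 1 (v t0) + nn 3 g)"
    if k: "kap \<ge> 0" and t01: "t0 \<le> t1" and W: "wave_on a (bk kap) t0 t1 u v" and g: "sob 3 g" for kap t0 t1 u v g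
  proof -
    define F where "F t = Ftot kap (u t - g) (v t)" for t
    define K where "K = C1 * (1 + kap) * nn 3 g"
    define lam where "lam = C1 / c * (1 + kap)"
    define r where "r = (1 + kap) * (t1 - t0)"
    define X where "X = (1 + kap) * nn 2 (u t0 - g) + nn 1 (v t0) + nn 3 g"
    have r0: "r \<ge> 0" using k t01 by (simp add: r_def)
    have lam0: "lam \<ge> 0" using C1 c k by (simp add: lam_def)
    have K0: "K \<ge> 0" using C1 k by (simp add: K_def)
    have u3: "sob 3 (u t)" if "t \<in> {t0..t1}" for t using W that unfolding wave_on_def by blast
    have Dle: "Fder kap (u t - g) (v t) (mul a (Qop (bk kap) (u t))) \<le> lam * F t + K * exp (lam * (t - t0))"
      if t: "t \<in> {t0<..<t1}" for t
    proof -
      have "Fder kap (u t - g) (v t) (mul a (Qop (bk kap) (u t))) \<le> C1 * (1 + kap) * (nn 2 (u t - g) + nn 1 (v t) + nn 3 g)"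
        using t by (intro C1(2) k u3 g) auto
      also have "\<dots> = C1 / c * (1 + kap) * (c * (nn 2 (u t - g) + nn 1 (v t))) + K * 1"
        using c(1) by (simp add: K_def field_simps)
      also have "\<dots> \<le> lam * F t + K * exp (lam * (t - t0))"
        unfolding lam_def[symmetric] F_def using lam0 K0 t c(2)[OF k]
        by (intro add_mono mult_left_mono) auto
      finally show ?thesis .
    qed
    have "F t1 \<le> exp (lam * (t1 - t0)) * (F t0 + K * (t1 - t0))"
    proof (rule gronwall_lipr[OF t01 lam0])
      show "lipr {t0..t1} F" unfolding F_def[abs_def] by (rule Ftot_regularity(1)[OF k W g])
      show "AE t in lborel. t \<in> {t0<..<t1} \<longrightarrow> (\<exists>D. (F has_real_derivative D) (at t) \<and> D \<le> lam * F t + K * exp (lam * (t - t0)))"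
        using Ftot_regularity(2)[OF k W g] by eventually_elim (use Dle in \<open>auto simp: F_def[abs_def]\<close>)
    qed
    also have "\<dots> \<le> exp (C1 / c * r) * ((C1 + C2) * exp r * X)"
    proof -
      have "F t0 \<le> C2 * (1 + kap) * nn 2 (u t0 - g) + C2 * nn 1 (v t0)" unfolding F_def by (rule C2(2)[OF k])
      also have "\<dots> = C2 * ((1 + kap) * nn 2 (u t0 - g) + nn 1 (v t0))" by (simp add: algebra_simps)
      also have "\<dots> \<le> C2 * X" using C2(1) by (intro mult_left_mono) (simp_all add: X_def)
      also have "\<dots> \<le> C2 * exp r * X"
      proof -
        have "X \<ge> 0" using k by (simp add: X_def)
        then have "C2 * X * 1 \<le> C2 * X * exp r" using C2(1) r0 by (intro mult_left_mono) auto
        then show ?thesis by (simp add: mult_ac)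
      qed
      finally have 1: "F t0 \<le> C2 * exp r * X" .
      have "K * (t1 - t0) = C1 * r * nn 3 g" by (simp add: K_def r_def)
      also have "\<dots> \<le> C1 * exp r * X"
      proof (intro mult_mono)
        show "r \<le> exp r" using exp_ge_add_one_self[of r] by linarith
        show "nn 3 g \<le> X" using k by (simp add: X_def)
      qed (use C1 r0 in auto)
      finally have "F t0 + K * (t1 - t0) \<le> (C1 + C2) * exp r * X" using 1 by (simp add: distrib_right)
      moreover have "lam * (t1 - t0) = C1 / c * r" by (simp add: lam_def r_def)
      ultimately show ?thesis by (simp add: mult_left_mono)
    qed
    also have "\<dots> = (C1 + C2) * exp ((C1 / c + 1) * r) * X"
    proof -
      have "(C1 / c + 1) * r = C1 / c * r + r" by (simp add: distrib_right)
      then show ?thesis by (simp only: exp_add mult_ac)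
    qed
    finally have Fle: "F t1 \<le> (C1 + C2) * exp ((C1 / c + 1) * r) * X" .
    have X0: "X \<ge> 0" using k by (simp add: X_def)
    have "c * (nn 2 (u t1 - g) + nn 1 (v t1)) \<le> (C1 + C2) * exp ((C1 / c + 1) * r) * X"
      using c(2)[OF k, of "u t1 - g" "v t1"] Fle by (simp add: F_def)
    then have "nn 2 (u t1 - g) + nn 1 (v t1) \<le> (C1 + C2) / c * exp ((C1 / c + 1) * r) * X"
      using c(1) by (simp add: field_simps)
    also have "\<dots> \<le> C * exp (C * r) * X"
    proof -
      have "(C1 / c + 1) * r \<le> C * r" using C0 r0 by (intro mult_right_mono)
      then show ?thesis using C0 X0 by (intro mult_right_mono mult_mono) auto
    qed
    finally show ?thesis by (simp add: r_def X_def)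
  qed
  then show ?thesis using C0(1) by blast
qed

end

section \<open>Second-order energy estimate for the unperturbed equation\<close>

text \<open>For fixed \<open>h\<close> a bounded operator that preserves every \<open>sob k\<close>,
  so it commutes with differentiation in time and needs no further regularity of the solution. For
  \<open>h = 0\<close> it is the zero operator, since the inverse of 0 is 0.\<close>

definition Dq :: "'n::finite \<Rightarrow> real \<Rightarrow> 'n l2 \<Rightarrow> 'n l2" where
  "Dq j h f = (tau (h *\<^sub>R axis j 1) f - f) /\<^sub>R h"

lemma bounded_linear_Dq: "bounded_linear (Dq j h)"
  unfolding Dq_def[abs_def]
  by (intro bounded_linear_intros bounded_linear_tau bounded_linear_compose[OF bounded_linear_scaleR_right])

lemmas linear_Dq = bounded_linear.linear[OF bounded_linear_Dq]

lemma sob_Dq: "sob k f \<Longrightarrow> sob k (Dq j h f)"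
  unfolding Dq_def by (intro sob_scale sob_diff sob_tau)

lemma dd_Dq: "sob 1 f \<Longrightarrow> dd i (Dq j h f) = Dq j h (dd i f)"
  unfolding Dq_def One_nat_def
  by (simp only: dd_scale dd_diff dd_tau sob_scale sob_diff sob_tau)

lemma norm_Dq_le: assumes "sob 1 f" shows "norm (Dq j h f) \<le> norm (dd j f)"
proof (cases "h = 0")
  case False
  have "isd j f (dd j f)" using assms sob_isd by (metis One_nat_def)
  from mult_left_mono[OF norm_tau_diff_le[OF this, of h], of "inverse \<bar>h\<bar>"] False show ?thesis
    by (simp add: Dq_def mult.assoc[symmetric])
qed (simp add: Dq_def)

lemma Dq_tendsto: assumes "sob 1 f" shows "((\<lambda>h. Dq j h f) \<longlongrightarrow> dd j f) (at 0)"
  using assms sob_isd[of 0 f j] unfolding isd_def Dq_def by simp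

text \<open>This bound degenerates as \<open>h\<close> tends to 0. It serves only to make the
  energies of difference quotients differentiable for each fixed \<open>h\<close>.\<close>

lemma nn_Dq_le: assumes "sob k f" shows "nn k (Dq j h f) \<le> (inverse h)\<^sup>2 * (4 * nn k f)"
proof -
  have "nn k (tau (h *\<^sub>R axis j 1) f - f) \<le> 2 * nn k (tau (h *\<^sub>R axis j 1) f) + 2 * nn k f"
    by (intro nn_diff sob_tau assms)
  then have "nn k (tau (h *\<^sub>R axis j 1) f - f) \<le> 4 * nn k f"
    using nn_tau[OF assms, of "h *\<^sub>R axis j 1"] by simp
  then show ?thesis
    unfolding Dq_def using nn_scale[OF sob_diff[OF sob_tau[OF assms] assms]]
    by (simp add: mult_left_mono del: mult_le_cancel_left_pos)
qed

text \<open>The commutator is a translation followed by multiplication with the difference quotient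
  of \<open>m\<close>, which is bounded by the derivative of \<open>m\<close> for every
  \<open>h\<close>.\<close>

lemma Dq_mul_commutator:
  fixes m :: "real^'n::finite \<Rightarrow> real"
  assumes m: "smooth_bdd m"
  shows "\<exists>K\<ge>0. \<forall>h f. norm (Dq j h (mul m f) - mul m (Dq j h f)) \<le> K * norm f"
proof -
  obtain K0 where K0: "mbdd m K0" using smooth_bdd_mbdd[OF m] .
  obtain K where K: "mbdd (pdx j m) K" using smooth_bdd_mbdd[OF smooth_bdd_pdx[OF m]] .
  have "norm (Dq j h (mul m f) - mul m (Dq j h f)) \<le> K * norm f" for h f
  proof (cases "h = 0")
    case True
    then show ?thesis using mbdd_nonneg[OF K] linear_0[OF linear_mul[OF K0]] by (simp add: Dq_def)
  next
    case False
    let ?e = "axis j 1 :: real^'n"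
    define q where "q x = inverse h * (m (x + h *\<^sub>R ?e) - m x)" for x
    have d: "m differentiable (at x)" for x using m by (auto simp: smooth_bdd_def intro: smooth_differentiable)
    have "\<bar>q x\<bar> \<le> K" for x
    proof -
      have "norm (m (x + h *\<^sub>R ?e) - m (x + 0 *\<^sub>R ?e)) \<le> K * norm (h - 0)"
        by (rule field_differentiable_bound[of UNIV "\<lambda>h. m (x + h *\<^sub>R ?e)"])
          (use pdx_line[OF d] K in \<open>auto simp: mbdd_def\<close>)
      then show ?thesis using False by (simp add: q_def abs_mult field_simps)
    qed
    moreover have "mbdd q (\<bar>inverse h\<bar> * (K0 + K0))"
      unfolding q_def by (intro mbdd_scale mbdd_diff mbdd_shift K0)
    ultimately have q: "mbdd q K" by (simp add: mbdd_def)
    have "Dq j h (mul m f) - mul m (Dq j h f) = mul q (tau (h *\<^sub>R ?e) f)"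
      unfolding q_def mul_scale_left[OF mbdd_diff[OF mbdd_shift[OF K0] K0]] mul_diff_left[OF mbdd_shift[OF K0] K0]
      by (simp add: Dq_def tau_mul[OF K0] linear_scale[OF linear_mul[OF K0]] linear_diff[OF linear_mul[OF K0]] scaleR_diff_right)
    then show ?thesis using norm_mul_le[OF q, of "tau (h *\<^sub>R ?e) f"] by simp
  qed
  then show ?thesis using mbdd_nonneg[OF K] by blast
qed

lemma norm_le_sqrt_nn: "norm f \<le> sqrt (nn k f)"
  by (rule real_le_rsqrt[OF norm_le_nn])

text \<open>Derivatives commute with difference quotients, so only the coefficients contribute. What
  is left is of second order in \<open>g\<close>, uniformly in \<open>h\<close>.\<close>

lemma Dq_Qop_commutator:
  fixes m :: "real^'n::finite \<Rightarrow> real"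
  assumes m: "smooth_bdd m"
  shows "\<exists>C\<ge>0. \<forall>h g. sob 2 g \<longrightarrow> (norm (Dq j h (Qop m g) - Qop m (Dq j h g)))\<^sup>2 \<le> C * nn 2 g"
proof -
  obtain K where K: "K \<ge> 0" "\<And>h f. norm (Dq j h (mul m f) - mul m (Dq j h f)) \<le> K * norm f"
    using Dq_mul_commutator[OF m] by blast
  have "\<forall>i. \<exists>K\<ge>0. \<forall>h f. norm (Dq j h (mul (pdx i m) f) - mul (pdx i m) (Dq j h f)) \<le> K * norm f"
    using Dq_mul_commutator[OF smooth_bdd_pdx[OF m]] by blast
  then obtain Ki where Ki: "\<And>i. Ki i \<ge> 0" "\<And>i h f. norm (Dq j h (mul (pdx i m) f) - mul (pdx i m) (Dq j h f)) \<le> Ki i * norm f"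
    by metis
  define S where "S = (\<Sum>i\<in>UNIV. K + Ki i)"
  have "(norm (Dq j h (Qop m g) - Qop m (Dq j h g)))\<^sup>2 \<le> S\<^sup>2 * nn 2 g" if g: "sob 2 g" for h g
  proof -
    note g' = sob_2_imp[OF g]
    let ?T = "\<lambda>i. (Dq j h (mul m (dd i (dd i g))) - mul m (Dq j h (dd i (dd i g)))) + (Dq j h (mul (pdx i m) (dd i g)) - mul (pdx i m) (Dq j h (dd i g)))"
    have "Dq j h (Qop m g) - Qop m (Dq j h g) = (\<Sum>i\<in>UNIV. ?T i)"
      unfolding Qop_def
      by (simp add: linear_sum[OF linear_Dq] linear_add[OF linear_Dq] dd_Dq[OF g'(1)] dd_Dq[OF g'(2)] sum_subtractf[symmetric] algebra_simps)
    also have "norm \<dots> \<le> (\<Sum>i\<in>UNIV. (K + Ki i) * sqrt (nn 2 g))"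
    proof (rule sum_norm_le)
      fix i
      have "norm (?T i) \<le> K * norm (dd i (dd i g)) + Ki i * norm (dd i g)"
        by (intro norm_triangle_mono K(2) Ki(2))
      also have "\<dots> \<le> K * sqrt (nn 2 g) + Ki i * sqrt (nn 2 g)"
      proof -
        have "norm (dd i (dd i g)) \<le> sqrt (nn 2 g)"
          using nn_dd_le_num(3)[of i "dd i g"] nn_dd_le_num(2)[of i g] by (intro real_le_rsqrt) linarith
        moreover have "norm (dd i g) \<le> sqrt (nn 2 g)"
          using norm_le_nn[of "dd i g" 1] nn_dd_le_num(2)[of i g] by (intro real_le_rsqrt) linarith
        ultimately show ?thesis using K Ki by (intro add_mono mult_left_mono) auto
      qed
      finally show "norm (?T i) \<le> (K + Ki i) * sqrt (nn 2 g)" by (simp add: distrib_right)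
    qed
    also have "\<dots> = S * sqrt (nn 2 g)" by (simp add: S_def sum_distrib_right)
    finally have "(norm (Dq j h (Qop m g) - Qop m (Dq j h g)))\<^sup>2 \<le> (S * sqrt (nn 2 g))\<^sup>2"
      by (intro power_mono) auto
    then show ?thesis by (simp add: power_mult_distrib)
  qed
  then show ?thesis by (intro exI[of _ "S\<^sup>2"]) simp
qed

context wave_coeffs
begin

text \<open>Counting a difference quotient as a derivative, the terms of order four cancel. The
  remaining commutators, with the coefficients in \<open>Qop\<close> and with \<open>a\<close>, are
  of order three and bounded uniformly in \<open>h\<close>.\<close>

lemma level2_residual_jk:
  "\<exists>C\<ge>0. \<forall>h U. sob 3 U \<longrightarrow> (norm (mul al (Dq j h (dd k (mul a (Qop b U)))) - Qop b (Dq j h (dd k U))))\<^sup>2 \<le> C * nn 3 U"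
proof -
  obtain Ka where Ka: "Ka \<ge> 0" "\<And>h f. norm (Dq j h (mul a f) - mul a (Dq j h f)) \<le> Ka * norm f"
    using Dq_mul_commutator[OF smooth_a] by blast
  obtain C1 where C1: "C1 \<ge> 0" "\<And>h g. sob 2 g \<Longrightarrow> (norm (Dq j h (Qop b g) - Qop b (Dq j h g)))\<^sup>2 \<le> C1 * nn 2 g"
    using Dq_Qop_commutator[OF smooth_b] by blast
  obtain C2 where C2: "C2 \<ge> 0" "\<And>w. sob 2 w \<Longrightarrow> (norm (Qop b w))\<^sup>2 \<le> C2 * nn 2 w"
    using Qop_nn[OF smooth_b, of 0] by (auto simp del: add_2_eq_Suc add_2_eq_Suc')
  have e3: "1 + 2 = (3::nat)" by simp
  obtain C3 where C3: "C3 \<ge> 0" "\<And>w. sob 3 w \<Longrightarrow> nn 1 (Qop b w) \<le> C3 * nn 3 w"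
    using Qop_nn[OF smooth_b, of 1] unfolding e3 by blast
  obtain C4 where C4: "C4 \<ge> 0" "\<And>w. sob 3 w \<Longrightarrow> nn 1 (Qop (pdx k b) w) \<le> C4 * nn 3 w"
    using Qop_nn[OF smooth_bdd_pdx[OF smooth_b], of 1] unfolding e3 by blast
  obtain C5 where C5: "C5 \<ge> 0" "\<And>w. sob 1 w \<Longrightarrow> nn 1 (mul a w) \<le> C5 * nn 1 w"
    using nn_mul[OF smooth_a, of 1] by blast
  obtain C6 where C6: "C6 \<ge> 0" "\<And>w. sob 1 w \<Longrightarrow> nn 1 (mul (pdx k a) w) \<le> C6 * nn 1 w"
    using nn_mul[OF smooth_bdd_pdx[OF smooth_a], of 1] by blast
  define Kal where "Kal = 1 / a_lo"
  have Kal0: "Kal \<ge> 0" using a_lo by (simp add: Kal_def)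
  define C where "C = 2 * C1 + 4 * ((Kal * Ka)\<^sup>2 * C2) + 4 * (Kal\<^sup>2 * (2 * (C5 * C4) + 2 * (C6 * C3)))"
  have "(norm (mul al (Dq j h (dd k (mul a (Qop b U)))) - Qop b (Dq j h (dd k U))))\<^sup>2 \<le> C * nn 3 U" if U: "sob 3 U" for h U
  proof -
    note U' = sob_3_imp[OF U]
    have sQ: "sob 1 (Qop b U)" "sob 1 (Qop (pdx k b) U)"
      using sob_Qop[of _ 1 U] U smooth_b smooth_bdd_pdx[OF smooth_b] unfolding e3 by blast+
    \<comment> \<open>Collects what the derivative in direction \<open>k\<close> produces on the
      coefficients. It lies in H^1, so its difference quotient is bounded by its gradient, whatever
      the step.\<close>
    define R where "R = mul a (Qop (pdx k b) U) + mul (pdx k a) (Qop b U)"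
    have sR: "sob 1 R" unfolding R_def by (intro sob_add sob_mul sQ smooth_a smooth_bdd_pdx)
    let ?g = "dd k U"
    obtain Kam where Kam: "mbdd a Kam" by (rule smooth_bdd_mbdd[OF smooth_a])
    have "dd k (mul a (Qop b U)) = mul a (dd k (Qop b U)) + mul (pdx k a) (Qop b U)"
      using sQ(1) by (intro dd_mul smooth_a) simp
    then have z: "dd k (mul a (Qop b U)) = mul a (Qop b ?g) + R"
      by (simp add: dd_Qop[OF smooth_b U] linear_add[OF linear_mul[OF Kam]] R_def)
    let ?A = "Dq j h (Qop b ?g) - Qop b (Dq j h ?g)"
    let ?B = "mul al (Dq j h (mul a (Qop b ?g)) - mul a (Dq j h (Qop b ?g)))"
    let ?C = "mul al (Dq j h R)"
    have "mul al (Dq j h (dd k (mul a (Qop b U)))) - Qop b (Dq j h ?g) = ?A + (?B + ?C)"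
      unfolding z by (simp add: linear_add[OF linear_Dq] linear_add[OF linear_mul[OF mbdd_al]] linear_diff[OF linear_mul[OF mbdd_al]] mul_al_a)
    moreover have A: "(norm ?A)\<^sup>2 \<le> C1 * nn 3 U"
      using C1(2)[OF U'(3)[of k], of h] mult_left_mono[OF nn_dd_le_num(1)[of k U] C1(1)] by linarith
    moreover have "(norm ?B)\<^sup>2 \<le> (Kal * Ka)\<^sup>2 * C2 * nn 3 U"
    proof -
      have "norm ?B \<le> Kal * (Ka * norm (Qop b ?g))"
        unfolding Kal_def by (intro order_trans[OF norm_mul_le[OF mbdd_al]] mult_left_mono Ka(2)) (use a_lo in simp)
      then have "(norm ?B)\<^sup>2 \<le> (Kal * (Ka * norm (Qop b ?g)))\<^sup>2" by (intro power_mono) auto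
      also have "\<dots> = (Kal * Ka)\<^sup>2 * (norm (Qop b ?g))\<^sup>2" by (simp add: power_mult_distrib)
      also have "\<dots> \<le> (Kal * Ka)\<^sup>2 * (C2 * nn 3 U)"
        using C2(2)[OF U'(3)[of k]] mult_left_mono[OF nn_dd_le_num(1)[of k U] C2(1)] by (intro mult_left_mono) auto
      finally show ?thesis by (simp add: mult.assoc)
    qed
    moreover have "(norm ?C)\<^sup>2 \<le> Kal\<^sup>2 * (2 * (C5 * C4) + 2 * (C6 * C3)) * nn 3 U"
    proof -
      have "norm ?C \<le> Kal * norm (dd j R)"
        unfolding Kal_def by (intro order_trans[OF norm_mul_le[OF mbdd_al]] mult_left_mono norm_Dq_le sR) (use a_lo in simp)
      then have "(norm ?C)\<^sup>2 \<le> (Kal * norm (dd j R))\<^sup>2" by (intro power_mono) auto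
      also have "\<dots> = Kal\<^sup>2 * (norm (dd j R))\<^sup>2" by (simp add: power_mult_distrib)
      also have "\<dots> \<le> Kal\<^sup>2 * ((2 * (C5 * C4) + 2 * (C6 * C3)) * nn 3 U)"
      proof (rule mult_left_mono)
        have "(norm (dd j R))\<^sup>2 \<le> nn 1 R" by (rule nn_dd_le_num(3))
        also have "\<dots> \<le> 2 * nn 1 (mul a (Qop (pdx k b) U)) + 2 * nn 1 (mul (pdx k a) (Qop b U))"
          unfolding R_def by (intro nn_add sob_mul sQ smooth_a smooth_bdd_pdx)
        also have "\<dots> \<le> 2 * (C5 * (C4 * nn 3 U)) + 2 * (C6 * (C3 * nn 3 U))"
        proof -
          have "nn 1 (mul a (Qop (pdx k b) U)) \<le> C5 * (C4 * nn 3 U)"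
            using C5(2)[OF sQ(2)] mult_left_mono[OF C4(2)[OF U] C5(1)] by linarith
          moreover have "nn 1 (mul (pdx k a) (Qop b U)) \<le> C6 * (C3 * nn 3 U)"
            using C6(2)[OF sQ(1)] mult_left_mono[OF C3(2)[OF U] C6(1)] by linarith
          ultimately show ?thesis by linarith
        qed
        finally show "(norm (dd j R))\<^sup>2 \<le> (2 * (C5 * C4) + 2 * (C6 * C3)) * nn 3 U" by (simp add: algebra_simps)
      qed simp
      finally show ?thesis by (simp add: mult.assoc)
    qed
    moreover have "(norm (?A + (?B + ?C)))\<^sup>2 \<le> 2 * (norm ?A)\<^sup>2 + 4 * (norm ?B)\<^sup>2 + 4 * (norm ?C)\<^sup>2"
      using norm_add_sq[of ?A "?B + ?C"] norm_add_sq[of ?B ?C] by linarith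
    ultimately have "(norm (mul al (Dq j h (dd k (mul a (Qop b U)))) - Qop b (Dq j h ?g)))\<^sup>2
      \<le> 2 * (C1 * nn 3 U) + 4 * ((Kal * Ka)\<^sup>2 * C2 * nn 3 U) + 4 * (Kal\<^sup>2 * (2 * (C5 * C4) + 2 * (C6 * C3)) * nn 3 U)"
      by (simp only:)
    then show ?thesis by (simp add: C_def algebra_simps)
  qed
  moreover have "C \<ge> 0" using C1 C2 C3 C4 C5 C6 by (simp add: C_def)
  ultimately show ?thesis by blast
qed

lemma level2_residual:
  "\<exists>C\<ge>0. \<forall>j k h U. sob 3 U \<longrightarrow> (norm (mul al (Dq j h (dd k (mul a (Qop b U)))) - Qop b (Dq j h (dd k U))))\<^sup>2 \<le> C * nn 3 U"
proof -
  obtain C where C: "\<And>j k. C j k \<ge> 0"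
    "\<And>j k h U. sob 3 U \<Longrightarrow> (norm (mul al (Dq j h (dd k (mul a (Qop b U)))) - Qop b (Dq j h (dd k U))))\<^sup>2 \<le> C j k * nn 3 U"
    using level2_residual_jk by metis
  have le: "C j k \<le> (\<Sum>j\<in>UNIV. \<Sum>k\<in>UNIV. C j k)" for j k
  proof -
    have "C j k \<le> (\<Sum>k\<in>UNIV. C j k)" using C(1) by (intro member_le_sum) auto
    also have "\<dots> \<le> (\<Sum>j\<in>UNIV. \<Sum>k\<in>UNIV. C j k)" using C(1) by (intro member_le_sum[where f = "\<lambda>j. \<Sum>k\<in>UNIV. C j k"] sum_nonneg) auto
    finally show ?thesis .
  qed
  show ?thesis
  proof (intro exI conjI allI impI)
    show "0 \<le> (\<Sum>j\<in>UNIV. \<Sum>k\<in>UNIV. C j k)" using C(1) by (intro sum_nonneg) auto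
    fix j k h and U :: "'n l2" assume U: "sob 3 U"
    show "(norm (mul al (Dq j h (dd k (mul a (Qop b U)))) - Qop b (Dq j h (dd k U))))\<^sup>2 \<le> (\<Sum>j\<in>UNIV. \<Sum>k\<in>UNIV. C j k) * nn 3 U"
      using C(2)[OF U, of j h k] mult_right_mono[OF le[of j k] nn_nonneg[of 3 U]] by linarith
  qed
qed

text \<open>The top derivatives are summed in the order in which they arise as limits of
  \<open>gsq (Dq j h (dd k w))\<close>.\<close>

lemma nn_3_eq:
  fixes w :: "'n l2"
  shows "nn 3 w = nn 2 w + (\<Sum>k\<in>UNIV. \<Sum>j\<in>UNIV. \<Sum>i\<in>UNIV. (norm (dd j (dd i (dd k w))))\<^sup>2)"
proof -
  have "nn 3 w = (norm w)\<^sup>2 + (\<Sum>k\<in>UNIV. nn 2 (dd k w))"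
    using nn.simps(2)[of 2 w] by (simp add: numeral_3_eq_3 numeral_2_eq_2)
  also have "\<dots> = (norm w)\<^sup>2 + gsq w + (\<Sum>k\<in>UNIV. gsq (dd k w)) + (\<Sum>k\<in>UNIV. \<Sum>i\<in>UNIV. gsq (dd i (dd k w)))"
    unfolding nn_2_eq sum.distrib by (simp add: gsq_def)
  also have "(\<Sum>k\<in>UNIV. \<Sum>i\<in>UNIV. gsq (dd i (dd k w))) = (\<Sum>k\<in>UNIV. \<Sum>j\<in>UNIV. \<Sum>i\<in>UNIV. (norm (dd j (dd i (dd k w))))\<^sup>2)"
    unfolding gsq_def by (intro sum.cong refl sum.swap)
  finally show ?thesis by (simp add: nn_2_eq)
qed

lemma gsq_Dq_le: assumes "sob 2 w" shows "gsq (Dq j h w) \<le> nn 2 w"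
proof -
  note w = sob_2_imp[OF assms]
  have "gsq (Dq j h w) \<le> (\<Sum>i\<in>UNIV. nn 1 (dd i w))"
    unfolding gsq_def dd_Dq[OF w(1)]
  proof (rule sum_mono)
    fix i
    have "(norm (Dq j h (dd i w)))\<^sup>2 \<le> (norm (dd j (dd i w)))\<^sup>2"
      by (intro power_mono norm_Dq_le w) simp
    also have "\<dots> \<le> nn 1 (dd i w)" by (rule nn_dd_le_num(3))
    finally show "(norm (Dq j h (dd i w)))\<^sup>2 \<le> nn 1 (dd i w)" .
  qed
  also have "\<dots> \<le> nn 2 w"
    using nn.simps(2)[of 1 w] by (simp add: numeral_2_eq_2)
  finally show ?thesis .
qed

lemma gsq_Dq_tendsto: assumes "sob 2 w" 
  shows "((\<lambda>h. gsq (Dq j h w)) \<longlongrightarrow> (\<Sum>i\<in>UNIV. (norm (dd j (dd i w)))\<^sup>2)) (at 0)"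
  unfolding gsq_def dd_Dq[OF sob_2_imp(1)[OF assms]]
  by (intro tendsto_sum tendsto_power tendsto_norm Dq_tendsto sob_2_imp[OF assms])

lemma bk_0: "bk 0 = b" by simp

text \<open>Two derivatives of \<open>v\<close> are available at \<open>t0\<close> only, so the
  energy is that of a difference quotient of a first derivative, and \<open>v t0\<close> enters
  through its initial value. The H^3 bound by \<open>M\<close> is a hypothesis here; what matters is
  that \<open>M\<close> comes back divided by \<open>lam\<close>.\<close>

lemma level2_energy:
  assumes W: "wave_on a b t0 t1 u v" and t01: "t0 \<le> t1" and v0: "sob 2 (v t0)"
    and lam: "lam > 0"
    and M: "M \<ge> 0" "\<And>t. t \<in> {t0..t1} \<Longrightarrow> nn 3 (u t) \<le> M * exp (lam * (t - t0))"
    and CU: "CU \<ge> 0" "\<And>w y. Een al b w y \<le> CU * (norm y)\<^sup>2 + CU * gsq w"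
    and CR: "CR \<ge> 0" "\<And>j k h U. sob 3 U \<Longrightarrow> (norm (mul al (Dq j h (dd k (mul a (Qop b U)))) - Qop b (Dq j h (dd k U))))\<^sup>2 \<le> CR * nn 3 U"
    and h: "h \<noteq> 0"
  shows "b_lo * gsq (Dq j h (dd k (u t1))) \<le> exp (lam * (t1 - t0)) * (CU * (nn 3 (u t0) + nn 2 (v t0)) + (CR * a_hi / lam * M) * (t1 - t0))"
proof -
  define w where "w t = Dq j h (dd k (u t))" for t
  define y where "y t = Dq j h (dd k (v t))" for t
  define E where "E t = Een al b (w t) (y t)" for t
  have u3: "sob 3 (u t)" "sob 1 (v t)" if "t \<in> {t0..t1}" for t using W that unfolding wave_on_def by blast+
  obtain N where N: "N \<ge> 0" "\<And>t. t \<in> {t0..t1} \<Longrightarrow> nn 3 (u t) \<le> N"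
    using wave_on_bounds[OF W sob_0] by (metis diff_zero)
  \<comment> \<open>This bound, and \<open>M'\<close> derived from it, depend on \<open>h\<close>.
    They are used for the regularity of the energy and do not reach the conclusion.\<close>
  define N' where "N' = (inverse h)\<^sup>2 * (4 * N)"
  have "N' \<ge> 0" using N by (simp add: N'_def)
  then obtain M' where M': "\<And>w. sob 2 w \<Longrightarrow> nn 2 w \<le> N' \<Longrightarrow> norm (Qop b w) \<le> M'"
    using Qop_norm_bound[of 0 N'] unfolding bk_0 by auto
  have ev: "sob 2 (w t) \<and> norm (Qop b (w t)) \<le> M'" if t: "t \<in> {t0..t1}" for t
  proof -
    have s: "sob 2 (w t)" unfolding w_def by (intro sob_Dq sob_3_imp(3) u3 t)
    have "nn 2 (w t) \<le> (inverse h)\<^sup>2 * (4 * nn 2 (dd k (u t)))"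
      unfolding w_def by (intro nn_Dq_le sob_3_imp(3) u3 t)
    also have "\<dots> \<le> N'"
      using nn_dd_le_num(1)[of k "u t"] N(2)[OF t] unfolding N'_def by (intro mult_left_mono) auto
    finally show ?thesis using M' s by blast
  qed
  have L: "lipr {t0..t1} (\<lambda>t. dd k (u t))" "lipr {t0..t1} (\<lambda>t. dd k (v t))"
    using W unfolding wave_on_def by blast+
  have Lw: "lipr {t0..t1} w" "lipr {t0..t1} y"
    unfolding w_def[abs_def] y_def[abs_def] by (intro lipr_bounded_linear[OF bounded_linear_Dq] L)+
  have wder: "(w has_vector_derivative y t) (at t)" if "t \<in> {t0<..<t1}" for t
    unfolding w_def[abs_def] y_def using W that unfolding wave_on_def
    by (intro bounded_linear.has_vector_derivative[OF bounded_linear_Dq]) blast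
  have ElE: "1 / a_hi * (norm (y t))\<^sup>2 + b_lo * gsq (w t) \<le> E t" for t
    using Een_lower[of 0 "y t" "w t"] unfolding bk_0 E_def by simp
  have "E t1 \<le> exp (lam * (t1 - t0)) * (E t0 + (CR * a_hi / lam * M) * (t1 - t0))"
  proof (rule gronwall_lipr[OF t01])
    show "lam \<ge> 0" using lam by simp
    show "lipr {t0..t1} E" unfolding E_def[abs_def] by (rule lipr_Een[OF smooth_b mbdd_al ev Lw])
    have "AE t in lborel. t \<in> {t0<..<t1} \<longrightarrow> (\<exists>z. sob 1 z \<and> (v has_vector_derivative z) (at t) \<and>
       (\<forall>i. ((\<lambda>s. dd i (v s)) has_vector_derivative dd i z) (at t)) \<and> z = mul a (Qop b (u t)))"
      using W unfolding wave_on_def by blast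
    then show "AE t in lborel. t \<in> {t0<..<t1} \<longrightarrow>
      (\<exists>D. (E has_real_derivative D) (at t) \<and> D \<le> lam * E t + CR * a_hi / lam * M * exp (lam * (t - t0)))"
    proof eventually_elim
      case (elim t)
      show ?case
      proof
        assume t: "t \<in> {t0<..<t1}"
        define z where "z = Dq j h (dd k (mul a (Qop b (u t))))"
        have "((\<lambda>s. dd k (v s)) has_vector_derivative dd k (mul a (Qop b (u t)))) (at t)" using elim t by auto
        then have yder: "(y has_vector_derivative z) (at t)"
          unfolding y_def[abs_def] z_def by (rule bounded_linear.has_vector_derivative[OF bounded_linear_Dq])
        let ?r = "mul al z - Qop b (w t)"
        have "(E has_real_derivative 2 * inner (y t) ?r) (at t)"
          unfolding E_def[abs_def] by (rule Een_has_derivative[OF smooth_b mbdd_al ev t wder[OF t] yder])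
        moreover have "2 * inner (y t) ?r \<le> lam * E t + CR * a_hi / lam * M * exp (lam * (t - t0))"
        proof -
          have tt: "t \<in> {t0..t1}" using t by simp
          \<comment> \<open>The weight \<open>lam / a_hi\<close> makes the kinetic part cost exactly
            \<open>lam\<close> times the energy and leaves the factor \<open>a_hi / lam\<close> in
            front of the squared residual.\<close>
          have "2 * inner (y t) ?r \<le> (lam / a_hi) * (norm (y t))\<^sup>2 + (norm ?r)\<^sup>2 / (lam / a_hi)"
            using lam a_hi_pos by (intro young_inner) simp
          also have "(lam / a_hi) * (norm (y t))\<^sup>2 = lam * (1 / a_hi * (norm (y t))\<^sup>2)" by simp
          also have "\<dots> \<le> lam * E t"
          proof (rule mult_left_mono)
            have "0 \<le> b_lo * gsq (w t)" using b_lo by simp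
            then show "1 / a_hi * (norm (y t))\<^sup>2 \<le> E t" using ElE[of t] by linarith
          qed (use lam in simp)
          also have "(norm ?r)\<^sup>2 / (lam / a_hi) \<le> (CR * (M * exp (lam * (t - t0)))) / (lam / a_hi)"
          proof (rule divide_right_mono)
            have "(norm ?r)\<^sup>2 \<le> CR * nn 3 (u t)" unfolding z_def w_def by (intro CR(2) u3 tt)
            also have "\<dots> \<le> CR * (M * exp (lam * (t - t0)))" by (intro mult_left_mono M(2) tt CR(1))
            finally show "(norm ?r)\<^sup>2 \<le> CR * (M * exp (lam * (t - t0)))" .
          qed (use lam a_hi_pos in simp)
          finally show ?thesis by (simp add: field_simps)
        qed
        ultimately show "\<exists>D. (E has_real_derivative D) (at t) \<and> D \<le> lam * E t + CR * a_hi / lam * M * exp (lam * (t - t0))"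
          by blast
      qed
    qed
  qed
  also have "\<dots> \<le> exp (lam * (t1 - t0)) * (CU * (nn 3 (u t0) + nn 2 (v t0)) + (CR * a_hi / lam * M) * (t1 - t0))"
  proof (intro mult_left_mono add_right_mono)
    have tt: "t0 \<in> {t0..t1}" using t01 by simp
    have "E t0 \<le> CU * (norm (y t0))\<^sup>2 + CU * gsq (w t0)" unfolding E_def by (rule CU(2))
    also have "\<dots> \<le> CU * nn 2 (v t0) + CU * nn 3 (u t0)"
    proof (intro add_mono mult_left_mono CU(1))
      have "(norm (y t0))\<^sup>2 \<le> (norm (dd j (dd k (v t0))))\<^sup>2"
        unfolding y_def by (intro power_mono norm_Dq_le sob_2_imp(2) v0) simp
      then show "(norm (y t0))\<^sup>2 \<le> nn 2 (v t0)"
        using nn_dd_le_num(3)[of j "dd k (v t0)"] nn_dd_le_num(2)[of k "v t0"] by linarith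
      show "gsq (w t0) \<le> nn 3 (u t0)"
        using gsq_Dq_le[OF sob_3_imp(3)[OF u3(1)[OF tt]], of j h k] nn_dd_le_num(1)[of k "u t0"] unfolding w_def by linarith
    qed
    finally show "E t0 \<le> CU * (nn 3 (u t0) + nn 2 (v t0))" by (simp add: distrib_left)
  qed simp
  finally show ?thesis
  proof -
    assume *: "E t1 \<le> exp (lam * (t1 - t0)) * (CU * (nn 3 (u t0) + nn 2 (v t0)) + (CR * a_hi / lam * M) * (t1 - t0))"
    have "0 \<le> 1 / a_hi * (norm (y t1))\<^sup>2" using a_hi_pos by simp
    then show ?thesis using ElE[of t1] * unfolding w_def by linarith
  qed
qed

text \<open>The residual of one pair \<open>j\<close>, \<open>k\<close> involves the full
  \<open>nn 3 (u t)\<close>, which none of the energies for fixed \<open>h\<close> controls. So the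
  supremum \<open>M\<close> of \<open>nn 3 (u t)\<close>, damped by
  \<open>exp (- (lam * (t - t0)))\<close>, is used as an unknown: it is finite by the definition of
  the class, it satisfies \<open>M \<le> A * D0 + B / lam * M\<close>, and the last term is
  absorbed.\<close>

lemma level2_estimate:
  assumes Tm: "Tm > 0"
  shows "\<exists>C\<ge>0. \<forall>t0 t1 u v. t0 \<le> t1 \<longrightarrow> t1 - t0 \<le> Tm \<longrightarrow> wave_on a b t0 t1 u v \<longrightarrow> sob 2 (v t0) \<longrightarrow>
    nn 3 (u t1) \<le> C * (nn 3 (u t0) + nn 2 (v t0))"
proof -
  obtain C1 where C1: "C1 \<ge> 0" "\<And>kap t0 t1 u v g. kap \<ge> 0 \<Longrightarrow> t0 \<le> t1 \<Longrightarrow> wave_on a (bk kap) t0 t1 u v \<Longrightarrow> sob 3 g \<Longrightarrow>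
   nn 2 (u t1 - g) + nn 1 (v t1) \<le> C1 * exp (C1 * ((1 + kap) * (t1 - t0))) * ((1 + kap) * nn 2 (u t0 - g) + nn 1 (v t0) + nn 3 g)"
    using level1_estimate by blast
  obtain CU where CU: "CU \<ge> 0" "\<And>w y. Een al b w y \<le> CU * (norm y)\<^sup>2 + CU * gsq w"
  proof -
    obtain C where C: "C \<ge> 0" "\<And>kap w y. kap \<ge> 0 \<Longrightarrow> Een al (bk kap) w y \<le> C * (norm y)\<^sup>2 + C * (1 + kap) * gsq w"
      using Een_upper by blast
    show ?thesis using C(1) C(2)[of 0] by (intro that[of C]) auto
  qed
  obtain CR where CR: "CR \<ge> 0" "\<And>j k h U. sob 3 U \<Longrightarrow> (norm (mul al (Dq j h (dd k (mul a (Qop b U)))) - Qop b (Dq j h (dd k U))))\<^sup>2 \<le> CR * nn 3 U"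
    using level2_residual by blast
  define n where "n = real CARD('n)"
  \<comment> \<open>\<open>A\<close> collects the influence of the data: the first-order estimate
    for derivatives of order at most two, and the initial energies of the \<open>n\<^sup>2\<close>
    pairs of directions. \<open>B / lam\<close> is the factor with which the supremum
    returns.\<close>
  define A where "A = C1 * exp (C1 * Tm) + n\<^sup>2 * (CU / b_lo)"
  define B where "B = n\<^sup>2 * (CR * a_hi * Tm / b_lo)"
  \<comment> \<open>Makes \<open>B / lam\<close> at most 1/2 and keeps \<open>lam\<close> positive
    even if \<open>B\<close> is 0.\<close>
  define lam where "lam = 2 * B + 1"
  have B0: "B \<ge> 0" using CR Tm a_hi_pos b_lo by (simp add: B_def)
  have A0: "A \<ge> 0" using C1 CU b_lo by (simp add: A_def)
  have lam: "lam > 0" using B0 by (simp add: lam_def)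
  have "nn 3 (u t1) \<le> (2 * A * exp (lam * Tm)) * (nn 3 (u t0) + nn 2 (v t0))"
    if t01: "t0 \<le> t1" and le: "t1 - t0 \<le> Tm" and W: "wave_on a b t0 t1 u v" and v0: "sob 2 (v t0)" for t0 t1 u v
  proof -
    define D0 where "D0 = nn 3 (u t0) + nn 2 (v t0)"
    have D00: "D0 \<ge> 0" by (simp add: D0_def)
    obtain N where N: "N \<ge> 0" "\<And>t. t \<in> {t0..t1} \<Longrightarrow> nn 3 (u t) \<le> N"
      using wave_on_bounds[OF W sob_0] by (metis diff_zero)
    define f where "f t = exp (- (lam * (t - t0))) * nn 3 (u t)" for t
    define M where "M = (SUP t\<in>{t0..t1}. f t)"
    have f0: "f t \<ge> 0" for t by (simp add: f_def)
    have bdd: "bdd_above (f ` {t0..t1})"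
    proof (rule bdd_aboveI2)
      fix t assume t: "t \<in> {t0..t1}"
      have "f t \<le> 1 * N" unfolding f_def using t lam N(2)[OF t] by (intro mult_mono) auto
      then show "f t \<le> N" by simp
    qed
    have fM: "f t \<le> M" if "t \<in> {t0..t1}" for t
      unfolding M_def by (rule cSUP_upper[OF that bdd])
    have M0: "M \<ge> 0" using fM[of t0] f0[of t0] t01 by simp
    have uM: "nn 3 (u t) \<le> M * exp (lam * (t - t0))" if "t \<in> {t0..t1}" for t
    proof -
      have e: "exp (- (lam * (t - t0))) * exp (lam * (t - t0)) = 1"
        by (subst mult.commute) (rule exp_minus_inverse)
      have "f t * exp (lam * (t - t0)) = (exp (- (lam * (t - t0))) * exp (lam * (t - t0))) * nn 3 (u t)"
        by (simp only: f_def mult_ac)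
      then have "nn 3 (u t) = f t * exp (lam * (t - t0))" by (simp only: e mult_1_left)
      then show ?thesis using fM[OF that] by (simp add: mult_right_mono)
    qed
    have key: "f t \<le> A * D0 + B / lam * M" if t: "t \<in> {t0..t1}" for t
    proof -
      have W': "wave_on a b t0 t u v" by (rule wave_on_subset[OF W]) (use t in auto)
      define e where "e = exp (lam * (t - t0))"
      have e1: "e \<ge> 1" using lam t by (simp add: e_def)
      have u3: "sob 3 (u t)" using W t unfolding wave_on_def by blast
      define Y where "Y = e * (CU * D0 + (CR * a_hi / lam * M) * Tm) / b_lo"
      \<comment> \<open>Third derivatives are reached here: the energy bound does not depend on
        \<open>h\<close> and therefore survives the limit of the difference quotients.\<close>
      have top: "(\<Sum>i\<in>UNIV. (norm (dd j (dd i (dd k (u t)))))\<^sup>2) \<le> Y" for j k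
      proof (rule tendsto_upperbound[OF gsq_Dq_tendsto])
        show "sob 2 (dd k (u t))" by (rule sob_3_imp(3)[OF u3])
        have "gsq (Dq j h (dd k (u t))) \<le> Y" if h: "h \<noteq> 0" for h
        proof -
          have "b_lo * gsq (Dq j h (dd k (u t))) \<le> exp (lam * (t - t0)) * (CU * (nn 3 (u t0) + nn 2 (v t0)) + (CR * a_hi / lam * M) * (t - t0))"
            by (rule level2_energy[OF W' _ v0 lam M0 _ CU CR h]) (use t uM in auto)
          also have "\<dots> \<le> e * (CU * D0 + (CR * a_hi / lam * M) * Tm)"
            unfolding e_def D0_def using t le CR(1) a_hi_pos lam M0
            by (intro mult_left_mono add_left_mono) auto
          finally show ?thesis using b_lo by (simp add: Y_def field_simps)
        qed
        then show "\<forall>\<^sub>F h in at 0. gsq (Dq j h (dd k (u t))) \<le> Y"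
          by (auto simp: eventually_at intro!: exI[of _ 1])
      qed simp
      have "(\<Sum>k\<in>UNIV. \<Sum>j\<in>UNIV. \<Sum>i\<in>UNIV. (norm (dd j (dd i (dd k (u t)))))\<^sup>2) \<le> (\<Sum>k\<in>(UNIV::'n set). \<Sum>j\<in>(UNIV::'n set). Y)"
        by (intro sum_mono top)
      also have "\<dots> = n\<^sup>2 * Y" by (simp add: n_def power2_eq_square)
      also have "\<dots> = e * (n\<^sup>2 * (CU / b_lo) * D0 + B / lam * M)"
        using b_lo(1) lam by (simp add: Y_def B_def field_simps)
      finally have top': "(\<Sum>k\<in>UNIV. \<Sum>j\<in>UNIV. \<Sum>i\<in>UNIV. (norm (dd j (dd i (dd k (u t)))))\<^sup>2) \<le> e * (n\<^sup>2 * (CU / b_lo) * D0 + B / lam * M)" .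
      have low: "nn 2 (u t) \<le> e * (C1 * exp (C1 * Tm) * D0)"
      proof -
        have "nn 2 (u t - 0) + nn 1 (v t) \<le> C1 * exp (C1 * ((1 + 0) * (t - t0))) * ((1 + 0) * nn 2 (u t0 - 0) + nn 1 (v t0) + nn 3 (0::'n l2))"
          by (rule C1(2)) (use t W' sob_0 in \<open>auto simp: bk_0\<close>)
        also have "\<dots> \<le> C1 * exp (C1 * Tm) * D0"
        proof (intro mult_mono)
          have "nn 2 (u t0) \<le> nn 3 (u t0)" "nn 1 (v t0) \<le> nn 2 (v t0)" by (intro nn_mono; simp)+
          then show "(1 + 0) * nn 2 (u t0 - 0) + nn 1 (v t0) + nn 3 (0::'n l2) \<le> D0" by (simp add: nn_0 D0_def)
          have "C1 * (t - t0) \<le> C1 * Tm" using C1 t le by (intro mult_left_mono) auto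
          then show "exp (C1 * ((1 + 0) * (t - t0))) \<le> exp (C1 * Tm)" by simp
        qed (use C1 in auto)
        finally have 1: "nn 2 (u t) \<le> C1 * exp (C1 * Tm) * D0" using nn_nonneg[of 1 "v t"] by (simp del: nn_nonneg)
        have "0 \<le> C1 * exp (C1 * Tm) * D0" using C1 D00 by simp
        then have "1 * (C1 * exp (C1 * Tm) * D0) \<le> e * (C1 * exp (C1 * Tm) * D0)"
          using e1 by (rule mult_right_mono[rotated])
        with 1 show ?thesis by simp
      qed
      have "nn 3 (u t) \<le> e * (A * D0 + B / lam * M)"
        using low top' unfolding nn_3_eq[of "u t"] by (simp add: A_def distrib_left distrib_right)
      moreover have "f t = nn 3 (u t) / e" by (simp only: f_def e_def exp_minus divide_inverse mult.commute)
      moreover have "e * (nn 3 (u t) / e) = nn 3 (u t)" using e1 by simp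
      ultimately have "e * f t \<le> e * (A * D0 + B / lam * M)" by simp
      moreover have "e > 0" using e1 by linarith
      ultimately show ?thesis by (simp only: mult_le_cancel_left_pos)
    qed
    \<comment> \<open>Taking the supremum over the interval; only the occurrence of \<open>M\<close>
      on the left is unfolded.\<close>
    have "M \<le> A * D0 + B / lam * M"
      by (subst (1) M_def) (rule cSUP_least, use t01 key in auto)
    moreover have "B / lam * M \<le> 1 / 2 * M"
      using lam B0 M0 by (intro mult_right_mono) (auto simp: lam_def field_simps)
    ultimately have M2: "M \<le> 2 * A * D0" by linarith
    have "nn 3 (u t1) \<le> M * exp (lam * (t1 - t0))" by (rule uM) (use t01 in simp)
    also have "\<dots> \<le> (2 * A * D0) * exp (lam * Tm)"
      using M2 M0 le lam by (intro mult_mono) auto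
    finally show ?thesis by (simp only: D0_def mult_ac)
  qed
  moreover have "2 * A * exp (lam * Tm) \<ge> 0" using A0 by simp
  ultimately show ?thesis by blast
qed

section \<open>Joining the phases; the unperturbed wave and uniqueness\<close>

lemma three_phase_estimate:
  assumes Tm: "Tm > 0"
  shows "\<exists>C\<ge>0. \<forall>s0 s1 kap u v t. 0 \<le> s0 \<longrightarrow> s0 \<le> s1 \<longrightarrow> kap \<ge> 0 \<longrightarrow> kap * (s1 - s0) \<le> eta0 \<longrightarrow>
    wave_on a b 0 s0 u v \<longrightarrow> wave_on a (bk kap) s0 s1 u v \<longrightarrow> (\<forall>s. wave_on a b s1 s u v) \<longrightarrow>
    sob 2 (v 0) \<longrightarrow> t \<in> {0..Tm} \<longrightarrow> nn 2 (u t) + nn 1 (v t) \<le> C * (nn 3 (u 0) + nn 2 (v 0))"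
proof -
  obtain C1 where C1: "C1 \<ge> 0" "\<And>kap t0 t1 u v g. kap \<ge> 0 \<Longrightarrow> t0 \<le> t1 \<Longrightarrow> wave_on a (bk kap) t0 t1 u v \<Longrightarrow> sob 3 g \<Longrightarrow>
   nn 2 (u t1 - g) + nn 1 (v t1) \<le> C1 * exp (C1 * ((1 + kap) * (t1 - t0))) * ((1 + kap) * nn 2 (u t0 - g) + nn 1 (v t0) + nn 3 g)"
    using level1_estimate by blast
  obtain C2 where C2: "C2 \<ge> 0" "\<And>t0 t1 u v. t0 \<le> t1 \<Longrightarrow> t1 - t0 \<le> Tm \<Longrightarrow> wave_on a b t0 t1 u v \<Longrightarrow> sob 2 (v t0) \<Longrightarrow>
    nn 3 (u t1) \<le> C2 * (nn 3 (u t0) + nn 2 (v t0))"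
    using level2_estimate[OF Tm] by blast
  define A where "A = C1 * exp (C1 * Tm)"
  \<comment> \<open>In the mirror phase \<open>(1 + kap) * (r - s0)\<close> is at most
    \<open>Tm + \<bar>eta0\<bar>\<close>, so \<open>B\<close> bounds the growth factor there
    independently of \<open>kap\<close>.\<close>
  define B where "B = C1 * exp (C1 * (Tm + \<bar>eta0\<bar>))"
  have A0: "A \<ge> 0" and B0: "B \<ge> 0" using C1 by (simp_all add: A_def B_def)
  have free: "nn 2 (u t) + nn 1 (v t) \<le> A * (nn 2 (u t0) + nn 1 (v t0))"
    if "t0 \<le> t" "t - t0 \<le> Tm" "wave_on a b t0 t u v" for t0 t u v
  proof -
    have "nn 2 (u t - 0) + nn 1 (v t) \<le> C1 * exp (C1 * ((1 + 0) * (t - t0))) * ((1 + 0) * nn 2 (u t0 - 0) + nn 1 (v t0) + nn 3 (0::'n l2))"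
      by (rule C1(2)) (use that sob_0 in \<open>auto simp: bk_0\<close>)
    also have "\<dots> = C1 * exp (C1 * (t - t0)) * (nn 2 (u t0) + nn 1 (v t0))" by (simp add: nn_0)
    also have "\<dots> \<le> A * (nn 2 (u t0) + nn 1 (v t0))"
      unfolding A_def using that C1(1) by (intro mult_right_mono mult_left_mono) (auto intro: mult_left_mono add_nonneg_nonneg)
    finally show ?thesis by simp
  qed
  define CC where "CC = A + (2 * (B * (A + C2)) + 2 * C2) + A * (2 * (B * (A + C2)) + 2 * C2)"
  have "nn 2 (u t) + nn 1 (v t) \<le> CC * (nn 3 (u 0) + nn 2 (v 0))"
    if s: "0 \<le> s0" "s0 \<le> s1" and k: "kap \<ge> 0" "kap * (s1 - s0) \<le> eta0"
      and W: "wave_on a b 0 s0 u v" "wave_on a (bk kap) s0 s1 u v" "\<And>s. wave_on a b s1 s u v"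
      and v0: "sob 2 (v 0)" and t: "t \<in> {0..Tm}" for s0 s1 kap u v t
  proof -
    define D0 where "D0 = nn 3 (u 0) + nn 2 (v 0)"
    have D00: "D0 \<ge> 0" by (simp add: D0_def)
    have data: "nn 2 (u 0) + nn 1 (v 0) \<le> D0"
      using nn_mono[of 2 3 "u 0"] nn_mono[of 1 2 "v 0"] by (simp add: D0_def)
    have p1: "nn 2 (u r) + nn 1 (v r) \<le> A * D0" "nn 3 (u r) \<le> C2 * D0" if r: "0 \<le> r" "r \<le> s0" "r \<le> Tm" for r
    proof -
      have Wr: "wave_on a b 0 r u v" by (rule wave_on_subset[OF W(1)]) (use r in auto)
      have "nn 2 (u r) + nn 1 (v r) \<le> A * (nn 2 (u 0) + nn 1 (v 0))" using r by (intro free Wr) auto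
      also have "\<dots> \<le> A * D0" by (intro mult_left_mono data A0)
      finally show "nn 2 (u r) + nn 1 (v r) \<le> A * D0" .
      show "nn 3 (u r) \<le> C2 * D0" unfolding D0_def using r by (intro C2(2) Wr v0) auto
    qed
    define G where "G = 2 * (B * (A + C2)) + 2 * C2"
    have G0: "G \<ge> 0" using A0 B0 C2 by (simp add: G_def)
    have p2: "nn 2 (u r) + nn 1 (v r) \<le> G * D0" if r: "s0 \<le> r" "r \<le> s1" "r \<le> Tm" for r
    proof -
      have Wr: "wave_on a (bk kap) s0 r u v" by (rule wave_on_subset[OF W(2)]) (use r in auto)
      \<comment> \<open>With this choice the one term multiplied by \<open>1 + kap\<close>, the
        initial distance to \<open>g\<close>, is zero.\<close>
      let ?g = "u s0"
      have g: "sob 3 ?g" using W(2) s unfolding wave_on_def by auto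
      note q = p1[of s0, OF s(1) order_refl order_trans[OF r(1,3)]]
      have "sob 3 (u x)" if "x \<in> {s0..r}" for x using Wr that unfolding wave_on_def by blast
      then have s: "sob 2 ?g" "sob 2 (u r)" using sob_3_imp(1)[OF g] sob_3_imp(1)[of "u r"] r by auto
      have "nn 2 (u r - ?g) + nn 1 (v r) \<le> C1 * exp (C1 * ((1 + kap) * (r - s0))) * ((1 + kap) * nn 2 (u s0 - ?g) + nn 1 (v s0) + nn 3 ?g)"
        by (rule C1(2)[OF k(1) r(1) Wr g])
      also have "\<dots> = C1 * exp (C1 * ((1 + kap) * (r - s0))) * (nn 1 (v s0) + nn 3 ?g)" by (simp add: nn_0)
      also have "\<dots> \<le> B * ((A + C2) * D0)"
      proof (rule mult_mono)
        have "kap * (r - s0) \<le> kap * (s1 - s0)" using k r by (intro mult_left_mono) auto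
        then have "(1 + kap) * (r - s0) \<le> Tm + \<bar>eta0\<bar>" using k r \<open>0 \<le> s0\<close> by (simp add: distrib_right)
        then show "C1 * exp (C1 * ((1 + kap) * (r - s0))) \<le> B"
          unfolding B_def using C1(1) by (intro mult_left_mono) (auto intro: mult_left_mono)
        show "nn 1 (v s0) + nn 3 ?g \<le> (A + C2) * D0"
          using q nn_nonneg[of 2 "u s0"] unfolding distrib_right by linarith
      qed (use B0 in auto)
      finally have d: "nn 2 (u r - ?g) + nn 1 (v r) \<le> B * (A + C2) * D0" by simp
      have "nn 2 (u r - ?g + ?g) \<le> 2 * nn 2 (u r - ?g) + 2 * nn 2 ?g" by (intro nn_add sob_diff s)
      then have "nn 2 (u r) \<le> 2 * nn 2 (u r - ?g) + 2 * nn 2 ?g" by simp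
      moreover have "nn 2 ?g \<le> C2 * D0" using q(2) nn_mono[of 2 3 ?g] by simp
      ultimately have "nn 2 (u r) + nn 1 (v r) \<le> 2 * (B * (A + C2) * D0) + 2 * (C2 * D0)"
        using d nn_nonneg[of 1 "v r"] by linarith
      then show ?thesis by (simp add: G_def algebra_simps)
    qed
    have p3: "nn 2 (u t) + nn 1 (v t) \<le> A * (G * D0)" if "s1 \<le> t"
    proof -
      have "nn 2 (u t) + nn 1 (v t) \<le> A * (nn 2 (u s1) + nn 1 (v s1))"
        using that s t by (intro free W(3)) auto
      also have "\<dots> \<le> A * (G * D0)" using that s t by (intro mult_left_mono p2 A0) auto
      finally show ?thesis .
    qed
    have CCeq: "CC * D0 = A * D0 + G * D0 + A * (G * D0)" by (simp add: CC_def G_def algebra_simps)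
    have nng: "0 \<le> A * D0" "0 \<le> G * D0" "0 \<le> A * (G * D0)" using A0 G0 D00 by auto
    consider "t \<le> s0" | "s0 \<le> t" "t \<le> s1" | "s1 \<le> t" by linarith
    then have "nn 2 (u t) + nn 1 (v t) \<le> CC * D0"
    proof cases
      case 1 then show ?thesis using p1(1)[of t] t nng CCeq by simp
    next
      case 2 then show ?thesis using p2[of t] t nng CCeq by simp
    next
      case 3 then show ?thesis using p3 nng CCeq by simp
    qed
    then show ?thesis by (simp add: D0_def)
  qed
  moreover have "CC \<ge> 0" using A0 B0 C2 by (simp add: CC_def)
  ultimately show ?thesis by blast
qed

text \<open>For the unperturbed wave: with \<open>kap = 0\<close> and \<open>g = 0\<close> the
  first-order estimate loses no derivative.\<close>

lemma free_estimate:
  "\<exists>C\<ge>0. \<forall>u v t. 0 \<le> t \<longrightarrow> t \<le> Tm \<longrightarrow> wave_on a b 0 t u v \<longrightarrow> nn 2 (u t) + nn 1 (v t) \<le> C * (nn 2 (u 0) + nn 1 (v 0))"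
proof -
  obtain C1 where C1: "C1 \<ge> 0" "\<And>kap t0 t1 u v g. kap \<ge> 0 \<Longrightarrow> t0 \<le> t1 \<Longrightarrow> wave_on a (bk kap) t0 t1 u v \<Longrightarrow> sob 3 g \<Longrightarrow>
   nn 2 (u t1 - g) + nn 1 (v t1) \<le> C1 * exp (C1 * ((1 + kap) * (t1 - t0))) * ((1 + kap) * nn 2 (u t0 - g) + nn 1 (v t0) + nn 3 g)"
    using level1_estimate by blast
  have "nn 2 (u t) + nn 1 (v t) \<le> (C1 * exp (C1 * Tm)) * (nn 2 (u 0) + nn 1 (v 0))"
    if "0 \<le> t" "t \<le> Tm" "wave_on a b 0 t u v" for t u v
  proof -
    have "nn 2 (u t - 0) + nn 1 (v t) \<le> C1 * exp (C1 * ((1 + 0) * (t - 0))) * ((1 + 0) * nn 2 (u 0 - 0) + nn 1 (v 0) + nn 3 (0::'n l2))"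
      by (rule C1(2)) (use that sob_0 in \<open>auto simp: bk_0\<close>)
    also have "\<dots> = C1 * exp (C1 * t) * (nn 2 (u 0) + nn 1 (v 0))" by (simp add: nn_0)
    also have "\<dots> \<le> (C1 * exp (C1 * Tm)) * (nn 2 (u 0) + nn 1 (v 0))"
      using that C1(1) by (intro mult_right_mono mult_left_mono) (auto intro: mult_left_mono add_nonneg_nonneg)
    finally show ?thesis by simp
  qed
  then show ?thesis using C1(1) by (intro exI[of _ "C1 * exp (C1 * Tm)"]) auto
qed

text \<open>By linearity of \<open>Qop\<close> the energy of the difference has zero derivative, so
  Gronwall applies with rate 0. Only the equality of the gradients is extracted, since the source of
  the corrector sees nothing else.\<close>

lemma wave_on_unique:
  assumes W: "wave_on a b 0 s u v" "wave_on a b 0 s u' v'" and s: "0 \<le> s"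
    and init: "u 0 = u' 0" "v 0 = v' 0"
  shows "dd i (u s - u' s) = 0"
proof -
  have u3: "sob 3 (u t)" "sob 3 (u' t)" if "t \<in> {0..s}" for t using W that unfolding wave_on_def by blast+
  obtain N where N: "N \<ge> 0" "\<And>t. t \<in> {0..s} \<Longrightarrow> nn 3 (u t) \<le> N"
    using wave_on_bounds[OF W(1) sob_0] by (metis diff_zero)
  obtain N' where N': "N' \<ge> 0" "\<And>t. t \<in> {0..s} \<Longrightarrow> nn 3 (u' t) \<le> N'"
    using wave_on_bounds[OF W(2) sob_0] by (metis diff_zero)
  have "2 * N + 2 * N' \<ge> 0" using N N' by simp
  then obtain M where M: "\<And>w. sob 2 w \<Longrightarrow> nn 2 w \<le> 2 * N + 2 * N' \<Longrightarrow> norm (Qop b w) \<le> M"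
    using Qop_norm_bound[of 0 "2 * N + 2 * N'"] unfolding bk_0 by auto
  define E where "E t = Een al b (u t - u' t) (v t - v' t)" for t
  have ev: "sob 2 (u t - u' t) \<and> norm (Qop b (u t - u' t)) \<le> M" if t: "t \<in> {0..s}" for t
  proof -
    have s2: "sob 2 (u t)" "sob 2 (u' t)" using u3[OF t] by (auto intro: sob_3_imp(1))
    have "nn 2 (u t - u' t) \<le> 2 * nn 2 (u t) + 2 * nn 2 (u' t)" by (intro nn_diff s2)
    also have "\<dots> \<le> 2 * N + 2 * N'"
      using N(2)[OF t] N'(2)[OF t] nn_mono[of 2 3 "u t"] nn_mono[of 2 3 "u' t"] by simp
    finally show ?thesis using M sob_diff[OF s2] by blast
  qed
  have lipd: "lipr S (\<lambda>t. f t - g t)" if "lipr S f" "lipr S g" for S and f g :: "real \<Rightarrow> 'n l2"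
    using lipr_add[OF that(1) lipr_bounded_linear[OF bounded_linear_minus[OF bounded_linear_ident] that(2)]] by simp
  have L: "lipr {0..s} u" "lipr {0..s} v" "lipr {0..s} u'" "lipr {0..s} v'"
    using W unfolding wave_on_def by blast+
  have "E s \<le> exp (0 * (s - 0)) * (E 0 + 0 * (s - 0))"
  proof (rule gronwall_lipr[OF s order_refl])
    show "lipr {0..s} E" unfolding E_def[abs_def]
      by (rule lipr_Een[OF smooth_b mbdd_al ev lipd[OF L(1,3)] lipd[OF L(2,4)]])
    have "AE t in lborel. t \<in> {0<..<s} \<longrightarrow> (\<exists>z. sob 1 z \<and> (v has_vector_derivative z) (at t) \<and>
       (\<forall>i. ((\<lambda>s. dd i (v s)) has_vector_derivative dd i z) (at t)) \<and> z = mul a (Qop b (u t)))"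
      "AE t in lborel. t \<in> {0<..<s} \<longrightarrow> (\<exists>z. sob 1 z \<and> (v' has_vector_derivative z) (at t) \<and>
       (\<forall>i. ((\<lambda>s. dd i (v' s)) has_vector_derivative dd i z) (at t)) \<and> z = mul a (Qop b (u' t)))"
      using W unfolding wave_on_def by blast+
    then show "AE t in lborel. t \<in> {0<..<s} \<longrightarrow> (\<exists>D. (E has_real_derivative D) (at t) \<and> D \<le> 0 * E t + 0 * exp (0 * (t - 0)))"
    proof eventually_elim
      case (elim t)
      show ?case
      proof
        assume t: "t \<in> {0<..<s}"
        let ?z = "mul a (Qop b (u t)) - mul a (Qop b (u' t))"
        have y: "((\<lambda>t. v t - v' t) has_vector_derivative ?z) (at t)"
          using elim t by (intro has_vector_derivative_diff) auto
        have ud: "(u has_vector_derivative v t) (at t)" "(u' has_vector_derivative v' t) (at t)"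
          using W t unfolding wave_on_def by blast+
        have "(E has_real_derivative 2 * inner (v t - v' t) (mul al ?z - Qop b (u t - u' t))) (at t)"
          unfolding E_def[abs_def]
          by (rule Een_has_derivative[OF smooth_b mbdd_al ev t has_vector_derivative_diff[OF ud] y])
        moreover have "mul al ?z - Qop b (u t - u' t) = 0"
          using u3[of t] t by (simp add: linear_diff[OF linear_mul[OF mbdd_al]] mul_al_a Qop_diff[OF smooth_b] sob_3_imp(1))
        ultimately show "\<exists>D. (E has_real_derivative D) (at t) \<and> D \<le> 0 * E t + 0 * exp (0 * (t - 0))"
          by (metis inner_zero_right mult_zero_left mult_zero_right add_0 order_refl)
      qed
    qed
  qed
  moreover have "E 0 = 0"
    using linear_0[OF linear_mul[OF mbdd_al]] by (simp add: E_def init Een_def Bform_def dd_0)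
  ultimately have Es: "E s \<le> 0" by simp
  have "1 / a_hi * (norm (v s - v' s))\<^sup>2 + b_lo * gsq (u s - u' s) \<le> E s"
    using Een_lower[of 0 "v s - v' s" "u s - u' s"] unfolding bk_0 E_def by simp
  moreover have "0 \<le> 1 / a_hi * (norm (v s - v' s))\<^sup>2" using a_hi_pos by simp
  ultimately have "b_lo * gsq (u s - u' s) \<le> 0" using Es by linarith
  then have "gsq (u s - u' s) \<le> 0" using b_lo by (simp add: mult_le_0_iff)
  then have "gsq (u s - u' s) = 0" using gsq_nonneg by (metis order_antisym)
  then show ?thesis unfolding gsq_def by (simp add: sum_nonneg_eq_0_iff)
qed

end

section \<open>From the given solution class to curves of classes\<close>

lemma at_within_nonneg: "t > 0 \<Longrightarrow> at t within {0..} = at (t::real)"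
  by (rule at_within_interior) simp

lemma cls_cong_AE: "L2 f \<Longrightarrow> L2 g \<Longrightarrow> (AE x in lborel. f x = g x) \<Longrightarrow> cls f = cls g"
  by (simp add: cls_eq_iff)

lemma wave_sol_sobolev:
  assumes "wave_sol a b c u0 u1 u v" "t \<ge> 0" shows "sobolev 3 (u t)" "sobolev 1 (v t)"
  using assms unfolding wave_sol_def by blast+

lemma wave_sol_deriv:
  assumes W: "wave_sol a b c u0 u1 u v" and t: "t \<ge> 0"
  shows "((\<lambda>s. cls (u s)) has_vector_derivative cls (v t)) (at t within {0..})"
    and "((\<lambda>s. dd i (cls (u s))) has_vector_derivative dd i (cls (v t))) (at t within {0..})"
proof -
  have H: "H_deriv 1 u v t" using W t unfolding wave_sol_def by blast
  have s: "\<And>s. s \<ge> 0 \<Longrightarrow> sobolev 1 (u s)" "sobolev 1 (v t)"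
    using wave_sol_sobolev[OF W] t sobolev_mono[of 3 _ 1] by auto
  show "((\<lambda>s. cls (u s)) has_vector_derivative cls (v t)) (at t within {0..})"
    by (rule H_deriv_vector[OF H t s])
  show "((\<lambda>s. dd i (cls (u s))) has_vector_derivative dd i (cls (v t))) (at t within {0..})"
    by (rule H_deriv_vector_dd[of 0]) (use H t s in auto)
qed

lemma lipr_of_derivative:
  fixes f :: "real \<Rightarrow> 'a::real_normed_vector"
  assumes "\<And>t. t \<in> {t0..t1} \<Longrightarrow> (f has_vector_derivative g t) (at t within {0..})" "t0 \<ge> 0"
    and "\<And>t. t \<in> {t0..t1} \<Longrightarrow> norm (g t) \<le> K" "K \<ge> 0"
  shows "s \<in> {t0..t1} \<Longrightarrow> t \<in> {t0..t1} \<Longrightarrow> norm (f s - f t) \<le> K * \<bar>s - t\<bar>"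
proof -
  assume st: "s \<in> {t0..t1}" "t \<in> {t0..t1}"
  have "norm (f s - f t) \<le> K * norm (s - t)"
  proof (rule differentiable_bound[of "{t0..t1}" f "\<lambda>t h. h *\<^sub>R g t"])
    fix r assume r: "r \<in> {t0..t1}"
    have "(f has_vector_derivative g r) (at r within {t0..t1})"
      by (rule has_vector_derivative_within_subset[OF assms(1)[OF r]]) (use assms(2) in auto)
    then show "(f has_derivative (\<lambda>h. h *\<^sub>R g r)) (at r within {t0..t1})"
      by (simp add: has_vector_derivative_def)
    show "onorm (\<lambda>h. h *\<^sub>R g r) \<le> K"
      using assms(3)[OF r] by (intro onorm_le) (simp add: mult.commute[of K] mult_left_mono)
  qed (use st in auto)
  then show ?thesis by simp
qed

lemma wave_sol_init:
  assumes W: "wave_sol a b c u0 u1 u v" and "L2 u0" "L2 u1"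
  shows "cls (u 0) = cls u0" "cls (v 0) = cls u1"
  using W wave_sol_sobolev[OF W order_refl] assms(2,3) sobolev_L2
  unfolding wave_sol_def by (metis cls_cong_AE)+

lemma norm_le_Hnorm_diff:
  assumes "sobolev 1 f" "sobolev 1 g" 
  shows "norm (cls f - cls g) \<le> Hnorm 1 (\<lambda>x. f x - g x)" "norm (dd i (cls f) - dd i (cls g)) \<le> Hnorm 1 (\<lambda>x. f x - g x)"
proof -
  have s: "sobolev 1 (\<lambda>x. f x - g x)" by (intro sobolev_diff assms)
  have c: "cls (\<lambda>x. f x - g x) = cls f - cls g" using assms by (intro cls_diff sobolev_L2)
  have "dd i (cls f) - dd i (cls g) = dd i (cls f - cls g)"
    using assms[THEN sobolev_sob] by (simp add: dd_diff)
  then show "norm (cls f - cls g) \<le> Hnorm 1 (\<lambda>x. f x - g x)" "norm (dd i (cls f) - dd i (cls g)) \<le> Hnorm 1 (\<lambda>x. f x - g x)"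
    unfolding Hnorm_eq[OF s] c by (auto intro!: real_le_rsqrt norm_le_nn nn_dd_le_num(3) simp del: One_nat_def)
qed

text \<open>The coefficient has to agree with \<open>m\<close> on the open interval only, so the
  switching times of the mirror do not matter. The Lipschitz bounds for \<open>u\<close> and its
  derivatives come from the boundedness of \<open>v\<close> and its derivatives on the
  interval.\<close>

lemma wave_sol_wave_on:
  assumes W: "wave_sol a b c u0 u1 u v" and a: "smooth_bdd a" and m: "smooth_bdd m" and t0: "0 \<le> t0"
    and c: "\<And>t x. t \<in> {t0<..<t1} \<Longrightarrow> b x * c t x = m x"
  shows "wave_on a m t0 t1 (\<lambda>t. cls (u t)) (\<lambda>t. cls (v t))"
proof -
  note sv = wave_sol_sobolev[OF W]
  have nneg: "t \<ge> 0" if "t \<in> {t0..t1}" for t using that t0 by simp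
  have s1: "sobolev 1 (u t)" if "t \<ge> 0" for t using sv(1)[OF that] by (rule sobolev_mono) simp
  obtain M where M: "\<And>t. t \<in> {0..t1} \<Longrightarrow> Hnorm 3 (u t) \<le> M"
    using W unfolding wave_sol_def by blast
  obtain L where L: "\<And>s t. s \<in> {0..t1} \<Longrightarrow> t \<in> {0..t1} \<Longrightarrow> Hnorm 1 (\<lambda>x. v s x - v t x) \<le> L * \<bar>s - t\<bar>"
    using W unfolding wave_sol_def by blast
  have L': "Hnorm 1 (\<lambda>x. v s x - v t x) \<le> \<bar>L\<bar> * \<bar>s - t\<bar>" if "s \<in> {t0..t1}" "t \<in> {t0..t1}" for s t
  proof -
    have "L * \<bar>s - t\<bar> \<le> \<bar>L\<bar> * \<bar>s - t\<bar>" by (intro mult_right_mono) auto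
    then show ?thesis using L[of s t] that t0 by simp
  qed
  have lv: "lipr {t0..t1} (\<lambda>t. cls (v t))"
    by (rule liprI[of "\<bar>L\<bar>"]) (auto simp: dist_norm intro!: order_trans[OF norm_le_Hnorm_diff(1) L'] sv nneg)
  have ldv: "lipr {t0..t1} (\<lambda>t. dd i (cls (v t)))" for i
    by (rule liprI[of "\<bar>L\<bar>"]) (auto simp: dist_norm intro!: order_trans[OF norm_le_Hnorm_diff(2) L'] sv nneg)
  have lu: "lipr {t0..t1} (\<lambda>t. cls (u t))"
  proof -
    obtain Y where Y: "Y \<ge> 0" "\<And>t. t \<in> {t0..t1} \<Longrightarrow> norm (cls (v t)) \<le> Y" using lipr_bounded[OF lv] by metis
    show ?thesis
      by (rule liprI[OF Y(1)]) (unfold dist_norm, rule lipr_of_derivative[OF wave_sol_deriv(1)[OF W nneg] t0 Y(2) Y(1)])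
  qed
  have ldu: "lipr {t0..t1} (\<lambda>t. dd i (cls (u t)))" for i
  proof -
    obtain Y where Y: "Y \<ge> 0" "\<And>t. t \<in> {t0..t1} \<Longrightarrow> norm (dd i (cls (v t))) \<le> Y" using lipr_bounded[OF ldv] by metis
    show ?thesis
      by (rule liprI[OF Y(1)]) (unfold dist_norm, rule lipr_of_derivative[OF wave_sol_deriv(2)[OF W nneg] t0 Y(2) Y(1)])
  qed
  obtain z where z: "AE t in lborel. t > 0 \<longrightarrow> sobolev 1 (z t) \<and> H_deriv 1 v z t \<and>
          (AE x in lborel. z t x = a x * (\<Sum>i\<in>UNIV. wd [i] (\<lambda>y. b y * c t y * wd [i] (u t) y) x))"
    using W unfolding wave_sol_def by blast
  obtain Km where Km: "mbdd m Km" by (rule smooth_bdd_mbdd[OF m])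
  obtain Ka where Ka: "mbdd a Ka" by (rule smooth_bdd_mbdd[OF a])
  have ae: "AE t in lborel. t \<in> {t0<..<t1} \<longrightarrow> (\<exists>z. sob 1 z \<and> ((\<lambda>t. cls (v t)) has_vector_derivative z) (at t) \<and>
       (\<forall>i. ((\<lambda>s. dd i (cls (v s))) has_vector_derivative dd i z) (at t)) \<and> z = mul a (Qop m (cls (u t))))"
    using z
  proof eventually_elim
    case (elim t)
    show ?case
    proof
      assume t: "t \<in> {t0<..<t1}"
      then have tp: "t > 0" using t0 by simp
      then have zz: "sobolev 1 (z t)" "H_deriv 1 v z t"
          "AE x in lborel. z t x = a x * (\<Sum>i\<in>UNIV. wd [i] (\<lambda>y. b y * c t y * wd [i] (u t) y) x)"
        using elim by auto
      have u3: "sob 3 (cls (u t))" using sobolev_sob[OF sv(1)] tp by simp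
      note u3' = sob_3_imp[OF u3]
      have wdu: "L2 (wd [i] (u t))" "cls (wd [i] (u t)) = dd i (cls (u t))" for i
        using sobolev_dd[of 2 "u t" i] sv(1)[of t] tp by (simp_all add: numeral_3_eq_3 numeral_2_eq_2)
      have Lm: "L2 (\<lambda>y. m y * wd [i] (u t) y)" for i by (rule L2_mul[OF Km wdu(1)])
      \<comment> \<open>The flux is not assumed to have weak derivatives. They exist because the
        flux is the smooth bounded \<open>m\<close> times a derivative of an H^3 function, and
        \<open>isd_wd\<close> then identifies the terms of the equation.\<close>
      have isd: "isd i (cls (\<lambda>y. m y * wd [i] (u t) y)) (dd i (mul m (dd i (cls (u t)))))" for i
      proof -
        have "sob 1 (mul m (dd i (cls (u t))))" by (intro sob_mul m u3')
        then have "isd i (mul m (dd i (cls (u t)))) (dd i (mul m (dd i (cls (u t)))))"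
          using sob_isd[of 0] by simp
        then show ?thesis by (simp add: mul_cls[OF Km wdu(1), symmetric] wdu(2))
      qed
      note Q = isd_wd[OF Lm isd]
      have "cls (z t) = cls (\<lambda>x. a x * (\<Sum>i\<in>UNIV. wd [i] (\<lambda>y. m y * wd [i] (u t) y) x))"
        using zz(3) by (intro cls_cong_AE L2_mul[OF Ka] L2_sum Q(1) sobolev_L2[OF zz(1)]) (simp_all add: c[OF t])
      also have "\<dots> = mul a (\<Sum>i\<in>UNIV. cls (wd [i] (\<lambda>y. m y * wd [i] (u t) y)))"
        by (simp add: mul_cls[OF Ka, symmetric] L2_sum Q(1) cls_sum)
      also have "\<dots> = mul a (Qop m (cls (u t)))"
        unfolding Q(2) by (simp add: Qop_div[OF m u3'(1)])
      finally have zeq: "cls (z t) = mul a (Qop m (cls (u t)))" .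
      have "((\<lambda>s. cls (v s)) has_vector_derivative cls (z t)) (at t within {0..})"
        by (rule H_deriv_vector[OF zz(2)]) (use tp sv zz in auto)
      moreover have "((\<lambda>s. dd i (cls (v s))) has_vector_derivative dd i (cls (z t))) (at t within {0..})" for i
        by (rule H_deriv_vector_dd[of 0]) (use tp sv zz in auto)
      ultimately show "\<exists>z. sob 1 z \<and> ((\<lambda>t. cls (v t)) has_vector_derivative z) (at t) \<and>
         (\<forall>i. ((\<lambda>s. dd i (cls (v s))) has_vector_derivative dd i z) (at t)) \<and> z = mul a (Qop m (cls (u t)))"
        using sobolev_sob[OF zz(1)] zeq unfolding at_within_nonneg[OF tp] by blast
    qed
  qed
  show ?thesis
    unfolding wave_on_def
  proof (intro conjI ballI allI lu lv ldu ldv ae)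
    show "sob 3 (cls (u t))" "sob 1 (cls (v t))" if "t \<in> {t0..t1}" for t
      using sobolev_sob sv nneg[OF that] by blast+
    have "nn 3 (cls (u t)) \<le> M\<^sup>2" if "t \<in> {t0..t1}" for t
      using power_mono[OF M, of t 2] that t0 Hnorm_sq[OF sv(1)[OF nneg[OF that]]] by simp
    then show "\<exists>M. \<forall>t\<in>{t0..t1}. nn 3 (cls (u t)) \<le> M" by blast
    fix t assume "t \<in> {t0<..<t1}"
    then have tp: "t > 0" using t0 by simp
    show "((\<lambda>t. cls (u t)) has_vector_derivative cls (v t)) (at t)"
      using wave_sol_deriv(1)[OF W, of t] tp unfolding at_within_nonneg[OF tp] by simp
    show "((\<lambda>s. dd i (cls (u s))) has_vector_derivative dd i (cls (v t))) (at t)" for i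
      using wave_sol_deriv(2)[OF W, of t i] tp unfolding at_within_nonneg[OF tp] by simp
  qed
qed

section \<open>The corrector\<close>

lemma sobolev_1I: assumes "L2 f" "sob 1 (cls f)" shows "sobolev 1 f"
  unfolding sobolev_def
proof (intro conjI allI impI assms(1))
  fix js :: "'a list" assume "length js \<le> 1"
  then consider "js = []" | i where "js = [i]" by (cases js) auto
  then show "\<exists>g. L2 g \<and> weak_deriv js f g"
  proof cases
    case 1
    then show ?thesis using weak_deriv_Nil[OF assms(1)] assms(1) by blast
  next
    case (2 i)
    obtain g where g: "L2 g" "dd i (cls f) = cls g" by (rule l2_cases)
    have "isd i (cls f) (cls g)" using assms(2) sob_isd[of 0 "cls f" i] g(2) by simp
    then have "weak_deriv [i] f g"
      unfolding weak_deriv_iff[OF assms(1) g(1)] by (simp add: isd_weakD)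
    then show ?thesis using g(1) 2 by blast
  qed
qed

text \<open>The norm of a test function in L^2 is at most that in H^1, so the Cauchy-Schwarz
  inequality bounds every element of the supremum.\<close>

lemma Hm1norm_le: assumes "L2 f" shows "Hm1norm f \<le> norm (cls f)"
  unfolding Hm1norm_def
proof (rule cSup_least)
  \<comment> \<open>The supremum is bounded through \<open>cSup_least\<close>, which asks for a
    nonempty set; the zero function is the admissible element.\<close>
  have "sobolev 1 (\<lambda>x :: real^'a. 0)"
    by (rule sobolev_1I) (simp_all add: cls_zero sob_0 del: One_nat_def)
  then have "Hnorm 1 (\<lambda>x :: real^'a. 0) = 0" by (simp add: Hnorm_eq cls_zero nn_0 del: One_nat_def)
  then show "{\<bar>LINT x|lborel. f x * \<phi> x\<bar> |\<phi>. test_fun \<phi> \<and> Hnorm 1 \<phi> \<le> 1} \<noteq> {}"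
    using test_fun_0 by force
  fix y assume "y \<in> {\<bar>LINT x|lborel. f x * \<phi> x\<bar> |\<phi>. test_fun \<phi> \<and> Hnorm 1 \<phi> \<le> 1}"
  then obtain \<phi> where \<phi>: "y = \<bar>LINT x|lborel. f x * \<phi> x\<bar>" "test_fun \<phi>" "Hnorm 1 \<phi> \<le> 1" by blast
  have "sobolev 1 \<phi>" by (rule sobolev_1I[OF L2_test[OF \<phi>(2)] sob_test[OF \<phi>(2)]])
  then have "norm (cls \<phi>) \<le> Hnorm 1 \<phi>" by (simp only: Hnorm_eq norm_le_sqrt_nn)
  then have "norm (cls \<phi>) \<le> 1" using \<phi>(3) by linarith
  have "y = \<bar>inner (cls f) (cls \<phi>)\<bar>" by (simp add: \<phi>(1) inner_cls assms L2_test[OF \<phi>(2)])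
  also have "\<dots> \<le> norm (cls f) * norm (cls \<phi>)" by (rule Cauchy_Schwarz_ineq2)
  also have "\<dots> \<le> norm (cls f) * 1" by (intro mult_left_mono) (use \<open>norm (cls \<phi>) \<le> 1\<close> in auto)
  finally show "y \<le> norm (cls f)" by simp
qed

text \<open>The quadratic form is an \<open>Een\<close> with zero coefficient and a constant first
  argument, so \<open>lipr_Een\<close> applies.\<close>

lemma lipr_quad:
  assumes al: "mbdd al K" and y: "lipr {t0..t1} y"
  shows "lipr {t0..t1} (\<lambda>t. inner (mul al (y t)) (y t))"
proof -
  have sm: "smooth_bdd (\<lambda>x :: real^'a. 0)"
    by (rule smooth_bddI_closed[of "\<lambda>f. f = (\<lambda>x. 0)"]) (auto simp: pdx_def)
  have "lipr {t0..t1} (\<lambda>t. Een al (\<lambda>x. 0) 0 (y t))"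
    by (rule lipr_Een[OF sm al _ lipr_const y, where M = "norm (Qop (\<lambda>x. 0) (0 :: 'a l2))"]) (auto simp: sob_0)
  then show ?thesis by (simp add: Een_def Bform_def dd_0)
qed

lemma H_deriv_0_vector:
  assumes "H_deriv 0 u v t" "t > 0" "\<And>s. s \<ge> 0 \<Longrightarrow> L2 (u s)" "L2 (v t)"
  shows "((\<lambda>s. cls (u s)) has_vector_derivative cls (v t)) (at t)"
  using H_deriv_vector[OF assms(1)] assms at_within_nonneg[OF assms(2)] by (simp add: sobolev_0_iff)

context wave_coeffs
begin

text \<open>The energy with weights \<open>1 / b\<close> and \<open>1 / a\<close> is zero until the
  source starts and does not grow after it stops. While the source acts, for a time
  \<open>d\<close>, Young's inequality is tuned to the rate \<open>1 / d\<close>: the exponential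
  then costs only \<open>exp 1\<close>, and both the weight and the duration contribute a factor
  \<open>d\<close>.\<close>

lemma first_order_estimate:
  assumes fo: "fo_sol a b F W w" and b_hi: "\<And>x. b x \<le> b_hi"
    and s: "0 \<le> s0" "s0 < s1"
    and LF: "\<And>t i. t > 0 \<Longrightarrow> L2 (\<lambda>x. F t x $ i)"
    and F0: "\<And>t i. t > 0 \<Longrightarrow> t \<notin> {s0<..<s1} \<Longrightarrow> cls (\<lambda>x. F t x $ i) = 0"
    and F1: "\<And>t i. t \<in> {s0<..<s1} \<Longrightarrow> t \<le> Tm \<Longrightarrow> norm (cls (\<lambda>x. F t x $ i)) \<le> \<rho>"
    and t: "t \<in> {0..Tm}"
  shows "(\<Sum>i\<in>UNIV. 1 / b_hi * (norm (cls (vcomp (W t) i)))\<^sup>2) + 1 / a_hi * (norm (cls (w t)))\<^sup>2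
    \<le> exp 1 * (b_hi * real CARD('n) * \<rho>\<^sup>2) * (s1 - s0)\<^sup>2"
proof -
  have b_pos: "b x > 0" for x using b_lo(1) b_lo(2)[of x] by linarith
  have b_hi_pos: "b_hi > 0" using b_pos[of 0] b_hi[of 0] by linarith
  define be where "be x = 1 / b x" for x
  have mbe: "mbdd be (1 / b_lo)"
  proof -
    have "b \<in> borel_measurable lborel" using smooth_b unfolding smooth_bdd_def by (intro smooth_borel) simp
    then have "be \<in> borel_measurable lborel" unfolding be_def[abs_def] by measurable
    moreover have "\<bar>be x\<bar> \<le> 1 / b_lo" for x
      using b_pos[of x] b_lo(1) b_lo(2)[of x] by (simp add: be_def frac_le)
    ultimately show ?thesis by (simp add: mbdd_def)
  qed
  have be_ge: "1 / b_hi \<le> be x" for x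
    using b_pos[of x] b_hi[of x] by (simp add: be_def frac_le)
  define Wi where "Wi i t = cls (vcomp (W t) i)" for i t
  define ww where "ww t = cls (w t)" for t
  define E where "E t = (\<Sum>i\<in>UNIV. inner (mul be (Wi i t)) (Wi i t)) + inner (mul al (ww t)) (ww t)" for t
  have sv: "sobolev 1 (w t)" "sobolev 1 (vcomp (W t) i)" if "t \<ge> 0" for t i
    using fo that unfolding fo_sol_def by blast+
  have LW: "L2 (w t)" "L2 (vcomp (W t) i)" if "t \<ge> 0" for t i
    using sv[OF that] sobolev_L2 by blast+
  have s1': "sob 1 (ww t)" "sob 1 (Wi i t)" if "t \<ge> 0" for t i
    unfolding ww_def Wi_def using sv[OF that] sobolev_sob by blast+
  have lip: "lipr {0..r} ww \<and> (\<forall>i. lipr {0..r} (Wi i))" for r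
  proof -
    obtain L where L: "\<And>s t. s \<in> {0..r} \<Longrightarrow> t \<in> {0..r} \<Longrightarrow> L2norm (\<lambda>x. w s x - w t x) \<le> L * \<bar>s - t\<bar>"
      "\<And>s t i. s \<in> {0..r} \<Longrightarrow> t \<in> {0..r} \<Longrightarrow> L2norm (\<lambda>x. W s x $ i - W t x $ i) \<le> L * \<bar>s - t\<bar>"
      using fo unfolding fo_sol_def by blast
    have LL: "L * \<bar>s - t\<bar> \<le> \<bar>L\<bar> * \<bar>s - t\<bar>" for s t by (intro mult_right_mono) auto
    have 1: "dist (ww s) (ww t) = L2norm (\<lambda>x. w s x - w t x)" if "s \<in> {0..r}" "t \<in> {0..r}" for s t
      using LW that unfolding ww_def dist_norm by (simp add: norm_cls L2_diff flip: cls_diff)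
    have 2: "dist (Wi i s) (Wi i t) = L2norm (\<lambda>x. W s x $ i - W t x $ i)" if "s \<in> {0..r}" "t \<in> {0..r}" for s t i
      using LW(2)[of s i] LW(2)[of t i] that unfolding Wi_def dist_norm
      by (simp add: norm_cls L2_diff flip: cls_diff) (simp add: vcomp_def)
    show ?thesis
      using order_trans[OF L(1) LL] order_trans[OF L(2) LL] 1 2
      by (intro conjI allI liprI[of "\<bar>L\<bar>"]) auto
  qed
  have Elip: "lipr {r0..r1} E" if "r0 \<ge> 0" for r0 r1
  proof -
    have "lipr {0..r1} E" unfolding E_def[abs_def]
      using lip[of r1] by (intro lipr_add lipr_sum lipr_quad[OF mbe] lipr_quad[OF mbdd_al]) auto
    then show ?thesis by (rule lipr_subset) (use that in auto)
  qed
  have Elow: "(\<Sum>i\<in>UNIV. 1 / b_hi * (norm (Wi i r))\<^sup>2) + 1 / a_hi * (norm (ww r))\<^sup>2 \<le> E r" for r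
    unfolding E_def by (intro add_mono sum_mono inner_mul_ge[OF mbe] be_ge inner_mul_ge[OF mbdd_al] al_ge)
  have E0: "E 0 = 0"
  proof -
    have "AE x in lborel. W 0 x = 0" "AE x in lborel. w 0 x = 0" using fo unfolding fo_sol_def by blast+
    then have "AE x in lborel. vcomp (W 0) i x = 0" for i by (auto simp: vcomp_def elim!: eventually_mono)
    then have "Wi i 0 = 0" for i
      unfolding Wi_def cls_zero[symmetric] by (intro cls_cong_AE LW) simp_all
    moreover have "ww 0 = 0"
      unfolding ww_def cls_zero[symmetric] using \<open>AE x in lborel. w 0 x = 0\<close> by (intro cls_cong_AE LW) simp_all
    ultimately show ?thesis by (simp add: E_def)
  qed
  define Fc where "Fc i t = cls (\<lambda>x. F t x $ i)" for i t
  obtain Wt wt where wt: "AE t in lborel. t > 0 \<longrightarrow>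
          L2 (wt t) \<and> (\<forall>i. L2 (vcomp (Wt t) i)) \<and>
          H_deriv 0 w wt t \<and> (\<forall>i. H_deriv 0 (\<lambda>s. vcomp (W s) i) (\<lambda>s. vcomp (Wt s) i) t) \<and>
          (AE x in lborel. Wt t x /\<^sub>R b x + wgrad (w t) x = F t x) \<and>
          (AE x in lborel. wt t x / a x + wdiv (W t) x = 0)"
    using fo unfolding fo_sol_def by blast
  have Eder: "AE t in lborel. t > 0 \<longrightarrow> (E has_real_derivative (\<Sum>i\<in>UNIV. 2 * inner (Wi i t) (Fc i t))) (at t)"
    using wt
  proof eventually_elim
    case (elim t)
    show ?case
    proof
      assume t: "t > 0"
      then have L: "L2 (wt t)" "\<And>i. L2 (vcomp (Wt t) i)" and
        H: "H_deriv 0 w wt t" "\<And>i. H_deriv 0 (\<lambda>s. vcomp (W s) i) (\<lambda>s. vcomp (Wt s) i) t" and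
        e1: "AE x in lborel. Wt t x /\<^sub>R b x + wgrad (w t) x = F t x" and
        e2: "AE x in lborel. wt t x / a x + wdiv (W t) x = 0"
        using elim by blast+
      have t0: "t \<ge> 0" using t by simp
      have wd1: "L2 (wd [i] (w t))" "cls (wd [i] (w t)) = dd i (ww t)" for i
        using sobolev_dd[of 0 "w t" i] sv(1)[OF t0] by (simp_all add: ww_def)
      have wd2: "L2 (wd [i] (vcomp (W t) i))" "cls (wd [i] (vcomp (W t) i)) = dd i (Wi i t)" for i
        using sobolev_dd[of 0 "vcomp (W t) i" i] sv(2)[OF t0] by (simp_all add: Wi_def)
      have q1: "mul be (cls (vcomp (Wt t) i)) = Fc i t - dd i (ww t)" for i
      proof -
        have "AE x in lborel. be x * vcomp (Wt t) i x + wd [i] (w t) x = F t x $ i"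
          using e1
        proof eventually_elim
          case (elim x)
          have "(Wt t x /\<^sub>R b x + wgrad (w t) x) $ i = F t x $ i" using elim by simp
          then show ?case by (simp add: vcomp_def wgrad_def be_def divide_inverse)
        qed
        then have "cls (\<lambda>x. be x * vcomp (Wt t) i x + wd [i] (w t) x) = Fc i t"
          unfolding Fc_def by (intro cls_cong_AE L2_add L2_mul[OF mbe] L wd1 LF t)
        then show ?thesis
          by (simp add: cls_add L2_mul[OF mbe L(2)] wd1 mul_cls[OF mbe L(2)] algebra_simps)
      qed
      have q2: "mul al (cls (wt t)) = - (\<Sum>i\<in>UNIV. dd i (Wi i t))"
      proof -
        have "AE x in lborel. al x * wt t x + wdiv (W t) x = 0"
          using e2 by (auto simp: al_def)
        then have "cls (\<lambda>x. al x * wt t x + (\<Sum>i\<in>UNIV. wd [i] (vcomp (W t) i) x)) = cls (\<lambda>x. 0)"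
          by (intro cls_cong_AE L2_add L2_mul[OF mbdd_al] L L2_sum wd2) (simp_all add: wdiv_def)
        then have "mul al (cls (wt t)) + (\<Sum>i\<in>UNIV. dd i (Wi i t)) = 0"
          by (simp add: cls_add L2_mul[OF mbdd_al L(1)] L2_sum wd2 cls_sum mul_cls[OF mbdd_al L(1)] cls_zero)
        then show ?thesis by (simp add: eq_neg_iff_add_eq_0)
      qed
      have "(Wi i has_vector_derivative cls (vcomp (Wt t) i)) (at t)" for i
        unfolding Wi_def[abs_def] by (rule H_deriv_0_vector[OF H(2) t LW(2) L(2)])
      moreover have "(ww has_vector_derivative cls (wt t)) (at t)"
        unfolding ww_def[abs_def] by (rule H_deriv_0_vector[OF H(1) t LW(1) L(1)])
      ultimately have "(E has_real_derivative (\<Sum>i\<in>UNIV. 2 * inner (Wi i t) (mul be (cls (vcomp (Wt t) i)))) + 2 * inner (ww t) (mul al (cls (wt t)))) (at t)"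
        unfolding E_def[abs_def] by (intro DERIV_add DERIV_sum quad_has_derivative[OF mbe] quad_has_derivative[OF mbdd_al])
      \<comment> \<open>The gradient in one equation and the divergence in the other are negative
        adjoints of each other. Their contributions cancel and only the source remains.\<close>
      moreover have "(\<Sum>i\<in>UNIV. 2 * inner (Wi i t) (mul be (cls (vcomp (Wt t) i)))) + 2 * inner (ww t) (mul al (cls (wt t)))
          = (\<Sum>i\<in>UNIV. 2 * inner (Wi i t) (Fc i t))"
      proof -
        have "inner (ww t) (dd i (Wi i t)) = - inner (Wi i t) (dd i (ww t))" for i
          using dd_inner[of "Wi i t" "ww t" i] s1'[OF t0] by (simp add: inner_commute)
        then show ?thesis
          unfolding q1 q2 by (simp add: inner_diff_right inner_sum_right sum_subtractf sum_distrib_left sum_negf right_diff_distrib)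
      qed
      ultimately show "(E has_real_derivative (\<Sum>i\<in>UNIV. 2 * inner (Wi i t) (Fc i t))) (at t)" by simp
    qed
  qed
  have quiet: "E r1 \<le> E r0" if r: "0 \<le> r0" "r0 \<le> r1" "{r0<..<r1} \<inter> {s0<..<s1} = {}" for r0 r1
  proof -
    have "E r1 \<le> exp (0 * (r1 - r0)) * (E r0 + 0 * (r1 - r0))"
    proof (rule gronwall_lipr[OF r(2) order_refl Elip[OF r(1)]])
      show "AE t in lborel. t \<in> {r0<..<r1} \<longrightarrow> (\<exists>D. (E has_real_derivative D) (at t) \<and> D \<le> 0 * E t + 0 * exp (0 * (t - r0)))"
        using Eder
      proof eventually_elim
        case (elim t)
        show ?case
        proof
          assume t: "t \<in> {r0<..<r1}"
          then have "t > 0" "t \<notin> {s0<..<s1}" using r by auto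
          then have "Fc i t = 0" for i unfolding Fc_def by (rule F0)
          then have "(E has_real_derivative 0) (at t)" using elim \<open>t > 0\<close> by simp
          then show "\<exists>D. (E has_real_derivative D) (at t) \<and> D \<le> 0 * E t + 0 * exp (0 * (t - r0))" by auto
        qed
      qed
    qed
    then show ?thesis by simp
  qed
  define d where "d = s1 - s0"
  have d: "d > 0" using s by (simp add: d_def)
  define Z where "Z = b_hi * real CARD('n) * \<rho>\<^sup>2"
  have Z0: "Z \<ge> 0" using b_hi_pos by (simp add: Z_def)
  have EZ: "E r \<le> 0" if "0 \<le> r" "r \<le> s0" for r
    using quiet[of 0 r] that E0 by auto
  have loud: "E r \<le> exp 1 * Z * d\<^sup>2" if r: "s0 \<le> r" "r \<le> s1" "r \<le> Tm" for r
  proof -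
    have "E r \<le> exp ((1 / d) * (r - s0)) * (E s0 + (d * Z) * (r - s0))"
    proof (rule gronwall_lipr[OF r(1) _ Elip[OF s(1)]])
      show "0 \<le> 1 / d" using d by simp
      show "AE t in lborel. t \<in> {s0<..<r} \<longrightarrow> (\<exists>D. (E has_real_derivative D) (at t) \<and> D \<le> 1 / d * E t + d * Z * exp (1 / d * (t - s0)))"
        using Eder
      proof eventually_elim
        case (elim t)
        show ?case
        proof
          assume t: "t \<in> {s0<..<r}"
          then have tt: "t > 0" "t \<in> {s0<..<s1}" "t \<le> Tm" using r s by auto
          have "(\<Sum>i\<in>UNIV. 2 * inner (Wi i t) (Fc i t)) \<le> (\<Sum>i\<in>UNIV. 1 / d * (1 / b_hi * (norm (Wi i t))\<^sup>2) + d * (b_hi * \<rho>\<^sup>2))"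
          proof (rule sum_mono)
            fix i
            \<comment> \<open>The weight is chosen so that the first term is \<open>1 / d\<close>
              times a part of the energy; the source then appears with the small factor
              \<open>d\<close>.\<close>
            have "2 * inner (Wi i t) (Fc i t) \<le> (1 / (d * b_hi)) * (norm (Wi i t))\<^sup>2 + (norm (Fc i t))\<^sup>2 / (1 / (d * b_hi))"
              using d b_hi_pos by (intro young_inner) simp
            also have "(norm (Fc i t))\<^sup>2 / (1 / (d * b_hi)) \<le> \<rho>\<^sup>2 / (1 / (d * b_hi))"
              using F1[OF tt(2,3), of i] d b_hi_pos unfolding Fc_def by (intro divide_right_mono power_mono) auto
            finally show "2 * inner (Wi i t) (Fc i t) \<le> 1 / d * (1 / b_hi * (norm (Wi i t))\<^sup>2) + d * (b_hi * \<rho>\<^sup>2)"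
              by (simp add: mult_ac)
          qed
          also have "\<dots> = 1 / d * (\<Sum>i\<in>UNIV. 1 / b_hi * (norm (Wi i t))\<^sup>2) + d * Z"
            by (simp add: sum.distrib sum_distrib_left Z_def)
          also have "\<dots> \<le> 1 / d * E t + d * Z * exp (1 / d * (t - s0))"
          proof (rule add_mono)
            have "0 \<le> 1 / a_hi * (norm (ww t))\<^sup>2" using a_hi_pos by simp
            then have "(\<Sum>i\<in>UNIV. 1 / b_hi * (norm (Wi i t))\<^sup>2) \<le> E t" using Elow[of t] by linarith
            then show "1 / d * (\<Sum>i\<in>UNIV. 1 / b_hi * (norm (Wi i t))\<^sup>2) \<le> 1 / d * E t"
              using d by (intro mult_left_mono) auto
            have "d * Z * 1 \<le> d * Z * exp (1 / d * (t - s0))"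
              using d Z0 t by (intro mult_left_mono) auto
            then show "d * Z \<le> d * Z * exp (1 / d * (t - s0))" by simp
          qed
          finally show "\<exists>D. (E has_real_derivative D) (at t) \<and> D \<le> 1 / d * E t + d * Z * exp (1 / d * (t - s0))"
            using elim tt(1) by blast
        qed
      qed
    qed
    also have "\<dots> \<le> exp 1 * (d * Z * d)"
    proof (rule mult_mono)
      show "exp (1 / d * (r - s0)) \<le> exp 1" using r d by (simp add: d_def)
      have "d * Z * (r - s0) \<le> d * Z * d" using r d Z0 by (intro mult_left_mono) (auto simp: d_def)
      then show "E s0 + d * Z * (r - s0) \<le> d * Z * d" using EZ[of s0] s by linarith
      have "0 \<le> E s0"
        using a_hi_pos b_hi_pos by (intro order_trans[OF _ Elow] add_nonneg_nonneg sum_nonneg) auto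
      then show "0 \<le> E s0 + d * Z * (r - s0)" using d Z0 r by (intro add_nonneg_nonneg) auto
    qed simp
    finally show ?thesis by (simp add: power2_eq_square mult_ac)
  qed
  have nn: "0 \<le> exp 1 * Z * d\<^sup>2" using Z0 by simp
  consider "t \<le> s0" | "s0 \<le> t" "t \<le> s1" | "s1 \<le> t" by linarith
  then have "E t \<le> exp 1 * Z * d\<^sup>2"
  proof cases
    case 1 then show ?thesis using EZ[of t] t nn by auto
  next
    case 2 then show ?thesis using loud[of t] t by auto
  next
    case 3
    then have "E t \<le> E s1" using s t by (intro quiet) auto
    then show ?thesis using loud[of s1] 3 s t by auto
  qed
  then show ?thesis using Elow[of t] unfolding Wi_def ww_def Z_def d_def by linarith
qed

end

section \<open>The instantaneous time mirror\<close>

lemma eta_off: "t \<notin> {T - \<epsilon> / 2<..<T + \<epsilon> / 2} \<Longrightarrow> eta eta0 T \<epsilon> t = 0"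
  unfolding eta_def greaterThanLessThan_iff by (rule if_not_P) linarith

lemma eta_on: "t \<in> {T - \<epsilon> / 2<..<T + \<epsilon> / 2} \<Longrightarrow> eta eta0 T \<epsilon> t = eta0 / \<epsilon>"
  unfolding eta_def greaterThanLessThan_iff by (rule if_P) linarith

text \<open>The time and the width of the pulse are not parameters: the constants are chosen before
  them, so they stay quantified inside the lemmas.\<close>

locale mirror = 
  fixes a b chi :: "real^'n::finite \<Rightarrow> real" and eta0 a_lo a_hi b_lo b_hi :: real
  assumes eta0: "eta0 > 0" and sa: "smooth_bdd a" and sb: "smooth_bdd b" and sc: "smooth_bdd chi"
    and lo: "a_lo > 0" "b_lo > 0" and abd: "\<forall>x. a_lo \<le> a x \<and> a x \<le> a_hi"
    and bbd: "\<forall>x. b_lo \<le> b x \<and> b x \<le> b_hi" and chi_nonneg: "\<forall>x. chi x \<ge> 0"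
begin

sublocale wave_coeffs a b "\<lambda>x. b x * chi x" a_lo a_hi b_lo
proof
  show "0 \<le> b x * chi x" for x
    using bbd chi_nonneg lo by (metis less_imp_le mult_nonneg_nonneg order_trans)
qed (use sa sb sc lo abd bbd smooth_bdd_mult in auto)

text \<open>On the interior of each of the three intervals \<open>eta\<close> is constant, and
  \<open>\<epsilon> \<le> T\<close> keeps the first switching time nonnegative.\<close>

lemma mirror_phases:
  assumes W: "wave_sol a b (\<lambda>t x. 1 + chi x * eta eta0 T \<epsilon> t) u0 u1 u v" and e: "0 < \<epsilon>" "\<epsilon> \<le> T"
  shows "wave_on a b 0 (T - \<epsilon> / 2) (\<lambda>t. cls (u t)) (\<lambda>t. cls (v t))"
    and "wave_on a (bk (eta0 / \<epsilon>)) (T - \<epsilon> / 2) (T + \<epsilon> / 2) (\<lambda>t. cls (u t)) (\<lambda>t. cls (v t))"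
    and "wave_on a b (T + \<epsilon> / 2) s (\<lambda>t. cls (u t)) (\<lambda>t. cls (v t))"
proof -
  note w = wave_sol_wave_on[OF W sa]
  have "T - \<epsilon> / 2 \<ge> 0" "T + \<epsilon> / 2 \<ge> 0" using e by auto
  then show "wave_on a b 0 (T - \<epsilon> / 2) (\<lambda>t. cls (u t)) (\<lambda>t. cls (v t))"
    "wave_on a (bk (eta0 / \<epsilon>)) (T - \<epsilon> / 2) (T + \<epsilon> / 2) (\<lambda>t. cls (u t)) (\<lambda>t. cls (v t))"
    "wave_on a b (T + \<epsilon> / 2) s (\<lambda>t. cls (u t)) (\<lambda>t. cls (v t))"
    by (intro w sb smooth_bk; simp add: eta_on eta_off algebra_simps)+
qed

lemma free_phase:
  assumes W: "wave_sol a b (\<lambda>t x. 1) u0 u1 u v"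
  shows "wave_on a b 0 s (\<lambda>t. cls (u t)) (\<lambda>t. cls (v t))"
  by (rule wave_sol_wave_on[OF W sa sb]) simp_all

lemma mirror_estimate:
  assumes Tm: "Tm > 0"
  shows "\<exists>C\<ge>0. \<forall>T \<epsilon> u0 u1 u v t. 0 < \<epsilon> \<longrightarrow> \<epsilon> \<le> T \<longrightarrow> sobolev 3 u0 \<longrightarrow> sobolev 2 u1 \<longrightarrow>
     wave_sol a b (\<lambda>t x. 1 + chi x * eta eta0 T \<epsilon> t) u0 u1 u v \<longrightarrow> t \<in> {0..Tm} \<longrightarrow>
     nn 2 (cls (u t)) + nn 1 (cls (v t)) \<le> C * (nn 3 (cls u0) + nn 2 (cls u1))"
proof -
  obtain C where C: "C \<ge> 0" "\<And>s0 s1 kap u v t. 0 \<le> s0 \<Longrightarrow> s0 \<le> s1 \<Longrightarrow> kap \<ge> 0 \<Longrightarrow> kap * (s1 - s0) \<le> eta0 \<Longrightarrow>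
    wave_on a b 0 s0 u v \<Longrightarrow> wave_on a (bk kap) s0 s1 u v \<Longrightarrow> (\<And>s. wave_on a b s1 s u v) \<Longrightarrow>
    sob 2 (v 0) \<Longrightarrow> t \<in> {0..Tm} \<Longrightarrow> nn 2 (u t) + nn 1 (v t) \<le> C * (nn 3 (u 0) + nn 2 (v 0))"
    using three_phase_estimate[OF Tm, of eta0] by blast
  have "nn 2 (cls (u t)) + nn 1 (cls (v t)) \<le> C * (nn 3 (cls u0) + nn 2 (cls u1))"
    if e: "0 < \<epsilon>" "\<epsilon> \<le> T" and d: "sobolev 3 u0" "sobolev 2 u1"
      and W: "wave_sol a b (\<lambda>t x. 1 + chi x * eta eta0 T \<epsilon> t) u0 u1 u v" and t: "t \<in> {0..Tm}" for T \<epsilon> u0 u1 u v t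
  proof -
    have i: "cls (u 0) = cls u0" "cls (v 0) = cls u1"
      using wave_sol_init[OF W] d sobolev_L2 by blast+
    have "nn 2 (cls (u t)) + nn 1 (cls (v t)) \<le> C * (nn 3 (cls (u 0)) + nn 2 (cls (v 0)))"
    \<comment> \<open>Amplitude \<open>eta0 / \<epsilon>\<close> times duration
      \<open>\<epsilon>\<close> is \<open>eta0\<close>, the only quantity of the pulse that enters
      the constant.\<close>
    proof (rule C(2)[where kap = "eta0 / \<epsilon>", OF _ _ _ _ mirror_phases[OF W e] _ t])
      show "sob 2 (cls (v 0))" unfolding i by (rule sobolev_sob[OF d(2)])
      show "eta0 / \<epsilon> * (T + \<epsilon> / 2 - (T - \<epsilon> / 2)) \<le> eta0" using e by (simp add: field_simps)
    qed (use e eta0 in auto)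
    then show ?thesis by (simp only: i)
  qed
  then show ?thesis using C(1) by blast
qed

text \<open>The times \<open>t1\<close> and \<open>t2\<close> are independent, so each of the two
  norms is bounded on its own; this is the origin of the factor 2 in the constant.\<close>

lemma regularity_bound:
  assumes Tm: "Tm > 0"
  shows "\<exists>C. \<forall>T \<epsilon> u0 u1 u v.
        T > 0 \<and> 0 < \<epsilon> \<and> \<epsilon> \<le> T \<and> sobolev 3 u0 \<and> sobolev 2 u1 \<and>
        wave_sol a b (\<lambda>t x. 1 + chi x * eta eta0 T \<epsilon> t) u0 u1 u v \<longrightarrow>
        (\<forall>t1\<in>{0..Tm}. \<forall>t2\<in>{0..Tm}.
           Hnorm 2 (u t1) + Hnorm 1 (v t2) \<le> C * Hnorm 3 u0 + C * Hnorm 2 u1)"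
proof -
  obtain C where C: "C \<ge> 0" "\<And>T \<epsilon> u0 u1 u v t. 0 < \<epsilon> \<Longrightarrow> \<epsilon> \<le> T \<Longrightarrow> sobolev 3 u0 \<Longrightarrow> sobolev 2 u1 \<Longrightarrow>
     wave_sol a b (\<lambda>t x. 1 + chi x * eta eta0 T \<epsilon> t) u0 u1 u v \<Longrightarrow> t \<in> {0..Tm} \<Longrightarrow>
     nn 2 (cls (u t)) + nn 1 (cls (v t)) \<le> C * (nn 3 (cls u0) + nn 2 (cls u1))"
    using mirror_estimate[OF Tm] by blast
  have "Hnorm 2 (u t1) + Hnorm 1 (v t2) \<le> (2 * sqrt C) * Hnorm 3 u0 + (2 * sqrt C) * Hnorm 2 u1"
    if e: "0 < \<epsilon>" "\<epsilon> \<le> T" and d: "sobolev 3 u0" "sobolev 2 u1"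
      and W: "wave_sol a b (\<lambda>t x. 1 + chi x * eta eta0 T \<epsilon> t) u0 u1 u v"
      and t: "t1 \<in> {0..Tm}" "t2 \<in> {0..Tm}" for T \<epsilon> u0 u1 u v t1 t2
  proof -
    let ?h = "Hnorm 3 u0 + Hnorm 2 u1"
    have h: "nn 3 (cls u0) + nn 2 (cls u1) \<le> ?h\<^sup>2"
      by (simp add: Hnorm_sq[OF d(1), symmetric] Hnorm_sq[OF d(2), symmetric] power2_sum)
    have le: "x \<le> sqrt C * ?h" if "x\<^sup>2 \<le> C * (nn 3 (cls u0) + nn 2 (cls u1))" for x
    proof -
      have "x\<^sup>2 \<le> (sqrt C * ?h)\<^sup>2"
        using that mult_left_mono[OF h C(1)] C(1) by (simp add: power_mult_distrib)
      then show ?thesis by (rule power2_le_imp_le) (simp add: C(1))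
    qed
    have s: "sobolev 2 (u t1)" "sobolev 1 (v t2)"
      using wave_sol_sobolev[OF W] t sobolev_mono[of 3 "u t1" 2] by auto
    have "Hnorm 2 (u t1) \<le> sqrt C * ?h"
      using C(2)[OF e d W t(1)] nn_nonneg[of 1 "cls (v t1)"] unfolding Hnorm_sq[OF s(1), symmetric] by (intro le) linarith
    moreover have "Hnorm 1 (v t2) \<le> sqrt C * ?h"
      using C(2)[OF e d W t(2)] nn_nonneg[of 2 "cls (u t2)"] unfolding Hnorm_sq[OF s(2), symmetric] by (intro le) linarith
    ultimately have "Hnorm 2 (u t1) + Hnorm 1 (v t2) \<le> sqrt C * ?h + sqrt C * ?h" by (rule add_mono)
    also have "\<dots> = (2 * sqrt C) * Hnorm 3 u0 + (2 * sqrt C) * Hnorm 2 u1" by (simp add: algebra_simps)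
    finally show ?thesis .
  qed
  then show ?thesis by (intro exI[of _ "2 * sqrt C"]) blast
qed

text \<open>The pulse may start or end after \<open>Tm\<close>. The claim is restricted to times up
  to \<open>Tm\<close>, where \<open>bnd\<close> is available.\<close>

lemma gradient_difference:
  assumes e: "0 < \<epsilon>" "\<epsilon> \<le> T"
    and W: "wave_sol a b (\<lambda>t x. 1 + chi x * eta eta0 T \<epsilon> t) u0 u1 u v" "wave_sol a b (\<lambda>t x. 1) u0 u1 U V"
    and d: "L2 u0" "L2 u1" and K: "K \<ge> 0"
    and bnd: "\<And>t. t \<in> {0..Tm} \<Longrightarrow> norm (dd i (cls (v t)) - dd i (cls (V t))) \<le> K"
    and t: "t \<in> {T - \<epsilon> / 2..T + \<epsilon> / 2}" "t \<le> Tm"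
  shows "norm (dd i (cls (u t) - cls (U t))) \<le> K * \<epsilon>"
proof -
  let ?s = "T - \<epsilon> / 2"
  have s0: "?s \<ge> 0" using e by simp
  define r where "r t = dd i (cls (u t)) - dd i (cls (U t))" for t
  have sb1: "sob (Suc 0) (cls (u t))" "sob (Suc 0) (cls (U t))" if "t \<ge> 0" for t
    using sob_3_imp(2)[OF sobolev_sob[OF wave_sol_sobolev(1)[OF W(1) that]]]
      sob_3_imp(2)[OF sobolev_sob[OF wave_sol_sobolev(1)[OF W(2) that]]] by simp_all
  have req: "dd i (cls (u t) - cls (U t)) = r t" if "t \<ge> 0" for t
    unfolding r_def by (rule dd_diff[OF sb1[OF that]])
  have "dd i (cls (u ?s) - cls (U ?s)) = 0"
    using wave_sol_init[OF W(1) d] wave_sol_init[OF W(2) d]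
    by (intro wave_on_unique[OF mirror_phases(1)[OF W(1) e] free_phase[OF W(2)] s0]) simp_all
  then have r0: "r ?s = 0" using req[OF s0] by simp
  have der: "(r has_vector_derivative dd i (cls (v x)) - dd i (cls (V x))) (at x within {0..})" if "x \<in> {?s..t}" for x
    unfolding r_def[abs_def] using that s0
    by (intro has_vector_derivative_diff wave_sol_deriv(2)[OF W(1)] wave_sol_deriv(2)[OF W(2)]) simp_all
  have bnd': "norm (dd i (cls (v x)) - dd i (cls (V x))) \<le> K" if "x \<in> {?s..t}" for x
    using that t s0 by (intro bnd) simp
  have "norm (r t - r ?s) \<le> K * \<bar>t - ?s\<bar>"
    by (rule lipr_of_derivative[of ?s t r "\<lambda>x. dd i (cls (v x)) - dd i (cls (V x))" K])
      (use der s0 bnd' K t in auto)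
  also have "\<dots> \<le> K * \<epsilon>" using t K by (intro mult_left_mono) auto
  finally show ?thesis using r0 req[of t] t s0 by simp
qed

lemma corrector_bound:
  assumes Tm: "Tm > 0" and d: "sobolev 3 u0" "sobolev 2 u1"
  shows "\<exists>C. \<forall>T \<epsilon> u v U V W w.
           T > 0 \<and> 0 < \<epsilon> \<and> \<epsilon> \<le> T \<and>
           wave_sol a b (\<lambda>t x. 1 + chi x * eta eta0 T \<epsilon> t) u0 u1 u v \<and>
           wave_sol a b (\<lambda>t x. 1) u0 u1 U V \<and>
           fo_sol a b
             (\<lambda>t x. \<chi> i. - (chi x * eta eta0 T \<epsilon> t * wd [i] (\<lambda>y. u t y - U t y) x)) W w
           \<longrightarrow>
           (\<forall>t1\<in>{0..Tm}. \<forall>t2\<in>{0..Tm}.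
              Hm1norm_vec (W t1) + L2norm (w t2) \<le> C * \<epsilon>)"
proof -
  have b_hi_pos: "b_hi > 0" using lo(2) bbd by (meson order_less_le_trans)
  obtain C1 where C1: "C1 \<ge> 0" "\<And>T \<epsilon> u0 u1 u v t. 0 < \<epsilon> \<Longrightarrow> \<epsilon> \<le> T \<Longrightarrow> sobolev 3 u0 \<Longrightarrow> sobolev 2 u1 \<Longrightarrow>
     wave_sol a b (\<lambda>t x. 1 + chi x * eta eta0 T \<epsilon> t) u0 u1 u v \<Longrightarrow> t \<in> {0..Tm} \<Longrightarrow>
     nn 2 (cls (u t)) + nn 1 (cls (v t)) \<le> C1 * (nn 3 (cls u0) + nn 2 (cls u1))"
    using mirror_estimate[OF Tm] by blast
  obtain C2 where C2: "C2 \<ge> 0" "\<And>u v t. 0 \<le> t \<Longrightarrow> t \<le> Tm \<Longrightarrow> wave_on a b 0 t u v \<Longrightarrow> nn 2 (u t) + nn 1 (v t) \<le> C2 * (nn 2 (u 0) + nn 1 (v 0))"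
    using free_estimate by blast
  obtain Kc where Kc: "mbdd chi Kc" by (rule smooth_bdd_mbdd[OF sc])
  have Kc0: "Kc \<ge> 0" by (rule mbdd_nonneg[OF Kc])
  \<comment> \<open>Bounds the gradient of the difference of the velocities by the triangle
    inequality: the first summand comes from \<open>mirror_estimate\<close>, the second from
    \<open>free_estimate\<close>.\<close>
  define K where "K = sqrt (C1 * (nn 3 (cls u0) + nn 2 (cls u1))) + sqrt (C2 * (nn 2 (cls u0) + nn 1 (cls u1)))"
  have K0: "K \<ge> 0" using C1(1) C2(1) by (simp add: K_def)
  \<comment> \<open>The size of the source while the mirror acts: the amplitude
    \<open>eta0 / \<epsilon>\<close> meets the gradient bound \<open>K * \<epsilon>\<close>, and the
    width cancels.\<close>
  define \<rho> where "\<rho> = eta0 * Kc * K"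
  have \<rho>0: "\<rho> \<ge> 0" using eta0 Kc0 K0 by (simp add: \<rho>_def)
  define Y where "Y = exp 1 * (b_hi * real CARD('n) * \<rho>\<^sup>2)"
  have Y0: "Y \<ge> 0" using b_hi_pos by (simp add: Y_def)
  have L: "L2 u0" "L2 u1" using d sobolev_L2 by blast+
  \<comment> \<open>The square roots undo the weights \<open>1 / b_hi\<close> and
    \<open>1 / a_hi\<close> of the first-order energy. The components of \<open>W\<close> are
    bounded one at a time, which costs a factor equal to the dimension.\<close>
  have "Hm1norm_vec (W t1) + L2norm (w t2) \<le> (real CARD('n) * sqrt (b_hi * Y) + sqrt (a_hi * Y)) * \<epsilon>"
    if e: "0 < \<epsilon>" "\<epsilon> \<le> T" 
      and W: "wave_sol a b (\<lambda>t x. 1 + chi x * eta eta0 T \<epsilon> t) u0 u1 u v" "wave_sol a b (\<lambda>t x. 1) u0 u1 U V"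
      and fo: "fo_sol a b (\<lambda>t x. \<chi> i. - (chi x * eta eta0 T \<epsilon> t * wd [i] (\<lambda>y. u t y - U t y) x)) W w"
      and t: "t1 \<in> {0..Tm}" "t2 \<in> {0..Tm}" for T \<epsilon> u v U V W w t1 t2
  proof -
    let ?F = "\<lambda>t x. (\<chi> i. - (chi x * eta eta0 T \<epsilon> t * wd [i] (\<lambda>y. u t y - U t y) x)) :: real^'n"
    let ?s0 = "T - \<epsilon> / 2" and ?s1 = "T + \<epsilon> / 2"
    have vV: "norm (dd i (cls (v r)) - dd i (cls (V r))) \<le> K" if r: "r \<in> {0..Tm}" for r i
    proof -
      have "(norm (dd i (cls (v r))))\<^sup>2 \<le> C1 * (nn 3 (cls u0) + nn 2 (cls u1))"
        using C1(2)[OF e d W(1) r] nn_dd_le_num(3)[of i "cls (v r)"] nn_nonneg[of 2 "cls (u r)"] by linarith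
      then have 1: "norm (dd i (cls (v r))) \<le> sqrt (C1 * (nn 3 (cls u0) + nn 2 (cls u1)))" by (rule real_le_rsqrt)
      have "nn 2 (cls (U r)) + nn 1 (cls (V r)) \<le> C2 * (nn 2 (cls (U 0)) + nn 1 (cls (V 0)))"
        by (rule C2(2)[OF _ _ free_phase[OF W(2)]]) (use r in auto)
      then have "(norm (dd i (cls (V r))))\<^sup>2 \<le> C2 * (nn 2 (cls u0) + nn 1 (cls u1))"
        using nn_dd_le_num(3)[of i "cls (V r)"] nn_nonneg[of 2 "cls (U r)"]
        unfolding wave_sol_init[OF W(2) L] by linarith
      then have 2: "norm (dd i (cls (V r))) \<le> sqrt (C2 * (nn 2 (cls u0) + nn 1 (cls u1)))" by (rule real_le_rsqrt)
      show ?thesis unfolding K_def by (rule order_trans[OF norm_triangle_ineq4 add_mono[OF 1 2]])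
    qed
    have wdr: "L2 (wd [i] (\<lambda>y. u r y - U r y))" "cls (wd [i] (\<lambda>y. u r y - U r y)) = dd i (cls (u r) - cls (U r))"
      if "r \<ge> 0" for r i
    proof -
      note s3 = wave_sol_sobolev(1)[OF W(1) that] wave_sol_sobolev(1)[OF W(2) that]
      have "sobolev (Suc 0) (\<lambda>y. u r y - U r y)"
        by (rule sobolev_mono[OF sobolev_diff[OF s3]]) simp
      then show "L2 (wd [i] (\<lambda>y. u r y - U r y))" "cls (wd [i] (\<lambda>y. u r y - U r y)) = dd i (cls (u r) - cls (U r))"
        using sobolev_dd[of 0 "\<lambda>y. u r y - U r y" i] sobolev_L2[OF s3(1)] sobolev_L2[OF s3(2)]
        by (simp_all add: cls_diff)
    qed
    have LF: "L2 (\<lambda>x. ?F r x $ i)" and cF: "cls (\<lambda>x. ?F r x $ i) = (- eta eta0 T \<epsilon> r) *\<^sub>R mul chi (dd i (cls (u r) - cls (U r)))"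
      if "r > 0" for r i
    proof -
      note q = wdr[OF less_imp_le[OF that], of i]
      have eq: "(\<lambda>x. ?F r x $ i) = (\<lambda>x. (- eta eta0 T \<epsilon> r) * (chi x * wd [i] (\<lambda>y. u r y - U r y) x))"
        by (simp add: mult_ac)
      show "L2 (\<lambda>x. ?F r x $ i)" unfolding eq by (intro L2_scale L2_mul[OF Kc] q)
      show "cls (\<lambda>x. ?F r x $ i) = (- eta eta0 T \<epsilon> r) *\<^sub>R mul chi (dd i (cls (u r) - cls (U r)))"
        unfolding eq cls_scale[OF L2_mul[OF Kc q(1)]] mul_cls[OF Kc q(1), symmetric] q(2) ..
    qed
    have FO: "(\<Sum>i\<in>UNIV. 1 / b_hi * (norm (cls (vcomp (W r) i)))\<^sup>2) + 1 / a_hi * (norm (cls (w r)))\<^sup>2 \<le> Y * \<epsilon>\<^sup>2"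
      if r: "r \<in> {0..Tm}" for r
    proof -
      have "(\<Sum>i\<in>UNIV. 1 / b_hi * (norm (cls (vcomp (W r) i)))\<^sup>2) + 1 / a_hi * (norm (cls (w r)))\<^sup>2
        \<le> exp 1 * (b_hi * real CARD('n) * \<rho>\<^sup>2) * (?s1 - ?s0)\<^sup>2"
      proof (rule first_order_estimate[OF fo _ _ _ LF _ _ r])
        show "b x \<le> b_hi" for x using bbd by simp
        show "cls (\<lambda>x. ?F t x $ i) = 0" if "t > 0" "t \<notin> {?s0<..<?s1}" for t i
          using cF[OF that(1), of i] eta_off[OF that(2)] by simp
        show "norm (cls (\<lambda>x. ?F t x $ i)) \<le> \<rho>" if t: "t \<in> {?s0<..<?s1}" "t \<le> Tm" for t i
        proof -
          have tp: "t > 0" using t e by auto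
          have "norm (cls (\<lambda>x. ?F t x $ i)) = eta0 / \<epsilon> * norm (mul chi (dd i (cls (u t) - cls (U t))))"
            using cF[OF tp, of i] eta_on[OF t(1)] eta0 e by simp
          also have "\<dots> \<le> eta0 / \<epsilon> * (Kc * (K * \<epsilon>))"
          proof (intro mult_left_mono order_trans[OF norm_mul_le[OF Kc]] mult_left_mono Kc0)
            show "norm (dd i (cls (u t) - cls (U t))) \<le> K * \<epsilon>"
              by (rule gradient_difference[OF e W L K0 vV]) (use t in auto)
          qed (use eta0 e in auto)
          also have "\<dots> = \<rho>" using e by (simp add: \<rho>_def)
          finally show ?thesis .
        qed
      qed (use e in auto)
      also have "?s1 - ?s0 = \<epsilon>" by simp
      finally show ?thesis by (simp only: Y_def)
    qed
    have LWw: "L2 (w t2)" "\<And>i. L2 (vcomp (W t1) i)"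
      using fo t sobolev_L2 unfolding fo_sol_def by (meson atLeastAtMost_iff)+
    have Wb: "norm (cls (vcomp (W t1) i)) \<le> sqrt (b_hi * Y) * \<epsilon>" for i
    proof -
      have "1 / b_hi * (norm (cls (vcomp (W t1) i)))\<^sup>2 \<le> (\<Sum>i\<in>UNIV. 1 / b_hi * (norm (cls (vcomp (W t1) i)))\<^sup>2)"
        using b_hi_pos by (intro member_le_sum[where f = "\<lambda>i. 1 / b_hi * (norm (cls (vcomp (W t1) i)))\<^sup>2"]) auto
      also have "\<dots> \<le> Y * \<epsilon>\<^sup>2"
      proof -
        have "0 \<le> 1 / a_hi * (norm (cls (w t1)))\<^sup>2" using a_hi_pos by simp
        then show ?thesis using FO[OF t(1)] by linarith
      qed
      finally have "(norm (cls (vcomp (W t1) i)))\<^sup>2 \<le> b_hi * Y * \<epsilon>\<^sup>2" using b_hi_pos by (simp add: field_simps)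
      also have "\<dots> = (sqrt (b_hi * Y) * \<epsilon>)\<^sup>2" using b_hi_pos Y0 by (simp add: power_mult_distrib)
      finally show ?thesis by (rule power2_le_imp_le) (use b_hi_pos Y0 e in auto)
    qed
    have wb: "norm (cls (w t2)) \<le> sqrt (a_hi * Y) * \<epsilon>"
    proof -
      have "0 \<le> (\<Sum>i\<in>UNIV. 1 / b_hi * (norm (cls (vcomp (W t2) i)))\<^sup>2)"
        using b_hi_pos by (intro sum_nonneg) auto
      then have "1 / a_hi * (norm (cls (w t2)))\<^sup>2 \<le> Y * \<epsilon>\<^sup>2" using FO[OF t(2)] by linarith
      then have "(norm (cls (w t2)))\<^sup>2 \<le> a_hi * Y * \<epsilon>\<^sup>2" using a_hi_pos by (simp add: field_simps)
      also have "\<dots> = (sqrt (a_hi * Y) * \<epsilon>)\<^sup>2" using a_hi_pos Y0 by (simp add: power_mult_distrib)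
      finally show ?thesis by (rule power2_le_imp_le) (use a_hi_pos Y0 e in auto)
    qed
    have "Hm1norm_vec (W t1) \<le> (\<Sum>i\<in>(UNIV::'n set). sqrt (b_hi * Y) * \<epsilon>)"
      unfolding Hm1norm_vec_def by (intro sum_mono order_trans[OF Hm1norm_le[OF LWw(2)] Wb])
    moreover have "L2norm (w t2) \<le> sqrt (a_hi * Y) * \<epsilon>" using wb by (simp add: norm_cls LWw(1))
    ultimately show ?thesis by (simp add: distrib_right)
  qed
  then show ?thesis by blast
qed

end

theorem theorem1:
  fixes a b chi :: "real^'n::finite \<Rightarrow> real"
    and eta0 a_lo a_hi b_lo b_hi :: real
  assumes "eta0 > 0"
    and "smooth_bdd a" and "smooth_bdd b" and "smooth_bdd chi"
    and "a_lo > 0" and "b_lo > 0"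
    and "\<forall>x. a_lo \<le> a x \<and> a x \<le> a_hi"
    and "\<forall>x. b_lo \<le> b x \<and> b x \<le> b_hi"
    and "\<forall>x. chi x \<ge> 0"
  shows
    "(\<forall>\<tau>>0. \<exists>C. \<forall>T \<epsilon> u0 u1 u v.
        T > 0 \<and> 0 < \<epsilon> \<and> \<epsilon> \<le> T \<and> sobolev 3 u0 \<and> sobolev 2 u1 \<and>
        wave_sol a b (\<lambda>t x. 1 + chi x * eta eta0 T \<epsilon> t) u0 u1 u v \<longrightarrow>
        (\<forall>t1\<in>{0..\<tau>}. \<forall>t2\<in>{0..\<tau>}.
           Hnorm 2 (u t1) + Hnorm 1 (v t2) \<le> C * Hnorm 3 u0 + C * Hnorm 2 u1))
     \<and>
     (\<forall>\<tau>>0. \<forall>u0 u1. sobolev 3 u0 \<and> sobolev 2 u1 \<longrightarrow>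
        (\<exists>C. \<forall>T \<epsilon> u v U V W w.
           T > 0 \<and> 0 < \<epsilon> \<and> \<epsilon> \<le> T \<and>
           wave_sol a b (\<lambda>t x. 1 + chi x * eta eta0 T \<epsilon> t) u0 u1 u v \<and>
           wave_sol a b (\<lambda>t x. 1) u0 u1 U V \<and>
           fo_sol a b
             (\<lambda>t x. \<chi> i. - (chi x * eta eta0 T \<epsilon> t * wd [i] (\<lambda>y. u t y - U t y) x)) W w
           \<longrightarrow>
           (\<forall>t1\<in>{0..\<tau>}. \<forall>t2\<in>{0..\<tau>}.
              Hm1norm_vec (W t1) + L2norm (w t2) \<le> C * \<epsilon>)))"
proof -
  interpret mirror a b chi eta0 a_lo a_hi b_lo b_hi
    by standard (use assms in auto)
  show ?thesis
    by (intro conjI allI impI) (rule regularity_bound, assumption, rule corrector_bound, auto)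
qed

end
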